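(* Let $\Gamma$ be an Abelian group, let $(X,\Gamma)$ be a minimal metric dynamical system and let $\phi:(X,\Gamma)\to(Y,\Gamma)$ be its maximal equicontinuous factor. Suppose further that $Y$ is infinite and that there is a diagram of homomorphisms of dynamical systems $$(X,\Gamma)\overset{\pi}{\to}(Y^*,\Gamma)\overset{\theta}{\to}(Y,\Gamma),$$ where $\pi$ is an isometric extension, $\theta$ is an almost 1-1 extension and $\phi=\theta\circ\pi$. For every $y^*\in Y^*$ the fiber $\pi^{-1}(y^* )$ has the structure of a homogeneous space of a compact Hausdorff topological group; let $\lambda_{y^*}$ be the corresponding Haar measure on this fiber. (Thus $\pi$ is an open extension having a relatively invariant measure, and $y^*\mapsto\lambda_{y^*}$, $Y^*\to\mathfrak{M}(X)$, is the corresponding continuous section.) Let $\Lambda:\mathfrak{M}(Y^* )\to\mathfrak{M}(X)$, defined by $$\Lambda(\nu)=\int_{Y^*}\lambda_{y^*}\,d\nu(y^* ),$$ be the associated affine injection, and set $\mathfrak{M}_m(X)=\{\Lambda(\nu):\nu\in\mathfrak{M}(Y^* )\}$. Then the set $$R=\{\nu\in\mathfrak{M}(X): \text{the } \Gamma\text{-orbit closure of }\nu\text{ in }\mathfrak{M}(X)\text{ meets }\mathfrak{M}_m(X)\}$$ is a dense $G_\delta$ subset of $\mathfrak{M}(X)$.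
   Context: A dynamical system $(X,\Gamma)$ is a compact Hausdorff space $X$ with an action of the abstract (discrete) group $\Gamma$ by homeomorphisms; it is metric if $X$ is metrizable and minimal if every orbit is dense. A homomorphism (extension, factor map) is a continuous $\Gamma$-equivariant surjection. The maximal equicontinuous factor of $(X,\Gamma)$ is the largest factor on which $\Gamma$ acts equicontinuously, i.e. every equicontinuous factor of $X$ factors through it. An extension $\pi:(X,\Gamma)\to(Y^*,\Gamma)$ of minimal systems is equicontinuous if, with $R_\pi=\{(x,x'):\pi(x)=\pi(x')\}$, for every neighborhood $\epsilon$ of the diagonal of $X\times X$ there is a neighborhood $\delta$ of the diagonal with $\gamma(\delta\cap R_\pi)\subset\epsilon$ for all $\gamma\in\Gamma$; in the metric case it is called isometric. An extension $\theta:(Y^*,\Gamma)\to(Y,\Gamma)$ of minimal metric systems is almost 1-1 if $\{y\in Y:\theta^{-1}(y)\text{ is a singleton}\}$ is a dense $G_\delta$ subset of $Y$. Haar measures on fibers: for an isometric extension $\pi:X\to Y^*$ of minimal systems there exist a minimal system $(\tilde X,\Gamma)$, a compact Hausdorff topological group $K$ acting (continuously and freely) on $\tilde X$ by automorphisms of the system, a closed subgroup $L\subset K$, and homomorphisms $\tilde\pi:\tilde X\to Y^*\cong\tilde X/K$ and $\psi:\tilde X\to X\cong\tilde X/L$ (the quotient maps) with $\tilde\pi=\pi\circ\psi$. Thus each fiber $\tilde\pi^{-1}(y^* )$ is a single $K$-orbit and $\pi^{-1}(y^* )$ is identified with a homogeneous space of $K$ (a quotient of $K$ by $L$). The measure $\lambda_{y^*}$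 is the push-forward under $\psi$ of the unique $K$-invariant Borel probability measure on $\tilde\pi^{-1}(y^* )$. $\mathfrak{M}(X)$ is the space of Borel probability measures on $X$ with the weak$^*$ topology, with the induced $\Gamma$-action. An extension $\pi:X\to Y^*$ has a relatively invariant measure (RIM) if there is a continuous $\Gamma$-equivariant map $y^*\mapsto\lambda_{y^*}$ from $Y^*$ to $\mathfrak{M}(X)$ (a section) with $\pi_*(\lambda_{y^*})=\delta_{y^*}$ for all $y^*\in Y^*$. *)

theory Defs
  imports "HOL-Probability.Probability"
begin

text \<open>
  Groups are written additively: the acting group is an \<open>ab_group_add\<close>, and
  \<open>topological_group_add\<close> (which is not assumed commutative) is used for the structure
  group of a homogeneous extension.

  Dynamical notions are stated for abstract topologies, because the maximal equicontinuous
  factor quantifies over factors, whose underlying sets are not fixed in advance.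
\<close>

class compact_metric_space = metric_space +
  assumes compact_UNIV_metric: "compact (UNIV :: 'a set)"


section \<open>Dynamical systems and extensions\<close>

definition dynamical_system :: "'a topology \<Rightarrow> ('g::group_add \<Rightarrow> 'a \<Rightarrow> 'a) \<Rightarrow> bool" where
  "dynamical_system T \<alpha> \<longleftrightarrow>
     compact_space T \<and> Hausdorff_space T \<and>
     (\<forall>g. homeomorphic_map T T (\<alpha> g)) \<and>
     (\<forall>x\<in>topspace T. \<alpha> 0 x = x) \<and>
     (\<forall>g h. \<forall>x\<in>topspace T. \<alpha> (g + h) x = \<alpha> g (\<alpha> h x))"

definition minimal_system :: "'a topology \<Rightarrow> ('g::group_add \<Rightarrow> 'a \<Rightarrow> 'a) \<Rightarrow> bool" where
  "minimal_system T \<alpha> \<longleftrightarrow>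
     dynamical_system T \<alpha> \<and>
     (\<forall>x\<in>topspace T. T closure_of range (\<lambda>g. \<alpha> g x) = topspace T)"

definition extension ::
  "'a topology \<Rightarrow> ('g \<Rightarrow> 'a \<Rightarrow> 'a) \<Rightarrow> 'b topology \<Rightarrow> ('g \<Rightarrow> 'b \<Rightarrow> 'b) \<Rightarrow> ('a \<Rightarrow> 'b) \<Rightarrow> bool" where
  "extension T \<alpha> T' \<beta> f \<longleftrightarrow>
     continuous_map T T' f \<and> f ` topspace T = topspace T' \<and>
     (\<forall>g. \<forall>x\<in>topspace T. f (\<alpha> g x) = \<beta> g (f x))"

definition diagonal_nbhd :: "'a topology \<Rightarrow> ('a \<times> 'a) set \<Rightarrow> bool" where
  "diagonal_nbhd T \<epsilon> \<longleftrightarrow>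
     \<epsilon> \<subseteq> topspace T \<times> topspace T \<and>
     (\<exists>U. openin (prod_topology T T) U \<and> Id_on (topspace T) \<subseteq> U \<and> U \<subseteq> \<epsilon>)"

definition equicontinuous_system :: "'a topology \<Rightarrow> ('g \<Rightarrow> 'a \<Rightarrow> 'a) \<Rightarrow> bool" where
  "equicontinuous_system T \<alpha> \<longleftrightarrow>
     (\<forall>\<epsilon>. diagonal_nbhd T \<epsilon> \<longrightarrow>
        (\<exists>\<delta>. diagonal_nbhd T \<delta> \<and> (\<forall>g. map_prod (\<alpha> g) (\<alpha> g) ` \<delta> \<subseteq> \<epsilon>)))"

text \<open>When \<open>T\<close> is metrizable such an extension is called isometric.\<close>

definition equicontinuous_extension ::
  "'a topology \<Rightarrow> ('g \<Rightarrow> 'a \<Rightarrow> 'a) \<Rightarrow> 'b topology \<Rightarrow> ('g \<Rightarrow> 'b \<Rightarrow> 'b) \<Rightarrow> ('a \<Rightarrow> 'b) \<Rightarrow> bool" where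
  "equicontinuous_extension T \<alpha> T' \<beta> f \<longleftrightarrow>
     extension T \<alpha> T' \<beta> f \<and>
     (\<forall>\<epsilon>. diagonal_nbhd T \<epsilon> \<longrightarrow>
        (\<exists>\<delta>. diagonal_nbhd T \<delta> \<and>
             (\<forall>g. map_prod (\<alpha> g) (\<alpha> g) ` (\<delta> \<inter> {(x, x'). f x = f x'}) \<subseteq> \<epsilon>)))"

definition almost_one_to_one_extension ::
  "'a topology \<Rightarrow> ('g \<Rightarrow> 'a \<Rightarrow> 'a) \<Rightarrow> 'b topology \<Rightarrow> ('g \<Rightarrow> 'b \<Rightarrow> 'b) \<Rightarrow> ('a \<Rightarrow> 'b) \<Rightarrow> bool" where
  "almost_one_to_one_extension T \<alpha> T' \<beta> f \<longleftrightarrow>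
     extension T \<alpha> T' \<beta> f \<and>
     (let S = {y \<in> topspace T'. is_singleton {x \<in> topspace T. f x = y}}
      in gdelta_in T' S \<and> T' closure_of S = topspace T')"

text \<open>
  The competing factors \<open>Z\<close> are topologies on subsets of the type \<open>'a\<close> of points of the
  system itself.  This covers factors living on any other type: the points of a factor can be
  represented by choosing one point in each fibre and transporting the topology.
\<close>

definition maximal_equicontinuous_factor ::
  "'a topology \<Rightarrow> ('g::group_add \<Rightarrow> 'a \<Rightarrow> 'a) \<Rightarrow> 'b topology \<Rightarrow> ('g \<Rightarrow> 'b \<Rightarrow> 'b) \<Rightarrow> ('a \<Rightarrow> 'b) \<Rightarrow> bool"
where
  "maximal_equicontinuous_factor T \<alpha> T' \<beta> f \<longleftrightarrow>
     dynamical_system T' \<beta> \<and> extension T \<alpha> T' \<beta> f \<and> equicontinuous_system T' \<beta> \<and>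
     (\<forall>(Z :: 'a topology) \<zeta> q.
        dynamical_system Z \<zeta> \<and> extension T \<alpha> Z \<zeta> q \<and> equicontinuous_system Z \<zeta> \<longrightarrow>
        (\<exists>h. extension T' \<beta> Z \<zeta> h \<and> (\<forall>x\<in>topspace T. q x = h (f x))))"


section \<open>Haar measures on the fibres of an isometric extension\<close>

text \<open>
  The presentation of \<open>\<pi> : X \<rightarrow> Y\<^sup>*\<close> by a group extension: a minimal system \<open>\<tau>\<close> on \<open>'t\<close>,
  a compact group \<open>'k\<close> acting freely on it by automorphisms via \<open>\<kappa>\<close>, and a closed subgroup
  \<open>L\<close>.  The fibres of \<open>\<psi>\<close> are the \<open>L\<close>-orbits and those of \<open>\<pi> \<circ> \<psi>\<close> the \<open>'k\<close>-orbits; since a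
  continuous surjection from a compact space onto a Hausdorff space is a quotient map, this
  says that \<open>\<psi>\<close> and \<open>\<pi> \<circ> \<psi>\<close> are the quotient maps by \<open>L\<close> and by \<open>'k\<close>.
\<close>

definition homogeneous_presentation ::
  "('g::group_add \<Rightarrow> 'x::topological_space \<Rightarrow> 'x) \<Rightarrow>
   ('g \<Rightarrow> 's::topological_space \<Rightarrow> 's) \<Rightarrow> ('x \<Rightarrow> 's) \<Rightarrow>
   ('g \<Rightarrow> 't::t2_space \<Rightarrow> 't) \<Rightarrow> ('k::{topological_group_add,t2_space} \<Rightarrow> 't \<Rightarrow> 't) \<Rightarrow>
   'k set \<Rightarrow> ('t \<Rightarrow> 'x) \<Rightarrow> bool"
where
  "homogeneous_presentation \<alpha> \<beta> \<pi> \<tau> \<kappa> L \<psi> \<longleftrightarrow>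
     minimal_system euclidean \<tau> \<and>
     compact (UNIV :: 'k set) \<and>
     continuous_on UNIV (\<lambda>(k, z). \<kappa> k z) \<and>
     (\<forall>z. \<kappa> 0 z = z) \<and> (\<forall>k k' z. \<kappa> (k + k') z = \<kappa> k (\<kappa> k' z)) \<and>
     (\<forall>k z. \<kappa> k z = z \<longrightarrow> k = 0) \<and>
     (\<forall>k g z. \<kappa> k (\<tau> g z) = \<tau> g (\<kappa> k z)) \<and>
     closed L \<and> 0 \<in> L \<and> (\<forall>k\<in>L. \<forall>k'\<in>L. k + k' \<in> L) \<and> (\<forall>k\<in>L. - k \<in> L) \<and>
     extension euclidean \<tau> euclidean \<alpha> \<psi> \<and>
     extension euclidean \<tau> euclidean \<beta> (\<pi> \<circ> \<psi>) \<and>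
     (\<forall>z z'. \<psi> z = \<psi> z' \<longleftrightarrow> (\<exists>k\<in>L. z' = \<kappa> k z)) \<and>
     (\<forall>z z'. \<pi> (\<psi> z) = \<pi> (\<psi> z') \<longleftrightarrow> (\<exists>k. z' = \<kappa> k z))"

text \<open>
  \<open>m\<close> is a Borel measure on the whole space giving full mass to the (closed) fibre.  Its
  image under \<open>\<psi>\<close> is uniquely determined when \<open>'x\<close> is metrizable, even though \<open>m\<close> is not
  required to be regular: sets \<open>\<psi> -` A\<close> with \<open>A\<close> Borel are then Baire sets of \<open>'t\<close>, and an
  invariant probability measure is unique on the Baire sets of an orbit.
\<close>

definition fibre_Haar_measures ::
  "('x::topological_space \<Rightarrow> 's) \<Rightarrow> ('k \<Rightarrow> 't::topological_space \<Rightarrow> 't) \<Rightarrow> ('t \<Rightarrow> 'x) \<Rightarrow>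
   ('s \<Rightarrow> 'x measure) \<Rightarrow> bool"
where
  "fibre_Haar_measures \<pi> \<kappa> \<psi> hm \<longleftrightarrow>
     (\<forall>y. \<exists>m :: 't measure.
        prob_space m \<and> sets m = sets borel \<and>
        emeasure m {z. \<pi> (\<psi> z) = y} = 1 \<and>
        (\<forall>k. distr m borel (\<kappa> k) = m) \<and>
        hm y = distr m borel \<psi>)"


section \<open>Spaces of probability measures\<close>

definition prob_measures :: "'a::topological_space measure set" where
  "prob_measures = space (prob_algebra borel)"

text \<open>
  Meant for compact spaces, where every continuous real function is bounded.
\<close>

definition weak_star_topology :: "'a::topological_space measure topology" where
  "weak_star_topology =
     topology_generated_by
       {{\<mu> \<in> prob_measures. (\<integral>x. f x \<partial>\<mu>) \<in> U} | (f :: 'a \<Rightarrow> real) U.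
          continuous_on UNIV f \<and> open U}"

lemma topspace_weak_star_topology: "topspace weak_star_topology = prob_measures"
proof -
  have "{\<mu> \<in> prob_measures. (\<integral>x. (0::real) \<partial>\<mu>) \<in> UNIV} \<in>
     {{\<mu> \<in> prob_measures. (\<integral>x. f x \<partial>\<mu>) \<in> U} | (f :: 'a \<Rightarrow> real) U. continuous_on UNIV f \<and> open U}"
    by (intro CollectI exI[of _ "\<lambda>x. 0"] exI[of _ UNIV]) auto
  then show ?thesis
    unfolding weak_star_topology_def topology_generated_by_topspace by blast
qed

definition measure_orbit :: "('g \<Rightarrow> 'a \<Rightarrow> 'a) \<Rightarrow> 'a::topological_space measure \<Rightarrow> 'a measure set" where
  "measure_orbit \<alpha> \<nu> = range (\<lambda>g. distr \<nu> borel (\<alpha> g))"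

text \<open>The map \<open>\<nu> \<mapsto> \<integral> hm y d\<nu>(y)\<close>, as the bind of the Giry monad.\<close>

definition integrate_section ::
  "('s \<Rightarrow> 'x measure) \<Rightarrow> 's::topological_space measure \<Rightarrow> 'x::topological_space measure" where
  "integrate_section hm \<nu> = \<nu> \<bind> hm"

end

theory Submission
  imports Defs
begin

text \<open>
  Let \<open>P f\<close> be the function obtained by averaging \<open>f\<close> over the fibres of \<open>\<pi>\<close>. A measure \<open>\<mu>\<close> belongs to
  \<open>M\<^sub>m(X)\<close> iff the integrals of \<open>f\<close> and \<open>P f\<close> against \<open>\<mu>\<close> agree for \<open>f\<close> in a countable determining
  family, so by compactness \<open>R\<close> is a countable intersection of open sets, and each of them has to be shown
  dense. Call \<open>x, x'\<close> regionally proximal if every nonempty open set has a translate that comes close to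
  both. Fix \<open>y\<close> in \<open>Y\<close> with \<open>\<theta>\<close>-fibre \<open>{y\<^sup>*}\<close> and \<open>x\<^sub>0\<close> above it, and let \<open>B\<close> be the set of points regionally
  proximal to \<open>x\<^sub>0\<close>. The group elements taking \<open>x\<^sub>0\<close> near \<open>B\<close> are the neighbourhoods of \<open>0\<close> for a group topology,
  and identifying points of \<open>X\<close> that are approached along the same Cauchy nets gives an equicontinuous
  factor in which the class of \<open>x\<^sub>0\<close> lies in \<open>B\<close>. By maximality of \<open>Y\<close>, all of \<open>\<pi>\<^sup>-\<^sup>1(y\<^sup>*)\<close> lies in \<open>B\<close>.
  Commutativity of \<open>\<Gamma>\<close> and the structure group upgrade this to finite sets: any finitely many nonempty
  open sets have translates, by one and the same element, that are nearly dense in whole fibres. Hence a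
  measure can be perturbed so that some translate is close to a mixture of Haar measures.
\<close>

subsection \<open>Compact metric spaces\<close>

text \<open>The obstacle is that regional proximality is shown to be transitive only along fibres of
  \<open>\<pi>\<close>, so a quotient by it is not directly at hand. Only the class \<open>B\<close>
  of \<open>x0\<close> is controlled, because the one-point \<open>\<theta>\<close>-fibre confines
  it to a single \<open>\<pi>\<close>-fibre. The detour through a topology on the group avoids any
  control at other points: that topology depends on the orbit of \<open>x0\<close> alone, yet it
  induces an equivalence relation on all of X. The structure group helps because its elements
  commute with the action, so a configuration of points in one fibre follows the motion of a single
  point of the minimal cover. In the density argument two demands compete: the perturbation may move
  mass only a little, whereas one translate has to spread it over entire fibres. Hence the mass is
  cut into small balls, each replaced by an open set to be spread, and one group element has to
  serve all balls and a whole net of a fibre at once. This is why pairs of points do not suffice and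
  finite sets are needed.\<close>

instance compact_metric_space \<subseteq> heine_borel
proof
  fix f :: "nat \<Rightarrow> 'a"
  have "seq_compact (UNIV :: 'a set)"
    using compact_UNIV_metric by (simp add: compact_eq_seq_compact_metric)
  then show "\<exists>l r. strict_mono (r::nat\<Rightarrow>nat) \<and> ((f \<circ> r) \<longlongrightarrow> l) sequentially"
    by (metis UNIV_I seq_compactE)
qed

lemma compact_space_subseq:
  fixes f :: "nat \<Rightarrow> 'a::compact_metric_space"
  obtains l r where "strict_mono (r::nat\<Rightarrow>nat)" "(\<lambda>n. f (r n)) \<longlonglongrightarrow> l"
proof -
  have "seq_compact (UNIV :: 'a set)"
    using compact_UNIV_metric by (simp add: compact_eq_seq_compact_metric)
  then obtain l r where "strict_mono (r::nat\<Rightarrow>nat)" "(f \<circ> r) \<longlonglongrightarrow> l"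
    by (meson UNIV_I seq_compactE)
  then show thesis using that by (simp add: o_def)
qed

lemma closed_imp_compact_space: "closed S \<Longrightarrow> compact (S :: 'a::compact_metric_space set)"
  by (metis Int_UNIV_left compact_Int_closed compact_UNIV_metric)

lemma continuous_imp_bounded_real:
  fixes f :: "'a::compact_metric_space \<Rightarrow> real"
  assumes "continuous_on UNIV f"
  obtains B where "\<And>x. \<bar>f x\<bar> \<le> B"
proof -
  have "bounded (range f)"
    by (intro compact_imp_bounded compact_continuous_image assms compact_UNIV_metric)
  then show thesis using that by (auto simp: bounded_real)
qed

lemma continuous_imp_uniformly_continuous_space:
  fixes f :: "'a::compact_metric_space \<Rightarrow> 'b::metric_space"
  assumes "continuous_on UNIV f" "e > 0"
  obtains d where "d > 0" "\<And>x y. dist x y < d \<Longrightarrow> dist (f x) (f y) < e"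
  using compact_uniformly_continuous[OF assms(1) compact_UNIV_metric] assms(2)
  unfolding uniformly_continuous_on_def by (metis UNIV_I dist_commute)

text \<open>Balls around the points of \<open>S\<close> already cover its compact closure, so the
  net can be chosen inside \<open>S\<close>; applied to a fibre, this keeps the net points in the
  fibre.\<close>

lemma finite_net:
  fixes S :: "'a::compact_metric_space set"
  assumes "e > 0"
  obtains D where "finite D" "D \<subseteq> S" "\<And>x. x \<in> S \<Longrightarrow> \<exists>y\<in>D. dist x y < e"
proof -
  have "compact (closure S)" by (rule closed_imp_compact_space) simp
  moreover have "closure S \<subseteq> (\<Union>y\<in>S. ball y e)"
  proof
    fix x assume "x \<in> closure S"
    then show "x \<in> (\<Union>y\<in>S. ball y e)" using assms by (auto simp: closure_approachable)
  qed
  ultimately obtain D where D: "D \<subseteq> S" "finite D" "closure S \<subseteq> (\<Union>y\<in>D. ball y e)"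
    using compactE_image[of "closure S" S "\<lambda>y. ball y e"] by (metis open_ball)
  have "\<exists>y\<in>D. dist x y < e" if "x \<in> S" for x
    using D(3) that closure_subset[of S] by (fastforce simp: dist_commute)
  with D that show thesis by blast
qed

lemma countable_open_base:
  obtains B :: "nat \<Rightarrow> 'a::compact_metric_space set"
  where "\<And>i. open (B i)"
    "\<And>U x. open U \<Longrightarrow> x \<in> U \<Longrightarrow> \<exists>i. x \<in> B i \<and> B i \<subseteq> U"
proof -
  have "\<exists>D. finite D \<and> (\<forall>x::'a. \<exists>y\<in>D. dist x y < 1 / Suc n)" for n
    by (rule finite_net[of "1 / Suc n" UNIV]) auto
  then obtain D where D: "\<And>n. finite (D n)" "\<And>n (x::'a). \<exists>y\<in>D n. dist x y < 1 / Suc n"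
    by metis
  define C where "C = (\<Union>n. (\<lambda>y. ball y (1 / Suc n)) ` D n)"
  have C: "countable C" "C \<noteq> {}"
    using D by (auto simp: C_def countable_finite intro!: countable_UN) (metis empty_iff)
  show thesis
  proof (rule that[of "from_nat_into C"])
    show "open (from_nat_into C i)" for i
      using from_nat_into[OF C(2), of i] by (auto simp: C_def)
  next
    fix U :: "'a set" and x assume "open U" "x \<in> U"
    then obtain e where e: "e > 0" "ball x e \<subseteq> U" using open_contains_ball by blast
    \<comment> \<open>Two radii \<open>1 / Suc n\<close> must fit into \<open>e\<close>: one from
      \<open>x\<close> to the centre \<open>y\<close>, one from \<open>y\<close> to any other point
      of the ball.\<close>
    then obtain n where n: "2 / real (Suc n) < e"
      using reals_Archimedean[of "e/2"] by (auto simp: field_simps)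
    obtain y where y: "y \<in> D n" "dist x y < 1 / Suc n" using D by blast
    have "ball y (1 / Suc n) \<subseteq> ball x e"
    proof
      fix z assume "z \<in> ball y (1 / Suc n)"
      then have "dist x z < 1 / Suc n + 1 / Suc n"
        using y(2) dist_triangle[of x z y] by (simp add: dist_commute)
      then show "z \<in> ball x e" using n by simp
    qed
    moreover have "ball y (1 / Suc n) \<in> C" using y by (auto simp: C_def)
    ultimately show "\<exists>i. x \<in> from_nat_into C i \<and> from_nat_into C i \<subseteq> U"
      using from_nat_into_surj[OF C(1)] e y(2) by (metis dist_commute mem_ball subset_trans)
  qed
qed

subsection \<open>Borel probability measures\<close>

lemma prob_measures_iff: "\<mu> \<in> prob_measures \<longleftrightarrow> sets \<mu> = sets borel \<and> prob_space \<mu>"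
  by (simp add: prob_measures_def space_prob_algebra)

lemma prob_measuresD:
  assumes "\<mu> \<in> prob_measures"
  shows "sets \<mu> = sets borel" "prob_space \<mu>" "space \<mu> = UNIV"
  using assms sets_eq_imp_space_eq[of \<mu> borel] by (auto simp: prob_measures_iff)

lemma measurable_prob_measures: "\<mu> \<in> prob_measures \<Longrightarrow> f \<in> measurable borel N \<Longrightarrow> f \<in> measurable \<mu> N"
  using measurable_cong_sets[of \<mu> borel N N] by (auto simp: prob_measures_iff)

lemma integrable_bounded_prob:
  fixes f :: "'a::topological_space \<Rightarrow> real"
  assumes "\<mu> \<in> prob_measures" "f \<in> borel_measurable borel" "\<And>x. \<bar>f x\<bar> \<le> B"
  shows "integrable \<mu> f"
proof -
  interpret prob_space \<mu> using assms(1) by (rule prob_measuresD)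
  show ?thesis
    by (rule integrable_const_bound[of _ B]) (use assms in \<open>auto intro: measurable_prob_measures\<close>)
qed

lemma integrable_continuous_prob:
  fixes f :: "'a::compact_metric_space \<Rightarrow> real"
  assumes "\<mu> \<in> prob_measures" "continuous_on UNIV f"
  shows "integrable \<mu> f"
proof -
  from continuous_imp_bounded_real[OF assms(2)] show ?thesis
    using integrable_bounded_prob[OF assms(1) borel_measurable_continuous_onI[OF assms(2)]] by metis
qed

lemma distr_prob_measures:
  "\<mu> \<in> prob_measures \<Longrightarrow> f \<in> borel_measurable borel \<Longrightarrow> distr \<mu> borel f \<in> prob_measures"
  unfolding prob_measures_iff
  by (metis measurable_cong_sets prob_space.prob_space_distr sets_distr)

lemma integral_distr_prob:
  fixes f :: "'b::topological_space \<Rightarrow> real"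
  assumes "\<mu> \<in> prob_measures" "g \<in> borel_measurable borel" "f \<in> borel_measurable borel"
  shows "(\<integral>x. f x \<partial>distr \<mu> borel g) = (\<integral>x. f (g x) \<partial>\<mu>)"
  by (rule integral_distr[OF measurable_prob_measures[OF assms(1,2)] assms(3)])

lemma integral_diff_le_prob:
  fixes f :: "'a::topological_space \<Rightarrow> real"
  assumes "\<mu> \<in> prob_measures" "integrable \<mu> f" "integrable \<mu> g" "AE x in \<mu>. \<bar>f x - g x\<bar> \<le> e"
  shows "\<bar>(\<integral>x. f x \<partial>\<mu>) - (\<integral>x. g x \<partial>\<mu>)\<bar> \<le> e"
proof -
  interpret prob_space \<mu> using assms(1) by (rule prob_measuresD)
  have "\<bar>(\<integral>x. f x \<partial>\<mu>) - (\<integral>x. g x \<partial>\<mu>)\<bar> = \<bar>\<integral>x. f x - g x \<partial>\<mu>\<bar>" using assms by simp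
  also have "\<dots> \<le> (\<integral>x. \<bar>f x - g x\<bar> \<partial>\<mu>)" by (rule integral_abs_bound)
  also have "\<dots> \<le> (\<integral>x. e \<partial>\<mu>)" using assms by (intro integral_mono_AE) auto
  finally show ?thesis by (simp add: prob_space)
qed

text \<open>The integrands increase to the indicator of \<open>U\<close>. The distance to the empty
  set is 0 by convention, so for \<open>U = UNIV\<close> the integrals vanish instead of tending to
  the total mass.\<close>

lemma prob_measures_open_integral_limit:
  fixes U :: "'a::metric_space set"
  assumes "open U" "\<mu> \<in> prob_measures"
  shows "(\<lambda>n. \<integral>x. min 1 (real n * infdist x (- U)) \<partial>\<mu>) \<longlonglongrightarrow> (if U = UNIV then 0 else measure \<mu> U)"
proof (cases "U = UNIV")
  case True then show ?thesis by (simp add: infdist_def)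
next
  case False
  interpret prob_space \<mu> using assms(2) by (rule prob_measuresD)
  have [measurable]: "U \<in> sets \<mu>" using assms by (auto simp: prob_measures_iff)
  have "(\<lambda>n. \<integral>x. min 1 (real n * infdist x (- U)) \<partial>\<mu>) \<longlonglongrightarrow> (\<integral>x. indicator U x \<partial>\<mu>)"
  proof (rule integral_dominated_convergence[where w="\<lambda>_. 1"])
    show "(\<lambda>x. min 1 (real n * infdist x (- U))) \<in> borel_measurable \<mu>" for n
      by (intro measurable_prob_measures[OF assms(2)] borel_measurable_continuous_onI continuous_intros)
    show "AE x in \<mu>. (\<lambda>n. min 1 (real n * infdist x (- U))) \<longlonglongrightarrow> indicator U x"
    proof (rule AE_I2)
      fix x
      show "(\<lambda>n. min 1 (real n * infdist x (- U))) \<longlonglongrightarrow> indicat_real U x"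
      proof (cases "x \<in> U")
        case True
        then have pos: "infdist x (- U) > 0"
          using False assms(1)
          by (metis Compl_iff Compl_UNIV_eq closed_Compl double_complement in_closed_iff_infdist_zero infdist_nonneg order_le_less)
        obtain N where N: "1 < real N * infdist x (- U)" using reals_Archimedean3[OF pos] by blast
        have "min 1 (real n * infdist x (- U)) = 1" if "n \<ge> N" for n
        proof -
          have "real N * infdist x (- U) \<le> real n * infdist x (- U)"
            using that pos by (intro mult_right_mono) auto
          then show ?thesis using N by simp
        qed
        then show ?thesis using True
          by (intro tendsto_eventually) (auto simp: eventually_sequentially)
      qed (simp add: infdist_zero)
    qed
    show "integrable \<mu> (\<lambda>_. 1::real)" by (rule integrable_const)
    show "AE x in \<mu>. norm (min 1 (real n * infdist x (- U))) \<le> 1" for n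
      by (rule AE_I2) (simp add: infdist_nonneg)
  qed simp
  then show ?thesis using False by simp
qed

lemma prob_measures_eqI_open:
  fixes \<mu> \<nu> :: "'a::topological_space measure"
  assumes "\<mu> \<in> prob_measures" "\<nu> \<in> prob_measures" "\<And>U. open U \<Longrightarrow> measure \<mu> U = measure \<nu> U"
  shows "\<mu> = \<nu>"
proof (rule measure_eqI_generator_eq[where E="Collect open" and \<Omega>=UNIV and A="\<lambda>_. UNIV"])
  interpret \<mu>: prob_space \<mu> using assms(1) by (rule prob_measuresD)
  interpret \<nu>: prob_space \<nu> using assms(2) by (rule prob_measuresD)
  show "Int_stable (Collect (open :: 'a set \<Rightarrow> bool))" by (auto simp: Int_stable_def)
  show "sets \<mu> = sigma_sets UNIV (Collect open)" "sets \<nu> = sigma_sets UNIV (Collect open)"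
    using assms by (auto simp: prob_measures_iff borel_def)
  show "emeasure \<mu> X = emeasure \<nu> X" if "X \<in> Collect open" for X
    using that assms(3) by (simp add: \<mu>.emeasure_eq_measure \<nu>.emeasure_eq_measure)
  show "emeasure \<mu> UNIV \<noteq> \<infinity>" by (simp add: \<mu>.emeasure_eq_measure)
qed auto

text \<open>
  The family is indexed by finite unions of basic open sets: an open set is an increasing union of
  these, and the indicator of each is a limit of truncated multiples of the distance to its complement.
\<close>

lemma countable_determining_family:
  obtains f :: "nat \<Rightarrow> 'a::compact_metric_space \<Rightarrow> real"
  where "\<And>j. continuous_on UNIV (f j)"
    "\<And>\<mu> \<nu>. \<mu> \<in> prob_measures \<Longrightarrow> \<nu> \<in> prob_measures \<Longrightarrow>
       \<forall>j. (\<integral>x. f j x \<partial>\<mu>) = (\<integral>x. f j x \<partial>\<nu>) \<Longrightarrow> \<mu> = \<nu>"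
proof -
  obtain B :: "nat \<Rightarrow> 'a set" where B: "\<And>i. open (B i)"
    "\<And>U x. open U \<Longrightarrow> x \<in> U \<Longrightarrow> \<exists>i. x \<in> B i \<and> B i \<subseteq> U" using countable_open_base by blast
  define F where "F = (\<lambda>(I, n) x. min 1 (real n * infdist x (- (\<Union>i\<in>I. B i)))) ` ({I. finite I} \<times> UNIV)"
  have F: "countable F" "F \<noteq> {}"
    unfolding F_def by (auto intro!: countable_image countable_SIGMA countable_Collect_finite)
  have cont: "continuous_on UNIV (from_nat_into F j)" for j
    using from_nat_into[OF F(2), of j] unfolding F_def by (auto intro!: continuous_intros)
  show thesis
  proof (rule that[OF cont])
    fix \<mu> \<nu> :: "'a measure"
    assume \<mu>: "\<mu> \<in> prob_measures" and \<nu>: "\<nu> \<in> prob_measures"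
      and eq: "\<forall>j. (\<integral>x. from_nat_into F j x \<partial>\<mu>) = (\<integral>x. from_nat_into F j x \<partial>\<nu>)"
    interpret \<mu>: prob_space \<mu> using \<mu> by (rule prob_measuresD)
    interpret \<nu>: prob_space \<nu> using \<nu> by (rule prob_measuresD)
    have fin: "measure \<mu> (\<Union>i\<in>I. B i) = measure \<nu> (\<Union>i\<in>I. B i)" if "finite I" for I
    proof (cases "(\<Union>i\<in>I. B i) = UNIV")
      case True
      then show ?thesis using \<mu>.prob_space \<nu>.prob_space \<mu> \<nu> by (metis prob_measuresD(3))
    next
      case False
      have "(\<integral>x. min 1 (real n * infdist x (- (\<Union>i\<in>I. B i))) \<partial>\<mu>)
          = (\<integral>x. min 1 (real n * infdist x (- (\<Union>i\<in>I. B i))) \<partial>\<nu>)" for n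
      proof -
        have "(\<lambda>x. min 1 (real n * infdist x (- (\<Union>i\<in>I. B i)))) \<in> F"
          using that by (auto simp: F_def intro!: image_eqI[of _ _ "(I, n)"])
        then show ?thesis using eq from_nat_into_surj[OF F(1)] by metis
      qed
      moreover have O: "open (\<Union>i\<in>I. B i)" using B by auto
      ultimately show ?thesis
        using prob_measures_open_integral_limit[OF O \<mu>] prob_measures_open_integral_limit[OF O \<nu>]
        by (simp add: False LIMSEQ_unique)
    qed
    show "\<mu> = \<nu>"
    proof (rule prob_measures_eqI_open[OF \<mu> \<nu>])
      fix U :: "'a set" assume U: "open U"
      define V where "V n = (\<Union>i\<in>{i. i \<le> n \<and> B i \<subseteq> U}. B i)" for n :: nat
      have UV: "U = (\<Union>n. V n)"
      proof
        show "U \<subseteq> (\<Union>n. V n)" using B(2)[OF U] by (fastforce simp: V_def)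
      qed (auto simp: V_def)
      have V: "incseq V" "range V \<subseteq> sets borel"
        using B unfolding V_def by (intro monoI UN_mono, force, force) (auto intro!: borel_open open_UN B(1))
      have "(\<lambda>n. measure \<mu> (V n)) \<longlonglongrightarrow> measure \<mu> U" "(\<lambda>n. measure \<nu> (V n)) \<longlonglongrightarrow> measure \<nu> U"
        unfolding UV using V \<mu> \<nu>
        by (auto intro!: \<mu>.finite_Lim_measure_incseq \<nu>.finite_Lim_measure_incseq simp: prob_measures_iff)
      moreover have "measure \<mu> (V n) = measure \<nu> (V n)" for n
        unfolding V_def by (rule fin) auto
      ultimately show "measure \<mu> U = measure \<nu> U" by (simp add: LIMSEQ_unique)
    qed
  qed
qed

subsection \<open>Sequential compactness of the space of probability measures\<close>

text \<open>At the first differing digit \<open>m\<close> the sums differ by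
  \<open>(1/3) ^ m\<close>, and the tail can cancel at most half of this. With digits 0 and 1, base
  three leaves a gap where base two would not.\<close>

lemma ternary_expansion_gap:
  fixes b c :: "nat \<Rightarrow> real"
  assumes "\<And>j. b j \<in> {0, 1}" "\<And>j. c j \<in> {0, 1}" "k < K" "b k \<noteq> c k"
  shows "(1/3) ^ K \<le> \<bar>(\<Sum>j. b j * (1/3) ^ j) - (\<Sum>j. c j * (1/3) ^ j)\<bar>"
proof -
  define m where "m = (LEAST j. b j \<noteq> c j)"
  have m: "b m \<noteq> c m" "m \<le> k" and below: "\<And>j. j < m \<Longrightarrow> b j = c j"
    unfolding m_def using LeastI[of "\<lambda>j. b j \<noteq> c j", OF assms(4)] Least_le[of "\<lambda>j. b j \<noteq> c j", OF assms(4)]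
      not_less_Least by blast+
  define d where "d j = (b j - c j) * (1/3) ^ j" for j
  have le1: "\<bar>b j - c j\<bar> \<le> 1" for j using assms(1)[of j] assms(2)[of j] by auto
  have sm: "summable (\<lambda>j. a j * (1/3) ^ j)" if "\<And>j. \<bar>a j\<bar> \<le> 1" for a :: "nat \<Rightarrow> real"
    by (rule summable_comparison_test'[where g="\<lambda>j. (1/3)^j" and N=0])
       (use that in \<open>auto simp: abs_mult mult_le_cancel_right1 intro!: summable_geometric\<close>)
  have smb: "summable (\<lambda>j. b j * (1/3) ^ j)" "summable (\<lambda>j. c j * (1/3) ^ j)"
    using assms(1,2) by (auto intro!: sm) (metis abs_0 abs_1 empty_iff insertE order_refl zero_le_one)+
  have smd: "summable d" unfolding d_def by (rule sm) (rule le1)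
  have "(\<Sum>j. b j * (1/3) ^ j) - (\<Sum>j. c j * (1/3) ^ j) = suminf d"
    unfolding d_def by (subst suminf_diff[OF smb]) (simp add: left_diff_distrib)
  also have "\<dots> = (\<Sum>j. d (j + Suc m)) + (\<Sum>j<Suc m. d j)"
    by (rule suminf_split_initial_segment[OF smd])
  also have "(\<Sum>j<Suc m. d j) = d m" by (simp add: d_def below)
  finally have eq: "(\<Sum>j. b j * (1/3) ^ j) - (\<Sum>j. c j * (1/3) ^ j) = (\<Sum>j. d (j + Suc m)) + d m" .
  have dm: "\<bar>d m\<bar> = (1/3) ^ m"
    using m(1) assms(1)[of m] assms(2)[of m] by (auto simp: d_def abs_mult)
  have dle: "\<bar>d j\<bar> \<le> (1/3) ^ j" for j
    unfolding d_def abs_mult using le1[of j] by (simp add: mult_le_cancel_right1)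
  have sg: "(\<lambda>j. (1/3) ^ (j + Suc m)) sums ((3/2) * (1/3::real) ^ Suc m)"
    using sums_mult2[OF geometric_sums[of "1/3::real"], of "(1/3) ^ Suc m"]
    by (simp add: power_add mult.commute)
  have sabs: "summable (\<lambda>j. \<bar>d (j + Suc m)\<bar>)"
    by (rule summable_comparison_test'[OF sums_summable[OF sg], of 0]) (simp only: real_norm_def abs_abs dle)
  have "\<bar>\<Sum>j. d (j + Suc m)\<bar> \<le> (\<Sum>j. \<bar>d (j + Suc m)\<bar>)" by (rule summable_rabs[OF sabs])
  also have "\<dots> \<le> (\<Sum>j. (1/3) ^ (j + Suc m))"
    by (rule suminf_le[OF _ sabs sums_summable[OF sg]]) (rule dle)
  also have "\<dots> = (3/2) * (1/3::real) ^ Suc m" using sg by (rule sums_unique[symmetric])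
  finally have tail: "\<bar>\<Sum>j. d (j + Suc m)\<bar> \<le> (1/2) * (1/3) ^ m" by simp
  have "(1/3::real) ^ K \<le> (1/3) ^ Suc m" using m(2) assms(3) by (intro power_decreasing) auto
  then show ?thesis unfolding eq using tail dm by (simp add: abs_if split: if_splits)
qed

text \<open>The ternary digits of \<open>s x\<close> record which basic open sets contain
  \<open>x\<close>. The last property says that \<open>s\<close> is injective with uniformly
  continuous inverse, although \<open>s\<close> itself is only Borel.\<close>

lemma real_code:
  obtains s :: "'a::compact_metric_space \<Rightarrow> real"
  where "s \<in> borel_measurable borel" "\<And>x. 0 \<le> s x" "\<And>x. s x \<le> 2"
    "\<And>e. e > 0 \<Longrightarrow> \<exists>d>0. \<forall>x y. \<bar>s x - s y\<bar> < d \<longrightarrow> dist x y < e"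
proof -
  obtain B :: "nat \<Rightarrow> 'a set" where B: "\<And>i. open (B i)"
    "\<And>U x. open U \<Longrightarrow> x \<in> U \<Longrightarrow> \<exists>i. x \<in> B i \<and> B i \<subseteq> U" using countable_open_base by blast
  define s where "s x = (\<Sum>j. indicat_real (B j) x * (1/3) ^ j)" for x
  have sg: "summable (\<lambda>j. (1/3::real) ^ j)" by (rule summable_geometric) simp
  have sm: "summable (\<lambda>j. indicat_real (B j) x * (1/3) ^ j)" for x
    by (rule summable_comparison_test'[OF sg, of 0]) (auto simp: indicator_def)
  show thesis
  proof (rule that[of s])
    have [measurable]: "B j \<in> sets borel" for j using B by simp
    show "s \<in> borel_measurable borel" unfolding s_def by measurable
    fix x
    show "0 \<le> s x" unfolding s_def by (rule suminf_nonneg[OF sm]) auto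
    have "s x \<le> (\<Sum>j. (1/3::real) ^ j)"
      unfolding s_def by (rule suminf_le[OF _ sm sg]) (auto simp: indicator_def)
    also have "\<dots> = 3/2" by (subst suminf_geometric) auto
    finally show "s x \<le> 2" by simp
  next
    fix e :: real assume e: "e > 0"
    have "\<exists>i. x \<in> B i \<and> B i \<subseteq> ball x (e/2)" for x using B(2)[of "ball x (e/2)" x] e by simp
    then obtain i where i: "\<And>x. x \<in> B (i x)" "\<And>x. B (i x) \<subseteq> ball x (e/2)" by metis
    have "UNIV \<subseteq> (\<Union>x\<in>UNIV. B (i x))" using i by auto
    then obtain D where D: "finite D" "UNIV \<subseteq> (\<Union>x\<in>D. B (i x))"
      using compactE_image[OF compact_UNIV_metric, of UNIV "\<lambda>x. B (i x)"] B(1) by metis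
    \<comment> \<open>\<open>K\<close> exceeds all indices of the finite subcover, so codes closer
      than \<open>(1/3) ^ K\<close> agree on membership in each of its sets.\<close>
    define K where "K = Suc (Max (i ` D))"
    have "dist x y < e" if "\<bar>s x - s y\<bar> < (1/3) ^ K" for x y
    proof -
      obtain c where c: "c \<in> D" "x \<in> B (i c)" using D(2) by blast
      have "i c < K" unfolding K_def using c(1) D(1) by (simp add: less_Suc_eq_le)
      then have "indicat_real (B (i c)) x = indicat_real (B (i c)) y"
        using ternary_expansion_gap[of "\<lambda>j. indicat_real (B j) x" "\<lambda>j. indicat_real (B j) y" "i c" K] that
        unfolding s_def by (fastforce simp: indicator_def)
      then have "y \<in> B (i c)" using c(2) by (auto simp: indicator_def split: if_splits)
      then have "dist c x < e/2" "dist c y < e/2" using i(2)[of c] c(2) by auto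
      then show ?thesis using dist_triangle_half_r by blast
    qed
    then show "\<exists>d>0. \<forall>x y. \<bar>s x - s y\<bar> < d \<longrightarrow> dist x y < e"
      by (intro exI[of _ "(1/3)^K"]) auto
  qed
qed

text \<open>
  Helly's theorem applied to the laws of a real code \<open>s\<close>. The code itself is only Borel, but its
  inverse extends continuously to the closure of its range, so limits can be pulled back.
\<close>

lemma prob_measures_convergent_subseq:
  fixes \<mu> :: "nat \<Rightarrow> 'a::compact_metric_space measure"
  assumes \<mu>: "\<And>n. \<mu> n \<in> prob_measures"
  obtains r \<mu>' where "strict_mono (r :: nat \<Rightarrow> nat)" "\<mu>' \<in> prob_measures"
    "\<And>f :: 'a \<Rightarrow> real. continuous_on UNIV f \<Longrightarrow>
       (\<lambda>n. \<integral>x. f x \<partial>\<mu> (r n)) \<longlonglongrightarrow> (\<integral>x. f x \<partial>\<mu>')"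
proof -
  obtain s :: "'a \<Rightarrow> real" where s [measurable]: "s \<in> borel_measurable borel"
    and s02: "\<And>x. 0 \<le> s x" "\<And>x. s x \<le> 2"
    and suc: "\<And>e. e > 0 \<Longrightarrow> \<exists>d>0. \<forall>x y. \<bar>s x - s y\<bar> < d \<longrightarrow> dist x y < e"
    using real_code by blast
  have inj: "inj s"
  proof (rule injI, rule ccontr)
    fix x y assume "s x = s y" "x \<noteq> y"
    then show False using suc[of "dist x y"] by force
  qed
  define C where "C = closure (range s)"
  have "uniformly_continuous_on (range s) (inv s)"
    unfolding uniformly_continuous_on_def using suc inj by (fastforce simp: dist_real_def)
  then obtain c0 where c0: "uniformly_continuous_on C c0" "\<And>x. x \<in> range s \<Longrightarrow> inv s x = c0 x"
    unfolding C_def using uniformly_continuous_on_extension_on_closure by metis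
  \<comment> \<open>The default value only serves to make the decoding map total and Borel; the
    limit law turns out to live on \<open>C\<close>.\<close>
  define c where "c t = (if t \<in> C then c0 t else undefined)" for t
  have C [measurable]: "C \<in> sets borel" by (simp add: C_def)
  have cs: "c (s x) = x" and sC: "s x \<in> C" for x
  proof -
    show "s x \<in> C" using closure_subset[of "range s"] by (auto simp: C_def)
    then show "c (s x) = x" unfolding c_def using c0(2)[of "s x"] inj by simp
  qed
  have contc: "continuous_on C c"
    using uniformly_continuous_imp_continuous[OF c0(1)] by (rule continuous_on_eq) (simp add: c_def)
  have [measurable]: "c \<in> borel_measurable borel"
  proof -
    have "c = (\<lambda>t. if t \<in> C then c t else undefined)" by (auto simp: c_def)
    moreover have "\<dots> \<in> borel_measurable borel"
      by (rule borel_measurable_continuous_on_if[OF C contc]) auto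
    ultimately show ?thesis by simp
  qed
  define \<nu> where "\<nu> n = distr (\<mu> n) borel s" for n
  have real_dist: "real_distribution (\<nu> n)" for n
    using distr_prob_measures[OF \<mu> s] by (auto simp: \<nu>_def prob_measures_iff real_distribution_def real_distribution_axioms_def)
  have "tight \<nu>"
    unfolding tight_def
  proof (intro conjI allI impI real_dist)
    fix e :: real assume "e > 0"
    \<comment> \<open>The codes lie between 0 and 2, so one half-open interval around that range
      witnesses tightness for every tolerance.\<close>
    have "measure (\<nu> n) {-1<..3} = 1" for n
    proof -
      have "s -` {-1<..3} = UNIV"
      proof (intro equalityI subset_UNIV subsetI vimageI2)
        fix x show "s x \<in> {-1<..3}" using s02[of x] by auto
      qed
      then show ?thesis unfolding \<nu>_def
        using prob_space.prob_space[of "\<mu> n"] prob_measuresD[OF \<mu>[of n]]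
        by (subst measure_distr) (auto intro: measurable_prob_measures[OF \<mu>])
    qed
    then show "\<exists>a b::real. a < b \<and> (\<forall>n. 1 - e < measure (\<nu> n) {a<..b})"
      using \<open>e > 0\<close> by (intro exI[of _ "-1"] exI[of _ 3]) auto
  qed
  then obtain r N where r: "strict_mono (r :: nat \<Rightarrow> nat)" and N: "real_distribution N"
    and "weak_conv_m (\<nu> \<circ> id \<circ> r) N"
    using tight_imp_convergent_subsubsequence[of \<nu> id] strict_mono_id by blast
  then have wc: "weak_conv_m (\<lambda>n. \<nu> (r n)) N" by (simp add: o_def)
  have Np: "N \<in> prob_measures"
    using N by (auto simp: prob_measures_iff real_distribution_def real_distribution_axioms_def)
  interpret N: real_distribution N by (rule N)
  have lim: "(\<lambda>n. \<integral>x. g x \<partial>\<nu> (r n)) \<longlonglongrightarrow> (\<integral>x. g x \<partial>N)"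
    if "continuous_on UNIV g" "\<And>x. \<bar>g x\<bar> \<le> B" for g :: "real \<Rightarrow> real" and B
    using weak_conv_imp_integral_bdd_continuous_conv[of "\<lambda>n. \<nu> (r n)" N g B] wc real_dist N that
    by (auto simp: continuous_on_eq_continuous_at)
  \<comment> \<open>Each \<open>\<nu> n\<close> is carried by \<open>C\<close>, so the truncated
    distance to \<open>C\<close> has integral 0 along the sequence and therefore in the
    limit.\<close>
  have AEC: "AE t in N. t \<in> C"
  proof -
    define g where "g t = min 1 (infdist t C)" for t
    have g: "continuous_on UNIV g" "\<bar>g t\<bar> \<le> 1" "0 \<le> g t" for t
      unfolding g_def by (auto intro!: continuous_intros simp: infdist_nonneg)
    have "(\<integral>x. g x \<partial>\<nu> n) = 0" for n
    proof -
      have "(\<integral>x. g x \<partial>\<nu> n) = (\<integral>x. g (s x) \<partial>\<mu> n)"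
        unfolding \<nu>_def by (rule integral_distr_prob[OF \<mu> s borel_measurable_continuous_onI[OF g(1)]])
      also have "(\<lambda>x. g (s x)) = (\<lambda>x. 0)" using sC by (auto simp: g_def fun_eq_iff)
      finally show ?thesis by simp
    qed
    then have "(\<integral>x. g x \<partial>N) = 0" using lim[OF g(1,2)] by (simp add: LIMSEQ_const_iff)
    moreover have "integrable N g"
      by (rule integrable_bounded_prob[OF Np borel_measurable_continuous_onI[OF g(1)] g(2)])
    ultimately have "AE t in N. g t = 0"
      using integral_nonneg_eq_0_iff_AE[of N g] g(3) by auto
    then show ?thesis
    proof (rule AE_mp, intro AE_I2 impI)
      fix t assume "g t = 0"
      then have "infdist t C = 0" by (auto simp: g_def min_def split: if_splits)
      then show "t \<in> C"
        using in_closed_iff_infdist_zero[of C t] sC by (auto simp: C_def)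
    qed
  qed
  define \<mu>' where "\<mu>' = distr N borel c"
  show thesis
  proof (rule that[OF r])
    show "\<mu>' \<in> prob_measures" unfolding \<mu>'_def by (rule distr_prob_measures[OF Np]) simp
  next
    fix f :: "'a \<Rightarrow> real" assume f: "continuous_on UNIV f"
    have [measurable]: "f \<in> borel_measurable borel" by (rule borel_measurable_continuous_onI[OF f])
    obtain B where B: "\<And>x. \<bar>f x\<bar> \<le> B" by (rule continuous_imp_bounded_real[OF f]) blast
    have "continuous_on C (\<lambda>t. f (c t))"
      by (rule continuous_on_compose2[OF f contc]) auto
    moreover have "closedin (top_of_set UNIV) C" by (simp add: C_def)
    moreover have "0 \<le> B" using B[of undefined] by linarith
    \<comment> \<open>Weak convergence needs a bounded continuous test function on the whole line,
      whereas the decoded \<open>f\<close> is continuous only on \<open>C\<close>; Tietze's theorem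
      extends it with the same bound.\<close>
    ultimately obtain g where g: "continuous_on UNIV g" "\<And>t. t \<in> C \<Longrightarrow> g t = f (c t)" "\<And>t. \<bar>g t\<bar> \<le> B"
      using Tietze[of C "\<lambda>t. f (c t)" UNIV B] B by auto
    have "(\<integral>x. f x \<partial>\<mu> n) = (\<integral>t. g t \<partial>\<nu> n)" for n
      unfolding \<nu>_def
      by (subst integral_distr_prob[OF \<mu> s borel_measurable_continuous_onI[OF g(1)]])
         (simp add: g(2) sC cs)
    moreover have "(\<integral>x. f x \<partial>\<mu>') = (\<integral>t. g t \<partial>N)"
    proof -
      have "(\<integral>x. f x \<partial>\<mu>') = (\<integral>t. f (c t) \<partial>N)"
        unfolding \<mu>'_def by (rule integral_distr_prob[OF Np]) auto
      also have "\<dots> = (\<integral>t. g t \<partial>N)"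
        using AEC by (intro integral_cong_AE)
          (auto simp: g(2) intro!: measurable_prob_measures[OF Np] borel_measurable_continuous_onI[OF g(1)])
      finally show ?thesis .
    qed
    ultimately show "(\<lambda>n. \<integral>x. f x \<partial>\<mu> (r n)) \<longlonglongrightarrow> (\<integral>x. f x \<partial>\<mu>')"
      using lim[OF g(1,3)] by simp
  qed
qed

subsection \<open>The weak* topology\<close>

lemma openin_weak_star_integral:
  fixes f :: "'a::topological_space \<Rightarrow> real"
  assumes "continuous_on UNIV f" "open U"
  shows "openin weak_star_topology {\<mu> \<in> prob_measures. (\<integral>x. f x \<partial>\<mu>) \<in> U}"
  unfolding weak_star_topology_def using assms by (intro topology_generated_by_Basis) blast

text \<open>Induction over the generation of the topology: having a neighbourhood given by finitely
  many test functions and one tolerance holds for subbasic sets and survives finite intersections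
  and arbitrary unions.\<close>

lemma weak_star_nhds:
  fixes T :: "'a::topological_space measure set"
  assumes "openin weak_star_topology T" "\<nu> \<in> T"
  obtains F e where "finite F" "\<And>f. f \<in> F \<Longrightarrow> continuous_on UNIV f" "e > (0::real)"
    "\<And>\<mu>. \<mu> \<in> prob_measures \<Longrightarrow>
       (\<And>f. f \<in> F \<Longrightarrow> \<bar>(\<integral>x. f x \<partial>\<mu>) - (\<integral>x. f x \<partial>\<nu>)\<bar> < e) \<Longrightarrow> \<mu> \<in> T"
proof -
  define N where "N T \<longleftrightarrow> (\<exists>F e. finite F \<and> (\<forall>f\<in>F. continuous_on UNIV f) \<and> e > (0::real) \<and>
     (\<forall>\<mu>\<in>prob_measures. (\<forall>f\<in>F. \<bar>(\<integral>x. f x \<partial>\<mu>) - (\<integral>x. f x \<partial>\<nu>)\<bar> < e) \<longrightarrow> \<mu> \<in> T))"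
    for T :: "'a measure set"
  have N_mono: "N T'" if "N T" "T \<subseteq> T'" for T T'
  proof -
    from that(1) obtain F e where "finite F" "\<forall>f\<in>F. continuous_on UNIV f" "e > (0::real)"
      "\<forall>\<mu>\<in>prob_measures. (\<forall>f\<in>F. \<bar>(\<integral>x. f x \<partial>\<mu>) - (\<integral>x. f x \<partial>\<nu>)\<bar> < e) \<longrightarrow> \<mu> \<in> T"
      unfolding N_def by blast
    with that(2) show ?thesis unfolding N_def by (intro exI[of _ F] exI[of _ e]) auto
  qed
  have "generate_topology_on {{\<mu> \<in> prob_measures. (\<integral>x. f x \<partial>\<mu>) \<in> U} | (f :: 'a \<Rightarrow> real) U.
          continuous_on UNIV f \<and> open U} T"
    using assms(1) by (simp add: weak_star_topology_def openin_topology_generated_by_iff)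
  then have "\<nu> \<in> T \<longrightarrow> N T"
  proof induction
    case (Int a b)
    show ?case
    proof
      assume "\<nu> \<in> a \<inter> b"
      then have "N a" "N b" using Int by auto
      then obtain F e F' e' where
        a: "finite F" "\<forall>f\<in>F. continuous_on UNIV f" "e > (0::real)"
          "\<And>\<mu>. \<mu> \<in> prob_measures \<Longrightarrow> \<forall>f\<in>F. \<bar>(\<integral>x. f x \<partial>\<mu>) - (\<integral>x. f x \<partial>\<nu>)\<bar> < e \<Longrightarrow> \<mu> \<in> a"
        and b: "finite F'" "\<forall>f\<in>F'. continuous_on UNIV f" "e' > (0::real)"
          "\<And>\<mu>. \<mu> \<in> prob_measures \<Longrightarrow> \<forall>f\<in>F'. \<bar>(\<integral>x. f x \<partial>\<mu>) - (\<integral>x. f x \<partial>\<nu>)\<bar> < e' \<Longrightarrow> \<mu> \<in> b"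
        unfolding N_def by metis
      show "N (a \<inter> b)"
        unfolding N_def
        by (rule exI[of _ "F \<union> F'"], rule exI[of _ "min e e'"]) (use a b in auto)
    qed
  next
    case (UN K)
    show ?case
    proof
      assume "\<nu> \<in> \<Union> K"
      then obtain k where "k \<in> K" "N k" using UN by blast
      then show "N (\<Union> K)" using N_mono[of k "\<Union> K"] by blast
    qed
  next
    case (Basis s)
    then obtain f U where s: "s = {\<mu> \<in> prob_measures. (\<integral>x. f x \<partial>\<mu>) \<in> U}"
      and f: "continuous_on UNIV f" and U: "open (U :: real set)" by blast
    show ?case
    proof
      assume "\<nu> \<in> s"
      then obtain e where e: "e > 0" "\<And>t. \<bar>t - (\<integral>x. f x \<partial>\<nu>)\<bar> < e \<Longrightarrow> t \<in> U"
        using U unfolding s open_dist by (auto simp: dist_real_def)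
      show "N s"
        unfolding N_def s
      proof (intro exI conjI)
        show "finite {f}" "\<forall>f\<in>{f}. continuous_on UNIV f" "e > 0" using f e by auto
        show "\<forall>\<mu>\<in>prob_measures. (\<forall>f\<in>{f}. \<bar>(\<integral>x. f x \<partial>\<mu>) - (\<integral>x. f x \<partial>\<nu>)\<bar> < e) \<longrightarrow>
          \<mu> \<in> {\<mu> \<in> prob_measures. (\<integral>x. f x \<partial>\<mu>) \<in> U}"
          using e(2) by simp
      qed
    qed
  qed simp
  then have "N T" using assms(2) by simp
  then obtain F e where F: "finite F" "\<forall>f\<in>F. continuous_on UNIV f" "e > (0::real)"
    "\<forall>\<mu>\<in>prob_measures. (\<forall>f\<in>F. \<bar>(\<integral>x. f x \<partial>\<mu>) - (\<integral>x. f x \<partial>\<nu>)\<bar> < e) \<longrightarrow> \<mu> \<in> T"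
    unfolding N_def by blast
  show thesis by (rule that[of F e]) (use F in auto)
qed

text \<open>A basic neighbourhood involves only finitely many test functions, so convergence of each
  integral separately gives an index that serves all of them.\<close>

lemma weak_star_closureI:
  fixes \<mu> :: "'a::topological_space measure"
  assumes "\<mu> \<in> prob_measures" "\<And>n. m n \<in> S" "S \<subseteq> prob_measures"
    and "\<And>f :: 'a \<Rightarrow> real. continuous_on UNIV f \<Longrightarrow> (\<lambda>n. \<integral>x. f x \<partial>m n) \<longlonglongrightarrow> (\<integral>x. f x \<partial>\<mu>)"
  shows "\<mu> \<in> weak_star_topology closure_of S"
  unfolding in_closure_of topspace_weak_star_topology
proof (intro conjI assms(1) allI impI)
  fix T assume T: "\<mu> \<in> T \<and> openin weak_star_topology T"
  then obtain F e where F: "finite F" "\<And>f. f \<in> F \<Longrightarrow> continuous_on UNIV f" "e > (0::real)"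
    "\<And>\<mu>'. \<mu>' \<in> prob_measures \<Longrightarrow>
       (\<And>f. f \<in> F \<Longrightarrow> \<bar>(\<integral>x. f x \<partial>\<mu>') - (\<integral>x. f x \<partial>\<mu>)\<bar> < e) \<Longrightarrow> \<mu>' \<in> T"
    using weak_star_nhds[of T \<mu>] by blast
  have "\<forall>f\<in>F. \<forall>\<^sub>F n in sequentially. \<bar>(\<integral>x. f x \<partial>m n) - (\<integral>x. f x \<partial>\<mu>)\<bar> < e"
    using assms(4) F by (auto simp: tendsto_iff dist_real_def)
  then have "\<forall>\<^sub>F n in sequentially. \<forall>f\<in>F. \<bar>(\<integral>x. f x \<partial>m n) - (\<integral>x. f x \<partial>\<mu>)\<bar> < e"
    by (simp add: eventually_ball_finite[OF F(1)])
  then obtain n where "\<forall>f\<in>F. \<bar>(\<integral>x. f x \<partial>m n) - (\<integral>x. f x \<partial>\<mu>)\<bar> < e"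
    by (auto simp: eventually_sequentially)
  then have "m n \<in> T" using F(4)[of "m n"] assms(2,3) by blast
  then show "\<exists>y. y \<in> S \<and> y \<in> T" using assms(2) by blast
qed

section \<open>Measures whose orbit closure meets the common zero set of countably many
  integrals\<close>

locale measure_action =
  fixes \<alpha> :: "'g \<Rightarrow> 'a::compact_metric_space \<Rightarrow> 'a" and h :: "nat \<Rightarrow> 'a \<Rightarrow> real"
  assumes cont_act: "\<And>g. continuous_on UNIV (\<alpha> g)"
    and cont_h: "\<And>j. continuous_on UNIV (h j)"
begin

text \<open>When \<open>h j\<close> is the deviation of the \<open>j\<close>-th determining function
  from its fibre mean, this is the set of integrated Haar measures, by
  \<open>integrate_section_eq\<close>.\<close>

definition null_measures :: "'a measure set" where
  "null_measures = {\<mu> \<in> prob_measures. \<forall>j. (\<integral>x. h j x \<partial>\<mu>) = 0}"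

definition approaching :: "'a measure set" where
  "approaching = {\<nu> \<in> prob_measures. weak_star_topology closure_of measure_orbit \<alpha> \<nu> \<inter> null_measures \<noteq> {}}"

lemma cont_h_act: "continuous_on UNIV (\<lambda>x. h j (\<alpha> g x))"
  by (rule continuous_on_compose2[OF cont_h cont_act]) auto

lemma measurable_act [measurable]: "\<alpha> g \<in> borel_measurable borel"
  by (rule borel_measurable_continuous_onI[OF cont_act])

lemma measure_orbit_subset: "\<nu> \<in> prob_measures \<Longrightarrow> measure_orbit \<alpha> \<nu> \<subseteq> prob_measures"
  by (auto simp: measure_orbit_def intro: distr_prob_measures)

lemma integral_act:
  fixes f :: "'a \<Rightarrow> real"
  assumes "\<nu> \<in> prob_measures" "continuous_on UNIV f"
  shows "(\<integral>x. f x \<partial>distr \<nu> borel (\<alpha> g)) = (\<integral>x. f (\<alpha> g x) \<partial>\<nu>)"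
  by (rule integral_distr_prob[OF assms(1) measurable_act borel_measurable_continuous_onI[OF assms(2)]])

text \<open>By sequential compactness, translates that are nearly null accumulate at a null measure.
  One parameter \<open>n\<close> bounds both the number of test functions and the precision, which
  makes the condition a countable one.\<close>

lemma approaching_iff:
  "\<nu> \<in> approaching \<longleftrightarrow>
     \<nu> \<in> prob_measures \<and> (\<forall>n. \<exists>g. \<forall>j\<le>n. \<bar>\<integral>x. h j (\<alpha> g x) \<partial>\<nu>\<bar> < 1 / real (Suc n))"
proof safe
  assume "\<nu> \<in> approaching"
  then obtain \<mu> where \<nu>: "\<nu> \<in> prob_measures"
    and \<mu>: "\<mu> \<in> weak_star_topology closure_of measure_orbit \<alpha> \<nu>" "\<mu> \<in> prob_measures"
      "\<And>j. (\<integral>x. h j x \<partial>\<mu>) = 0"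
    unfolding approaching_def null_measures_def by auto
  show "\<nu> \<in> prob_measures" by fact
  fix n
  define T where "T = (\<Inter>j\<in>{..n}. {\<mu> \<in> prob_measures. (\<integral>x. h j x \<partial>\<mu>) \<in> {- 1 / real (Suc n)<..<1 / real (Suc n)}})"
  have "openin weak_star_topology T"
    unfolding T_def by (intro openin_INT2 openin_weak_star_integral cont_h) auto
  moreover have "\<mu> \<in> T" unfolding T_def using \<mu> by (auto simp: field_simps)
  ultimately obtain \<mu>' where "\<mu>' \<in> measure_orbit \<alpha> \<nu>" "\<mu>' \<in> T"
    using \<mu>(1) unfolding in_closure_of by blast
  then show "\<exists>g. \<forall>j\<le>n. \<bar>\<integral>x. h j (\<alpha> g x) \<partial>\<nu>\<bar> < 1 / real (Suc n)"
  proof -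
    from \<open>\<mu>' \<in> measure_orbit \<alpha> \<nu>\<close> obtain g where g: "\<mu>' = distr \<nu> borel (\<alpha> g)"
      by (auto simp: measure_orbit_def)
    have "\<bar>\<integral>x. h j (\<alpha> g x) \<partial>\<nu>\<bar> < 1 / real (Suc n)" if "j \<le> n" for j
    proof -
      have "(\<integral>x. h j x \<partial>\<mu>') \<in> {- 1 / real (Suc n)<..<1 / real (Suc n)}"
        using \<open>\<mu>' \<in> T\<close> that unfolding T_def by blast
      then show ?thesis by (simp add: g integral_act[OF \<nu> cont_h] abs_less_iff)
    qed
    then show ?thesis by blast
  qed
next
  assume \<nu>: "\<nu> \<in> prob_measures"
    and "\<forall>n. \<exists>g. \<forall>j\<le>n. \<bar>\<integral>x. h j (\<alpha> g x) \<partial>\<nu>\<bar> < 1 / real (Suc n)"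
  then obtain g where g: "\<And>n j. j \<le> n \<Longrightarrow> \<bar>\<integral>x. h j (\<alpha> (g n) x) \<partial>\<nu>\<bar> < 1 / real (Suc n)"
    by metis
  define m where "m n = distr \<nu> borel (\<alpha> (g n))" for n
  have m: "m n \<in> prob_measures" for n
    unfolding m_def by (rule distr_prob_measures[OF \<nu>]) simp
  obtain r \<mu> where r: "strict_mono (r :: nat \<Rightarrow> nat)" and \<mu>: "\<mu> \<in> prob_measures"
    and lim: "\<And>f :: 'a \<Rightarrow> real. continuous_on UNIV f \<Longrightarrow> (\<lambda>n. \<integral>x. f x \<partial>m (r n)) \<longlonglongrightarrow> (\<integral>x. f x \<partial>\<mu>)"
    using prob_measures_convergent_subseq[of m, OF m] by blast
  have "(\<integral>x. h j x \<partial>\<mu>) = 0" for j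
  proof (rule LIMSEQ_unique[OF lim[OF cont_h]])
    show "(\<lambda>n. \<integral>x. h j x \<partial>m (r n)) \<longlonglongrightarrow> 0"
    proof (rule LIMSEQ_subseq_LIMSEQ[OF _ r, unfolded o_def])
      show "(\<lambda>n. \<integral>x. h j x \<partial>m n) \<longlonglongrightarrow> 0"
      proof (rule tendsto_rabs_zero_cancel, rule tendsto_sandwich[OF _ _ tendsto_const lim_inverse_n'[THEN LIMSEQ_Suc]])
        show "\<forall>\<^sub>F n in sequentially. \<bar>\<integral>x. h j x \<partial>m n\<bar> \<le> 1 / real (Suc n)"
          using eventually_ge_at_top[of j]
        proof eventually_elim
          case (elim n) then show ?case
            unfolding m_def integral_act[OF \<nu> cont_h] using g[OF elim] by simp
        qed
      qed auto
    qed
  qed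
  moreover have "\<mu> \<in> weak_star_topology closure_of measure_orbit \<alpha> \<nu>"
    by (rule weak_star_closureI[of _ "\<lambda>n. m (r n)"])
       (use \<mu> lim measure_orbit_subset[OF \<nu>] in \<open>auto simp: m_def measure_orbit_def\<close>)
  ultimately show "\<nu> \<in> approaching" using \<nu> \<mu> unfolding approaching_def null_measures_def by blast
qed

text \<open>For fixed \<open>n\<close> the condition of \<open>approaching_iff\<close> is a union
  over the group of open sets, hence open whatever the cardinality of the group.\<close>

lemma gdelta_in_approaching: "gdelta_in weak_star_topology approaching"
proof -
  define O' where "O' n = (\<Union>g. \<Inter>j\<in>{..n}. {\<nu> \<in> prob_measures.
      (\<integral>x. h j (\<alpha> g x) \<partial>\<nu>) \<in> {- 1 / real (Suc n)<..<1 / real (Suc n)}})" for n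
  have "openin weak_star_topology (O' n)" for n
    unfolding O'_def
    by (intro openin_Union ballI, elim imageE, hypsubst)
       (intro openin_INT2 openin_weak_star_integral cont_h_act, auto)
  then have "gdelta_in weak_star_topology (\<Inter>(range O'))"
    by (intro gdelta_in_Inter) (auto intro: open_imp_gdelta_in)
  also have "\<Inter>(range O') = approaching"
    unfolding O'_def by (auto simp: approaching_iff abs_less_iff minus_less_iff) blast+
  finally show ?thesis .
qed

text \<open>
  A Baire category argument by hand: successive perturbations, each small on the finitely many test
  functions that matter so far, have a limit point that keeps all approximations reached on the way.
\<close>

lemma approaching_dense:
  assumes step: "\<And>\<mu> F n e. \<mu> \<in> prob_measures \<Longrightarrow> finite F \<Longrightarrow>
      (\<And>f :: 'a \<Rightarrow> real. f \<in> F \<Longrightarrow> continuous_on UNIV f) \<Longrightarrow> e > 0 \<Longrightarrow>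
      \<exists>\<mu>'\<in>prob_measures. (\<forall>f\<in>F. \<bar>(\<integral>x. f x \<partial>\<mu>') - (\<integral>x. f x \<partial>\<mu>)\<bar> < e) \<and>
         (\<exists>g. \<forall>j\<le>n. \<bar>\<integral>x. h j (\<alpha> g x) \<partial>\<mu>'\<bar> < e)"
  shows "weak_star_topology closure_of approaching = topspace weak_star_topology"
proof (rule equalityI[OF closure_of_subset_topspace], rule subsetI)
  fix \<nu>0 :: "'a measure" assume "\<nu>0 \<in> topspace weak_star_topology"
  then have \<nu>0: "\<nu>0 \<in> prob_measures" by (simp add: topspace_weak_star_topology)
  show "\<nu>0 \<in> weak_star_topology closure_of approaching"
    unfolding in_closure_of topspace_weak_star_topology
  proof (intro conjI \<nu>0 allI impI)
    fix T assume "\<nu>0 \<in> T \<and> openin weak_star_topology T"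
    then obtain F0 e where F0: "finite F0" "\<And>f. f \<in> F0 \<Longrightarrow> continuous_on UNIV f" and e: "e > (0::real)"
      and T: "\<And>\<mu>. \<mu> \<in> prob_measures \<Longrightarrow>
         (\<And>f. f \<in> F0 \<Longrightarrow> \<bar>(\<integral>x. f x \<partial>\<mu>) - (\<integral>x. f x \<partial>\<nu>0)\<bar> < e) \<Longrightarrow> \<mu> \<in> T"
      using weak_star_nhds[of T \<nu>0] by blast
    \<comment> \<open>The tolerances \<open>(e/4) * (1/2)^k\<close> add up to \<open>e/2\<close>,
      leaving room for the strict bound \<open>e\<close>. The translated functions
      \<open>h j\<close> join the test set, so that the smallness reached at stage \<open>k\<close>
      is protected from all later perturbations.\<close>
    define Q :: "nat \<Rightarrow> 'a measure \<times> ('a \<Rightarrow> real) set \<Rightarrow> 'a measure \<times> ('a \<Rightarrow> real) set \<Rightarrow> bool" where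
      "Q k p p' \<longleftrightarrow> snd p \<subseteq> snd p' \<and>
        (\<forall>f\<in>snd p. \<bar>(\<integral>x. f x \<partial>fst p') - (\<integral>x. f x \<partial>fst p)\<bar> < (e/4) * (1/2)^k) \<and>
        (\<exists>g. \<forall>j\<le>k. (\<lambda>x. h j (\<alpha> g x)) \<in> snd p' \<and> \<bar>\<integral>x. h j (\<alpha> g x) \<partial>fst p'\<bar> < (1/2)^k)" for k p p'
    define P where "P k p \<longleftrightarrow> fst p \<in> prob_measures \<and> finite (snd p) \<and> (\<forall>f\<in>snd p. continuous_on UNIV f) \<and>
        (k = 0 \<longrightarrow> p = (\<nu>0, F0))" for k :: nat and p :: "'a measure \<times> ('a \<Rightarrow> real) set"
    have "\<exists>s. \<forall>k. P k (s k) \<and> Q k (s k) (s (Suc k))"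
    proof (rule dependent_nat_choice)
      show "\<exists>p. P 0 p" using \<nu>0 F0 by (auto simp: P_def)
    next
      fix p k assume p: "P k p"
      define d where "d = min ((e/4) * (1/2)^k) ((1/2)^k)"
      have "d > 0" using e by (simp add: d_def)
      with step[of "fst p" "snd p" d k] p obtain \<mu>' g where *: "\<mu>' \<in> prob_measures"
        "\<And>f. f \<in> snd p \<Longrightarrow> \<bar>(\<integral>x. f x \<partial>\<mu>') - (\<integral>x. f x \<partial>fst p)\<bar> < d"
        "\<And>j. j \<le> k \<Longrightarrow> \<bar>\<integral>x. h j (\<alpha> g x) \<partial>\<mu>'\<bar> < d"
        unfolding P_def by blast
      show "\<exists>p'. P (Suc k) p' \<and> Q k p p'"
        using * p cont_h_act unfolding P_def Q_def d_def
        by (intro exI[of _ "(\<mu>', snd p \<union> (\<lambda>j x. h j (\<alpha> g x)) ` {..k})"]) auto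
    qed
    then obtain s where s: "\<And>k. P k (s k)" "\<And>k. Q k (s k) (s (Suc k))" by blast
    define m H where "m k = fst (s k)" and "H k = snd (s k)" for k
    have m: "m k \<in> prob_measures" for k using s(1)[of k] by (simp add: P_def m_def)
    have contH: "f \<in> H k \<Longrightarrow> continuous_on UNIV f" for f k using s(1)[of k] by (simp add: P_def H_def)
    have HS: "f \<in> H k \<Longrightarrow> f \<in> H (Suc k)" for f k using s(2)[of k] by (auto simp: Q_def H_def)
    have Hmono: "f \<in> H k \<Longrightarrow> f \<in> H (k + i)" for f k i by (induction i) (auto intro: HS)
    have step1: "f \<in> H k \<Longrightarrow> \<bar>(\<integral>x. f x \<partial>m (Suc k)) - (\<integral>x. f x \<partial>m k)\<bar> < (e/4) * (1/2)^k" for f k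
      using s(2)[of k] by (auto simp: Q_def H_def m_def)
    have dist: "\<bar>(\<integral>x. f x \<partial>m (k + i)) - (\<integral>x. f x \<partial>m k)\<bar> \<le> (e/2) * (1/2)^k - (e/2) * (1/2)^(k+i)"
      if "f \<in> H k" for f k i
    proof (induction i)
      case (Suc i)
      have "(e/2) * (1/2)^(k+i) - (e/2) * (1/2)^(k + Suc i) = (e/4) * (1/2)^(k+i)" by simp
      then show ?case using step1[OF Hmono[OF that], of i] Suc by (simp add: abs_if split: if_splits)
    qed simp
    obtain r \<mu> where r: "strict_mono (r :: nat \<Rightarrow> nat)" and \<mu>: "\<mu> \<in> prob_measures"
      and lim: "\<And>f :: 'a \<Rightarrow> real. continuous_on UNIV f \<Longrightarrow> (\<lambda>n. \<integral>x. f x \<partial>m (r n)) \<longlonglongrightarrow> (\<integral>x. f x \<partial>\<mu>)"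
      using prob_measures_convergent_subseq[of m, OF m] by blast
    have close: "\<bar>(\<integral>x. f x \<partial>\<mu>) - (\<integral>x. f x \<partial>m k)\<bar> \<le> (e/2) * (1/2)^k" if f: "f \<in> H k" for f k
    proof (rule LIMSEQ_le_const2)
      show "(\<lambda>n. \<bar>(\<integral>x. f x \<partial>m (r n)) - (\<integral>x. f x \<partial>m k)\<bar>) \<longlonglongrightarrow> \<bar>(\<integral>x. f x \<partial>\<mu>) - (\<integral>x. f x \<partial>m k)\<bar>"
        by (intro tendsto_intros lim contH[OF f])
      have "\<bar>(\<integral>x. f x \<partial>m (r n)) - (\<integral>x. f x \<partial>m k)\<bar> \<le> (e/2) * (1/2)^k" if "n \<ge> k" for n
      proof -
        have "k \<le> r n" using seq_suble[OF r, of n] that by simp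
        then have "\<bar>(\<integral>x. f x \<partial>m (r n)) - (\<integral>x. f x \<partial>m k)\<bar> \<le> (e/2) * (1/2)^k - (e/2) * (1/2)^(r n)"
          using dist[OF f, of "r n - k"] by simp
        moreover have "0 \<le> (e/2) * (1/2)^(r n)" using e by simp
        ultimately show ?thesis by linarith
      qed
      then show "\<exists>N. \<forall>n\<ge>N. \<bar>(\<integral>x. f x \<partial>m (r n)) - (\<integral>x. f x \<partial>m k)\<bar> \<le> (e/2) * (1/2)^k" by blast
    qed
    have s0: "m 0 = \<nu>0" "H 0 = F0" using s(1)[of 0] by (auto simp: P_def m_def H_def)
    have "\<mu> \<in> T"
    proof (rule T[OF \<mu>])
      fix f assume "f \<in> F0"
      then have "\<bar>(\<integral>x. f x \<partial>\<mu>) - (\<integral>x. f x \<partial>\<nu>0)\<bar> \<le> e/2" using close[of f 0] s0 by simp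
      then show "\<bar>(\<integral>x. f x \<partial>\<mu>) - (\<integral>x. f x \<partial>\<nu>0)\<bar> < e" using e by linarith
    qed
    moreover have "\<mu> \<in> approaching"
      unfolding approaching_iff
    proof (intro conjI \<mu> allI)
      fix n
      \<comment> \<open>The summand 1 accounts for the integral reached at stage \<open>k\<close>,
        the summand \<open>e\<close> for the drift from there to the limit measure.\<close>
      have "(\<lambda>k. (1 + e) * (1/2)^k) \<longlonglongrightarrow> (1 + e) * 0"
        by (intro tendsto_intros LIMSEQ_power_zero) auto
      then have "\<forall>\<^sub>F k in sequentially. (1 + e) * (1/2)^k < 1 / real (Suc n)"
        by (intro order_tendstoD) auto
      then obtain k where k: "k \<ge> n" "(1 + e) * (1/2)^k < 1 / real (Suc n)"
        unfolding eventually_sequentially by (meson le_cases)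
      obtain g where g: "\<And>j. j \<le> k \<Longrightarrow> (\<lambda>x. h j (\<alpha> g x)) \<in> H (Suc k)"
        "\<And>j. j \<le> k \<Longrightarrow> \<bar>\<integral>x. h j (\<alpha> g x) \<partial>m (Suc k)\<bar> < (1/2)^k"
        using s(2)[of k] unfolding Q_def H_def m_def by blast
      have "\<bar>\<integral>x. h j (\<alpha> g x) \<partial>\<mu>\<bar> < 1 / real (Suc n)" if "j \<le> n" for j
      proof -
        have "\<bar>(\<integral>x. h j (\<alpha> g x) \<partial>\<mu>) - (\<integral>x. h j (\<alpha> g x) \<partial>m (Suc k))\<bar> \<le> (e/2) * (1/2)^(Suc k)"
          using close[OF g(1)] that k(1) by simp
        also have "\<dots> \<le> e * (1/2)^k" using e by simp
        finally have "\<bar>\<integral>x. h j (\<alpha> g x) \<partial>\<mu>\<bar> < (1/2)^k + e * (1/2)^k"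
          using g(2)[of j] that k(1) by linarith
        then show ?thesis using k(2) by (simp add: algebra_simps)
      qed
      then show "\<exists>g. \<forall>j\<le>n. \<bar>\<integral>x. h j (\<alpha> g x) \<partial>\<mu>\<bar> < 1 / real (Suc n)" by blast
    qed
    ultimately show "\<exists>y. y \<in> approaching \<and> y \<in> T" by blast
  qed
qed

end

subsection \<open>Dynamical systems on topological spaces\<close>

lemma dynamical_system_euclideanD:
  assumes "dynamical_system (euclidean :: 'a::topological_space topology) \<alpha>"
  shows "continuous_on UNIV (\<alpha> g)" "\<alpha> 0 x = x" "\<alpha> (g + h) x = \<alpha> g (\<alpha> h x)"
    "\<alpha> (- g) (\<alpha> g x) = x" "\<alpha> g (\<alpha> (- g) x) = x"
proof -
  show "continuous_on UNIV (\<alpha> g)"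
    using assms homeomorphic_imp_continuous_map unfolding dynamical_system_def by fastforce
  have *: "\<alpha> 0 x = x" "\<And>g h. \<alpha> (g + h) x = \<alpha> g (\<alpha> h x)"
    using assms unfolding dynamical_system_def by auto
  then show "\<alpha> 0 x = x" "\<alpha> (g + h) x = \<alpha> g (\<alpha> h x)" by auto
  show "\<alpha> (- g) (\<alpha> g x) = x" "\<alpha> g (\<alpha> (- g) x) = x"
    using *(2)[of "- g" g] *(2)[of g "- g"] *(1) by simp_all
qed

lemma minimal_system_euclideanD:
  assumes "minimal_system (euclidean :: 'a::topological_space topology) \<alpha>"
  shows "dynamical_system (euclidean :: 'a topology) \<alpha>"
    "open U \<Longrightarrow> U \<noteq> {} \<Longrightarrow> \<exists>g. \<alpha> g x \<in> U"
proof -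
  show "dynamical_system (euclidean :: 'a topology) \<alpha>"
    using assms by (simp add: minimal_system_def)
  assume U: "open U" "U \<noteq> {}"
  have "closure (range (\<lambda>g. \<alpha> g x)) = UNIV"
    using assms by (simp add: minimal_system_def)
  then show "\<exists>g. \<alpha> g x \<in> U"
    using U open_Int_closure_eq_empty[of U "range (\<lambda>g. \<alpha> g x)"] by auto
qed

locale homogeneous_extension =
  fixes \<alpha> :: "'g::ab_group_add \<Rightarrow> 'x::compact_metric_space \<Rightarrow> 'x"
    and \<beta> :: "'g \<Rightarrow> 's::compact_metric_space \<Rightarrow> 's"
    and \<pi> :: "'x \<Rightarrow> 's"
    and \<tau> :: "'g \<Rightarrow> 't::t2_space \<Rightarrow> 't"
    and \<kappa> :: "'k::{topological_group_add,t2_space} \<Rightarrow> 't \<Rightarrow> 't"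
    and L :: "'k set" and \<psi> :: "'t \<Rightarrow> 'x"
  assumes minimal: "minimal_system euclidean \<alpha>"
    and base: "dynamical_system euclidean \<beta>"
    and ext: "extension euclidean \<alpha> euclidean \<beta> \<pi>"
    and presentation: "homogeneous_presentation \<alpha> \<beta> \<pi> \<tau> \<kappa> L \<psi>"
begin

lemmas act = dynamical_system_euclideanD[OF minimal_system_euclideanD(1)[OF minimal]]
lemmas act_dense = minimal_system_euclideanD(2)[OF minimal]
lemmas act_base = dynamical_system_euclideanD[OF base]

lemma minimal_cover: "minimal_system euclidean \<tau>"
  using presentation by (simp add: homogeneous_presentation_def)

lemmas act_cover = dynamical_system_euclideanD[OF minimal_system_euclideanD(1)[OF minimal_cover]]
lemmas act_cover_dense = minimal_system_euclideanD(2)[OF minimal_cover]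

lemma cont_\<pi>: "continuous_on UNIV \<pi>"
  and equivariant_\<pi>: "\<pi> (\<alpha> g x) = \<beta> g (\<pi> x)"
  using ext by (auto simp: extension_def)

lemma cont_\<psi>: "continuous_on UNIV \<psi>"
  and surj_\<psi>: "\<exists>z. \<psi> z = x"
  and equivariant_\<psi>: "\<psi> (\<tau> g z) = \<alpha> g (\<psi> z)"
proof -
  have "extension euclidean \<tau> euclidean \<alpha> \<psi>" using presentation by (simp add: homogeneous_presentation_def)
  then show "continuous_on UNIV \<psi>" "\<exists>z. \<psi> z = x" "\<psi> (\<tau> g z) = \<alpha> g (\<psi> z)"
    unfolding extension_def by (auto simp: surj_def) (metis surjD)
qed

lemma surj_\<pi>: "\<exists>x. \<pi> x = y"
  using ext unfolding extension_def by simp (metis surjD)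

lemma compact_cover: "compact (UNIV :: 't set)"
  using minimal_cover by (simp add: minimal_system_def dynamical_system_def compact_space_def)

lemma compact_group: "compact (UNIV :: 'k set)"
  and cont_\<kappa>: "continuous_on UNIV (\<lambda>(k, z). \<kappa> k z)"
  and \<kappa>_0: "\<kappa> 0 z = z" and \<kappa>_add: "\<kappa> (k + k') z = \<kappa> k (\<kappa> k' z)"
  and \<kappa>_free: "\<kappa> k z = z \<Longrightarrow> k = 0"
  and \<kappa>_commute: "\<kappa> k (\<tau> g z) = \<tau> g (\<kappa> k z)"
  using presentation by (auto simp: homogeneous_presentation_def)

lemma \<psi>_eq_iff: "\<psi> z = \<psi> z' \<longleftrightarrow> (\<exists>k\<in>L. z' = \<kappa> k z)"
  and \<pi>\<psi>_eq_iff: "\<pi> (\<psi> z) = \<pi> (\<psi> z') \<longleftrightarrow> (\<exists>k. z' = \<kappa> k z)"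
  using presentation unfolding homogeneous_presentation_def by blast+

lemma cont_\<kappa>': "continuous_on UNIV (\<kappa> k)"
proof -
  have "continuous_on UNIV (\<lambda>z. (\<lambda>(k, z). \<kappa> k z) (k, z))"
    by (rule continuous_on_compose2[OF cont_\<kappa>]) (auto intro!: continuous_intros)
  then show ?thesis by simp
qed

lemma cont_\<kappa>_orbit: "continuous_on UNIV (\<lambda>k. \<kappa> k z)"
proof -
  have "continuous_on UNIV (\<lambda>k. (\<lambda>(k, z). \<kappa> k z) (k, z))"
    by (rule continuous_on_compose2[OF cont_\<kappa>]) (auto intro!: continuous_intros)
  then show ?thesis by simp
qed

lemma \<kappa>_inj: "\<kappa> k z = \<kappa> k' z \<Longrightarrow> k = k'"
  using \<kappa>_free[of "- k' + k" z] by (simp add: \<kappa>_add) (metis \<kappa>_0 \<kappa>_add add.left_inverse add_eq_0_iff minus_minus)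

subsection \<open>Haar measures on the fibres\<close>

text \<open>
  Writing a point of the fibre as \<open>w = \<kappa> k z\<close>, the integral of \<open>F (\<kappa> (- k + l) z)\<close> over the fibre does
  not depend on \<open>l\<close>; replacing it by a Riemann sum gives a finite average of translates of \<open>F\<close>.
\<close>

lemma almost_constant_average:
  fixes F :: "'t \<Rightarrow> real"
  assumes F: "continuous_on UNIV F" and e: "e > 0" and m: "m \<in> prob_measures"
    and fib: "emeasure m {z. \<pi> (\<psi> z) = y} = 1" and inv: "\<And>k. distr m borel (\<kappa> k) = m"
  obtains n :: nat and c q C where "\<And>i. c i \<ge> (0::real)" "(\<Sum>i<n. c i) = 1"
    "\<And>w. \<pi> (\<psi> w) = y \<Longrightarrow> \<bar>(\<Sum>i<n. c i * F (\<kappa> (q i) w)) - C\<bar> \<le> e"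
proof -
  interpret prob_space m using m by (rule prob_measuresD)
  have setsm [simp]: "sets m = sets borel" "space m = UNIV" using prob_measuresD[OF m] by auto
  obtain z where z: "\<pi> (\<psi> z) = y" using surj_\<pi>[of y] surj_\<psi> by metis
  define S where "S = {w. \<pi> (\<psi> w) = y}"
  have S_eq: "S = range (\<lambda>k. \<kappa> k z)"
  proof (rule set_eqI)
    fix w
    have "\<pi> (\<psi> w) = y \<longleftrightarrow> (\<exists>k. w = \<kappa> k z)" using \<pi>\<psi>_eq_iff[of z w] z by metis
    then show "w \<in> S \<longleftrightarrow> w \<in> range (\<lambda>k. \<kappa> k z)" by (simp add: S_def image_iff)
  qed
  have "compact S" unfolding S_eq by (rule compact_continuous_image[OF cont_\<kappa>_orbit compact_group])
  then have clS: "closed S" by (rule compact_imp_closed)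
  then have [measurable]: "S \<in> sets borel" by simp
  have AES: "AE w in m. w \<in> S"
    using fib clS by (subst AE_in_set_eq_1) (auto simp: S_def emeasure_eq_measure)
  define k where "k w = (THE k. w = \<kappa> k z)" for w
  have k: "k (\<kappa> l z) = l" for l
    unfolding k_def by (rule the_equality) (auto dest: \<kappa>_inj)
  have contk: "continuous_on S k"
    unfolding S_eq by (rule continuous_on_inv[OF cont_\<kappa>_orbit compact_group]) (simp add: k)
  \<comment> \<open>The coordinate \<open>k\<close> is meaningful only on the fibre
    \<open>S\<close>, where it is continuous; the indicator turns the integrand into a Borel
    function on the whole space.\<close>
  define G where "G l w = indicator S w *\<^sub>R F (\<kappa> (- k w + l) z)" for l w
  have G_meas: "G l \<in> borel_measurable borel" for l
    unfolding G_def
  proof (rule borel_measurable_continuous_on_indicator)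
    show "continuous_on S (\<lambda>w. F (\<kappa> (- k w + l) z))"
      by (rule continuous_on_compose2[OF F], rule continuous_on_compose2[OF cont_\<kappa>_orbit])
         (auto intro!: continuous_intros contk)
  qed simp
  obtain B where B: "\<And>w. \<bar>F w\<bar> \<le> B"
  proof -
    have "bounded (range F)" by (intro compact_imp_bounded compact_continuous_image F compact_cover)
    then show thesis using that by (auto simp: bounded_real)
  qed
  have B0: "0 \<le> B" using B[of undefined] by linarith
  have G_int: "integrable m (G l)" for l
    by (rule integrable_bounded_prob[OF m G_meas, of _ B]) (auto simp: G_def indicator_def B B0)
  \<comment> \<open>Replacing \<open>w\<close> by \<open>\<kappa> l w\<close> changes its coordinate
    from \<open>j\<close> to \<open>l + j\<close>, and \<open>- (l + j) + l = - j\<close>. The order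
    of the summands matters, since the structure group need not be commutative.\<close>
  have const: "(\<integral>w. G l w \<partial>m) = (\<integral>w. G 0 w \<partial>m)" for l
  proof -
    have meas: "\<kappa> l \<in> borel_measurable borel"
      by (rule borel_measurable_continuous_onI[OF cont_\<kappa>'])
    have "(\<integral>w. G l w \<partial>m) = (\<integral>w. G l (\<kappa> l w) \<partial>m)"
      by (subst inv[of l, symmetric], rule integral_distr_prob[OF m meas G_meas])
    also have "(\<lambda>w. G l (\<kappa> l w)) = G 0"
    proof
      fix w
      have mem: "\<kappa> l w \<in> S \<longleftrightarrow> w \<in> S" using \<pi>\<psi>_eq_iff[of w "\<kappa> l w"] by (auto simp: S_def)
      show "G l (\<kappa> l w) = G 0 w"
      proof (cases "w \<in> S")
        case True
        then obtain j where j: "w = \<kappa> j z" unfolding S_eq by blast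
        then have "k (\<kappa> l w) = l + j" "k w = j" by (simp_all add: k flip: \<kappa>_add)
        then show ?thesis using mem True by (simp add: G_def minus_add add.assoc)
      qed (use mem in \<open>auto simp: G_def\<close>)
    qed
    finally show ?thesis .
  qed
  \<comment> \<open>Compactness in \<open>l\<close> gives a neighbourhood independent of
    \<open>l\<close>, so one Riemann sum approximates the integral at all points of the
    fibre.\<close>
  have "\<exists>U. open U \<and> k0 \<in> U \<and> (\<forall>k\<in>U. \<forall>l. \<bar>F (\<kappa> (- k + l) z) - F (\<kappa> (- k0 + l) z)\<bar> < e)" for k0
  proof -
    define W where "W = {p. \<bar>F (\<kappa> (- fst p + snd p) z) - F (\<kappa> (- k0 + snd p) z)\<bar> < e}"
    have "open W"
      unfolding W_def
      by (intro open_Collect_less continuous_intros continuous_on_compose2[OF F] continuous_on_compose2[OF cont_\<kappa>_orbit]) auto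
    moreover have "{k0} \<times> UNIV \<subseteq> W" using e by (auto simp: W_def)
    ultimately obtain X where "k0 \<in> X" "open X" "X \<times> UNIV \<subseteq> W"
      using Elementary_Topology.tube_lemma[OF compact_group, of W k0] by blast
    then have "\<bar>F (\<kappa> (- k + l) z) - F (\<kappa> (- k0 + l) z)\<bar> < e" if "k \<in> X" for k l
      using that by (auto simp: W_def dest!: subsetD[of _ _ "(k, l)"])
    with \<open>k0 \<in> X\<close> \<open>open X\<close> show ?thesis by blast
  qed
  then obtain U where U: "\<And>k0. open (U k0)" "\<And>k0. k0 \<in> U k0"
    "\<And>k0 k l. k \<in> U k0 \<Longrightarrow> \<bar>F (\<kappa> (- k + l) z) - F (\<kappa> (- k0 + l) z)\<bar> < e" by metis
  obtain D where D: "finite D" "UNIV \<subseteq> (\<Union>d\<in>D. U d)"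
    using compactE_image[OF compact_group, of UNIV U] U by (metis UNIV_I UN_I subsetI)
  obtain n :: nat and p where np: "D = p ` {..<n}"
    using finite_imp_nat_seg_image_inj_on[OF D(1)] by (auto simp: lessThan_def)
  \<comment> \<open>The finite cover is made disjoint by taking the first index that fits; the
    masses of the pieces become the weights of the average.\<close>
  define P where "P i = (S \<inter> k -` U (p i)) - (\<Union>j<i. S \<inter> k -` U (p j))" for i
  have [measurable]: "S \<inter> k -` U d \<in> sets borel" for d
  proof -
    obtain T where "open T" "S \<inter> k -` U d = S \<inter> T"
      using continuous_openin_preimage_gen[OF contk U(1)] by (metis openin_open)
    then show ?thesis by simp
  qed
  have [measurable]: "P i \<in> sets borel" for i unfolding P_def by measurable
  have Pdisj: "w \<in> P i \<Longrightarrow> w \<in> P j \<Longrightarrow> i = j" for w i j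
    unfolding P_def by (cases i j rule: linorder_cases) auto
  have Pex: "\<exists>i<n. w \<in> P i" if "w \<in> S" for w
  proof -
    have "\<exists>i<n. k w \<in> U (p i)" using D(2) unfolding np by blast
    then obtain i where "i < n" "k w \<in> U (p i)" "\<forall>j<i. \<not> (j < n \<and> k w \<in> U (p j))"
      using exists_least_iff[of "\<lambda>i. i < n \<and> k w \<in> U (p i)"] by blast
    then show ?thesis using that by (intro exI[of _ i]) (auto simp: P_def)
  qed
  define s where "s l w = (\<Sum>i<n. F (\<kappa> (- p i + l) z) * indicat_real (P i) w)" for l w
  have s_eq: "s l w = F (\<kappa> (- p i + l) z)" if "i < n" "w \<in> P i" for l w i
  proof -
    have "s l w = (\<Sum>j<n. if j = i then F (\<kappa> (- p i + l) z) else 0)"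
      unfolding s_def by (rule sum.cong) (use Pdisj that in \<open>auto simp: indicator_def\<close>)
    then show ?thesis using that by simp
  qed
  define c where "c i = measure m (P i)" for i
  have ind_int: "integrable m (indicat_real (P i))" for i
    by (simp add: emeasure_eq_measure)
  have s_int: "integrable m (s l)" for l
    unfolding s_def by (intro Bochner_Integration.integrable_sum integrable_mult_right ind_int)
  have s_val: "(\<integral>w. s l w \<partial>m) = (\<Sum>i<n. c i * F (\<kappa> (- p i + l) z))" for l
    unfolding s_def
    by (subst Bochner_Integration.integral_sum)
       (simp_all add: ind_int c_def mult.commute)
  show thesis
  proof (rule that[of c n "\<lambda>i. - p i" "\<integral>w. G 0 w \<partial>m"])
    show "c i \<ge> 0" for i by (simp add: c_def)
    have "(\<Sum>i<n. c i) = measure m (\<Union>i<n. P i)"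
      unfolding c_def by (rule finite_measure_finite_Union[symmetric])
        (auto simp: disjoint_family_on_def dest: Pdisj)
    also have "(\<Union>i<n. P i) = S"
    proof
      show "(\<Union>i<n. P i) \<subseteq> S" by (auto simp: P_def)
      show "S \<subseteq> (\<Union>i<n. P i)" using Pex by blast
    qed
    also have "measure m S = 1" using fib by (simp add: S_def emeasure_eq_measure)
    finally show "(\<Sum>i<n. c i) = 1" .
  next
    fix w assume "\<pi> (\<psi> w) = y"
    then obtain l where l: "w = \<kappa> l z" using \<pi>\<psi>_eq_iff[of z w] z by auto
    have "(\<Sum>i<n. c i * F (\<kappa> (- p i) w)) = (\<integral>w. s l w \<partial>m)" by (simp add: s_val l \<kappa>_add)
    moreover have "\<bar>(\<integral>w. s l w \<partial>m) - (\<integral>w. G l w \<partial>m)\<bar> \<le> e"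
    proof (rule integral_diff_le_prob[OF m s_int G_int])
      show "AE w in m. \<bar>s l w - G l w\<bar> \<le> e"
        using AES
      proof (rule AE_mp, intro AE_I2 impI)
        fix v assume v: "v \<in> S"
        then obtain i where i: "i < n" "v \<in> P i" using Pex by blast
        then have "k v \<in> U (p i)" by (auto simp: P_def)
        then show "\<bar>s l v - G l v\<bar> \<le> e"
          using U(3)[of "k v" "p i" l] s_eq[OF i] v by (simp add: G_def)
      qed
    qed
    ultimately show "\<bar>(\<Sum>i<n. c i * F (\<kappa> (- p i) w)) - (\<integral>w. G 0 w \<partial>m)\<bar> \<le> e"
      using const[of l] by simp
  qed
qed

end

locale Haar_extension = homogeneous_extension \<alpha> \<beta> \<pi> \<tau> \<kappa> L \<psi>
  for \<alpha> :: "'g::ab_group_add \<Rightarrow> 'x::compact_metric_space \<Rightarrow> 'x"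
    and \<beta> :: "'g \<Rightarrow> 's::compact_metric_space \<Rightarrow> 's"
    and \<pi> :: "'x \<Rightarrow> 's"
    and \<tau> :: "'g \<Rightarrow> 't::t2_space \<Rightarrow> 't"
    and \<kappa> :: "'k::{topological_group_add,t2_space} \<Rightarrow> 't \<Rightarrow> 't"
    and L :: "'k set" and \<psi> :: "'t \<Rightarrow> 'x" +
  fixes hm :: "'s \<Rightarrow> 'x measure"
  assumes Haar: "fibre_Haar_measures \<pi> \<kappa> \<psi> hm"
begin

lemma Haar_lift:
  obtains m where "m \<in> prob_measures" "emeasure m {z. \<pi> (\<psi> z) = y} = 1"
    "\<And>k. distr m borel (\<kappa> k) = m" "hm y = distr m borel \<psi>"
  using Haar unfolding fibre_Haar_measures_def prob_measures_iff by metis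

lemma measurable_\<psi>: "\<psi> \<in> borel_measurable borel"
  by (rule borel_measurable_continuous_onI[OF cont_\<psi>])

lemma measurable_\<pi>: "\<pi> \<in> borel_measurable borel"
  by (rule borel_measurable_continuous_onI[OF cont_\<pi>])

lemma hm_prob: "hm y \<in> prob_measures"
  by (rule Haar_lift[of y]) (use distr_prob_measures measurable_\<psi> in metis)

lemma closed_fibre: "closed {x. \<pi> x = y}"
  by (intro closed_Collect_eq cont_\<pi> continuous_intros)

lemma hm_fibre: "AE x in hm y. \<pi> x = y"
proof -
  obtain m where m: "m \<in> prob_measures" "emeasure m {z. \<pi> (\<psi> z) = y} = 1" "hm y = distr m borel \<psi>"
    using Haar_lift by metis
  interpret prob_space m using m(1) by (rule prob_measuresD)
  have "closed {z. \<pi> (\<psi> z) = y}"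
    using continuous_closed_vimage[of "{x. \<pi> x = y}" \<psi>] closed_fibre cont_\<psi>
    by (simp add: vimage_def continuous_on_eq_continuous_at)
  then have "{z. \<pi> (\<psi> z) = y} \<in> sets m" using prob_measuresD(1)[OF m(1)] by simp
  then have "AE z in m. z \<in> {z. \<pi> (\<psi> z) = y}"
    using m(2) by (subst AE_in_set_eq_1) (auto simp: emeasure_eq_measure)
  then have "AE z in m. \<pi> (\<psi> z) = y" by simp
  then show ?thesis
    unfolding m(3) using closed_fibre[of y]
    by (subst AE_distr_iff) (auto intro!: measurable_prob_measures[OF m(1)] measurable_\<psi>)
qed

text \<open>By invariance, an average of translates of \<open>f \<circ> \<psi>\<close> has the same
  integral as \<open>f \<circ> \<psi>\<close> against every fibre measure. An average nearly
  constant on the fibre over \<open>y\<close> stays nearly constant on neighbouring fibres, so both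
  integrals are close to that constant. No uniqueness of the lifted measures is invoked.\<close>

lemma continuous_hm:
  fixes f :: "'x \<Rightarrow> real"
  assumes f: "continuous_on UNIV f"
  shows "continuous_on UNIV (\<lambda>y. \<integral>x. f x \<partial>hm y)"
proof -
  define F where "F z = f (\<psi> z)" for z
  have F: "continuous_on UNIV F"
    unfolding F_def by (rule continuous_on_compose2[OF f cont_\<psi>]) simp
  have int_hm: "(\<integral>x. f x \<partial>hm y) = (\<integral>z. F z \<partial>m)" if "m \<in> prob_measures" "hm y = distr m borel \<psi>" for y m
    unfolding that(2) F_def
    by (rule integral_distr_prob[OF that(1) measurable_\<psi> borel_measurable_continuous_onI[OF f]])
  have "\<exists>d>0. \<forall>y'. dist y' y < d \<longrightarrow> \<bar>(\<integral>x. f x \<partial>hm y') - (\<integral>x. f x \<partial>hm y)\<bar> < e"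
    if e: "e > 0" for y e
  proof -
    obtain m where m: "m \<in> prob_measures" "emeasure m {z. \<pi> (\<psi> z) = y} = 1"
      "\<And>k. distr m borel (\<kappa> k) = m" "hm y = distr m borel \<psi>"
      using Haar_lift by metis
    have e5: "e/5 > 0" using e by simp
    obtain n :: nat and c q C where c: "\<And>i. c i \<ge> (0::real)" "(\<Sum>i<n. c i) = 1"
      and C: "\<And>w. \<pi> (\<psi> w) = y \<Longrightarrow> \<bar>(\<Sum>i<n. c i * F (\<kappa> (q i) w)) - C\<bar> \<le> e/5"
      by (rule almost_constant_average[OF F e5 m(1,2,3)]) blast
    define A where "A w = (\<Sum>i<n. c i * F (\<kappa> (q i) w))" for w
    have Fk: "continuous_on UNIV (\<lambda>w. F (\<kappa> k w))" for k
      by (rule continuous_on_compose2[OF F cont_\<kappa>']) simp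
    have A: "continuous_on UNIV A" unfolding A_def by (intro continuous_intros Fk)
    \<comment> \<open>The average is within \<open>e/5\<close> of \<open>C\<close> over
      \<open>y\<close>, so the compact image of \<open>Z\<close> misses \<open>y\<close>. Near
      \<open>y\<close> the error is at most \<open>2 * (e/5)\<close>, and comparing two fibres costs
      \<open>4 * (e/5) < e\<close>.\<close>
    define Z where "Z = {w. 2 * (e/5) \<le> \<bar>A w - C\<bar>}"
    have "closed Z" unfolding Z_def by (intro closed_Collect_le continuous_intros A)
    then have "compact Z" using compact_Int_closed[OF compact_cover] by fastforce
    then have "compact ((\<lambda>w. \<pi> (\<psi> w)) ` Z)"
      by (rule compact_continuous_image[rotated])
         (rule continuous_on_compose2[OF cont_\<pi>], rule continuous_on_subset[OF cont_\<psi>], auto)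
    then have "open (- (\<lambda>w. \<pi> (\<psi> w)) ` Z)" by (simp add: compact_imp_closed open_Compl)
    moreover have "y \<in> - (\<lambda>w. \<pi> (\<psi> w)) ` Z"
      using C e by (fastforce simp: Z_def A_def)
    ultimately have "\<exists>d>0. \<forall>y'. dist y' y < d \<longrightarrow> y' \<in> - (\<lambda>w. \<pi> (\<psi> w)) ` Z"
      unfolding open_dist by blast
    then obtain d where d: "d > 0" "\<And>y'. dist y' y < d \<Longrightarrow> y' \<notin> (\<lambda>w. \<pi> (\<psi> w)) ` Z"
      by blast
    have close: "\<bar>(\<integral>x. f x \<partial>hm y') - C\<bar> \<le> 2 * (e/5)" if "dist y' y < d" for y'
    proof -
      obtain m' where m': "m' \<in> prob_measures" "emeasure m' {z. \<pi> (\<psi> z) = y'} = 1"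
        "\<And>k. distr m' borel (\<kappa> k) = m'" "hm y' = distr m' borel \<psi>"
        using Haar_lift by metis
      interpret prob_space m' using m'(1) by (rule prob_measuresD)
      have intF: "integrable m' (\<lambda>w. F (\<kappa> k w))" for k
      proof -
        obtain B where "\<And>x. \<bar>f x\<bar> \<le> B" by (rule continuous_imp_bounded_real[OF f]) blast
        then show ?thesis
          by (intro integrable_bounded_prob[OF m'(1) borel_measurable_continuous_onI[OF Fk], of _ B])
             (simp add: F_def)
      qed
      have "(\<integral>w. F (\<kappa> k w) \<partial>m') = (\<integral>x. f x \<partial>hm y')" for k
      proof -
        have "(\<integral>w. F (\<kappa> k w) \<partial>m') = (\<integral>w. F w \<partial>distr m' borel (\<kappa> k))"
          by (rule integral_distr_prob[OF m'(1) borel_measurable_continuous_onI[OF cont_\<kappa>']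
                borel_measurable_continuous_onI[OF F], symmetric])
        then show ?thesis using m'(3) int_hm[OF m'(1,4)] by simp
      qed
      then have "(\<integral>w. A w \<partial>m') = (\<Sum>i<n. c i * (\<integral>x. f x \<partial>hm y'))"
        unfolding A_def using intF by simp
      also have "\<dots> = (\<integral>x. f x \<partial>hm y')" using c(2) by (simp flip: sum_distrib_right)
      finally have "(\<integral>x. f x \<partial>hm y') = (\<integral>w. A w \<partial>m')" by simp
      moreover have "\<bar>(\<integral>w. A w \<partial>m') - (\<integral>w. C \<partial>m')\<bar> \<le> 2 * (e/5)"
      proof (rule integral_diff_le_prob[OF m'(1)])
        show "integrable m' A" unfolding A_def using intF by simp
        have "closed {z. \<pi> (\<psi> z) = y'}"
          using continuous_closed_vimage[of "{x. \<pi> x = y'}" \<psi>] closed_fibre cont_\<psi>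
          by (simp add: vimage_def continuous_on_eq_continuous_at)
        then have "{z. \<pi> (\<psi> z) = y'} \<in> sets m'" using prob_measuresD(1)[OF m'(1)] by simp
        then have "AE z in m'. z \<in> {z. \<pi> (\<psi> z) = y'}"
          using m'(2) by (subst AE_in_set_eq_1) (auto simp: emeasure_eq_measure)
        then show "AE w in m'. \<bar>A w - C\<bar> \<le> 2 * (e/5)"
        proof (rule AE_mp, intro AE_I2 impI)
          fix w assume "w \<in> {z. \<pi> (\<psi> z) = y'}"
          then have "w \<notin> Z" using d(2)[OF that] by blast
          then show "\<bar>A w - C\<bar> \<le> 2 * (e/5)" by (simp add: Z_def)
        qed
      qed simp
      ultimately show ?thesis by (simp add: prob_space)
    qed
    show ?thesis
    proof (intro exI[of _ d] conjI d(1) allI impI)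
      fix y' assume "dist y' y < d"
      then show "\<bar>(\<integral>x. f x \<partial>hm y') - (\<integral>x. f x \<partial>hm y)\<bar> < e"
        using close[of y'] close[of y] d(1) e by (simp add: abs_if split: if_splits)
    qed
  qed
  then show ?thesis unfolding continuous_on_iff dist_real_def by blast
qed

end

subsection \<open>Regional proximality\<close>

context homogeneous_extension
begin

text \<open>For a pair of points this is regional proximality, usually stated by nearby points with
  a translate that nearly identifies them; \<open>RP_I\<close> starts from that form. The present
  form makes sense for larger sets: the same \<open>g\<close> has to serve every point of
  \<open>A\<close>.\<close>

definition reach :: "'x set \<Rightarrow> bool" where
  "reach A \<longleftrightarrow> (\<forall>V e. open V \<longrightarrow> V \<noteq> {} \<longrightarrow> e > 0 \<longrightarrow> (\<exists>g. \<forall>a\<in>A. \<exists>v\<in>V. dist (\<alpha> g v) a < e))"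

definition RP :: "'x \<Rightarrow> 'x \<Rightarrow> bool" where
  "RP x x' \<longleftrightarrow> reach {x, x'}"

lemma reachD:
  assumes "reach A" "open V" "V \<noteq> {}" "e > 0"
  obtains g where "\<And>a. a \<in> A \<Longrightarrow> \<exists>v\<in>V. dist (\<alpha> g v) a < e"
  using assms unfolding reach_def by metis

lemma RPD:
  assumes "RP x x'" "open V" "V \<noteq> {}" "e > 0"
  obtains g v v' where "v \<in> V" "v' \<in> V" "dist (\<alpha> g v) x < e" "dist (\<alpha> g v') x' < e"
proof -
  obtain g where "\<And>a. a \<in> {x, x'} \<Longrightarrow> \<exists>v\<in>V. dist (\<alpha> g v) a < e"
    using reachD[OF assms(1)[unfolded RP_def] assms(2-4)] by metis
  then have "\<exists>v\<in>V. dist (\<alpha> g v) x < e" "\<exists>v\<in>V. dist (\<alpha> g v) x' < e" by blast+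
  then show thesis using that by blast
qed

lemma RP_sym: "RP x x' \<Longrightarrow> RP x' x"
  by (simp add: RP_def insert_commute)

lemma RP_refl: "RP x x"
  unfolding RP_def reach_def
proof (intro allI impI)
  fix V :: "'x set" and e :: real assume V: "open V" "V \<noteq> {}" "e > 0"
  then obtain v where "v \<in> V" by blast
  obtain g where "\<alpha> g v \<in> ball x e" using act_dense[of "ball x e" v] V by auto
  then show "\<exists>g. \<forall>a\<in>{x, x}. \<exists>v\<in>V. dist (\<alpha> g v) a < e"
    using \<open>v \<in> V\<close> by (auto simp: dist_commute)
qed

lemma RP_closed:
  assumes "\<And>e. e > 0 \<Longrightarrow> \<exists>y y'. RP y y' \<and> dist y x < e \<and> dist y' x' < e"
  shows "RP x x'"
  unfolding RP_def reach_def
proof (intro allI impI)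
  fix V :: "'x set" and e :: real assume V: "open V" "V \<noteq> {}" "e > 0"
  then have e2: "e/2 > 0" by simp
  with assms obtain y y' where y: "RP y y'" "dist y x < e/2" "dist y' x' < e/2" by blast
  obtain g v v' where "v \<in> V" "v' \<in> V" "dist (\<alpha> g v) y < e/2" "dist (\<alpha> g v') y' < e/2"
    using RPD[OF y(1) V(1,2) e2] by metis
  then show "\<exists>g. \<forall>a\<in>{x, x'}. \<exists>v\<in>V. dist (\<alpha> g v) a < e"
    using y(2,3) dist_triangle_half_r[of y] by (metis dist_commute dist_triangle_half_l insertE singletonD)
qed

lemma uniform_act:
  assumes "e > 0"
  obtains d where "d > 0" "\<And>x y. dist x y < d \<Longrightarrow> dist (\<alpha> g x) (\<alpha> g y) < e"
  using continuous_imp_uniformly_continuous_space[OF act(1) assms] by metis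

lemma reach_act:
  assumes "reach A" shows "reach (\<alpha> g ` A)"
  unfolding reach_def
proof (intro allI impI)
  fix V :: "'x set" and e :: real assume V: "open V" "V \<noteq> {}" "e > 0"
  obtain d where d: "d > 0" "\<And>x y. dist x y < d \<Longrightarrow> dist (\<alpha> g x) (\<alpha> g y) < e"
    using uniform_act[OF V(3)] by metis
  obtain h where h: "\<And>a. a \<in> A \<Longrightarrow> \<exists>v\<in>V. dist (\<alpha> h v) a < d"
    using reachD[OF assms V(1,2) d(1)] by metis
  then show "\<exists>h. \<forall>a\<in>\<alpha> g ` A. \<exists>v\<in>V. dist (\<alpha> h v) a < e"
    by (intro exI[of _ "g + h"]) (use d(2) in \<open>fastforce simp: act(3)\<close>)
qed

lemma RP_act: "RP x x' \<Longrightarrow> RP (\<alpha> g x) (\<alpha> g x')"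
  using reach_act[of "{x, x'}" g] by (simp add: RP_def)

lemma open_act_image: "open V \<Longrightarrow> open (\<alpha> g ` V)"
proof -
  assume "open V"
  have "\<alpha> g ` V = \<alpha> (- g) -` V" by (auto simp: act intro!: image_eqI[of _ _ "\<alpha> (- g) _"])
  then show ?thesis using \<open>open V\<close> act(1)[of "- g"]
    by (simp add: continuous_open_vimage continuous_on_eq_continuous_at)
qed

lemma open_act_vimage: "open V \<Longrightarrow> open (\<alpha> g -` V)"
  using act(1)[of g] by (simp add: continuous_open_vimage continuous_on_eq_continuous_at)

text \<open>The translates of a given open set cover the space, so close pairs lie in a common translate.\<close>

lemma RP_I:
  assumes "\<And>e. e > 0 \<Longrightarrow> \<exists>u u' g. dist u x < e \<and> dist u' x' < e \<and> dist (\<alpha> g u) (\<alpha> g u') < e"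
  shows "RP x x'"
  unfolding RP_def reach_def
proof (intro allI impI)
  fix V :: "'x set" and e :: real assume V: "open V" "V \<noteq> {}" "e > 0"
  have cov: "UNIV \<subseteq> \<Union>(range (\<lambda>g. \<alpha> g -` V))" using act_dense[OF V(1,2)] by fastforce
  have op: "open B" if "B \<in> range (\<lambda>g. \<alpha> g -` V)" for B using that open_act_vimage[OF V(1)] by auto
  from Heine_Borel_lemma[OF compact_UNIV_metric cov op]
  obtain d where d: "d > 0" "\<And>y. \<exists>G\<in>range (\<lambda>g. \<alpha> g -` V). ball y d \<subseteq> G" by auto
  obtain u u' g where u: "dist u x < min d e" "dist u' x' < min d e" "dist (\<alpha> g u) (\<alpha> g u') < min d e"
    using assms[of "min d e"] d(1) V(3) by auto
  obtain h where "ball (\<alpha> g u) d \<subseteq> \<alpha> h -` V" using d(2)[of "\<alpha> g u"] by blast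
  then have "\<alpha> h (\<alpha> g u) \<in> V" "\<alpha> h (\<alpha> g u') \<in> V"
    using u(3) d(1) by (auto dest: subsetD[of _ _ "\<alpha> g u"] subsetD[of _ _ "\<alpha> g u'"])
  moreover have "\<alpha> (- (h + g)) (\<alpha> h (\<alpha> g v)) = v" for v by (simp flip: act(3)) (simp add: act(2))
  ultimately show "\<exists>g. \<forall>a\<in>{x, x'}. \<exists>v\<in>V. dist (\<alpha> g v) a < e"
    using u by (intro exI[of _ "- (h + g)"]) (metis insertE min_less_iff_conj singletonD)
qed

text \<open>The \<open>L\<close>-saturation of \<open>W\<close> is open, and its compact complement
  maps exactly onto the complement of the image of \<open>W\<close>.\<close>

lemma open_\<psi>:
  assumes "open W" shows "open (\<psi> ` W)"
proof -
  define U where "U = (\<Union>l\<in>L. \<kappa> (- l) -` W)"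
  have "open U"
    unfolding U_def using cont_\<kappa>' assms
    by (auto intro!: open_UN continuous_open_vimage simp: continuous_on_eq_continuous_at)
  then have "compact (- U)" using compact_Int_closed[OF compact_cover, of "- U"] by auto
  then have "closed (\<psi> ` (- U))"
    using compact_imp_closed compact_continuous_image continuous_on_subset[OF cont_\<psi>] by blast
  moreover have "\<psi> ` (- U) = - (\<psi> ` W)"
  proof (intro set_eqI iffI)
    fix x assume "x \<in> \<psi> ` (- U)"
    then obtain z where z: "x = \<psi> z" "z \<notin> U" by blast
    show "x \<in> - (\<psi> ` W)"
    proof
      assume "x \<in> \<psi> ` W"
      then obtain w where "w \<in> W" "\<psi> w = \<psi> z" using z by auto
      then obtain l where "l \<in> L" "z = \<kappa> l w" using \<psi>_eq_iff by blast
      then have "z \<in> U" using \<open>w \<in> W\<close> unfolding U_def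
        by (auto intro!: bexI[of _ l] simp: \<kappa>_0 simp flip: \<kappa>_add)
      then show False using z by blast
    qed
  next
    fix x assume x: "x \<in> - (\<psi> ` W)"
    obtain z where z: "\<psi> z = x" using surj_\<psi> by blast
    have "z \<notin> U"
    proof
      assume "z \<in> U"
      then obtain l where l: "l \<in> L" "\<kappa> (- l) z \<in> W" by (auto simp: U_def)
      have "z = \<kappa> l (\<kappa> (- l) z)" by (simp add: \<kappa>_0 flip: \<kappa>_add)
      then have "\<psi> (\<kappa> (- l) z) = \<psi> z" using \<psi>_eq_iff l(1) by blast
      then show False using x z l(2) by (metis ComplD imageI)
    qed
    then show "x \<in> \<psi> ` (- U)" using z by blast
  qed
  ultimately show ?thesis by (simp add: closed_open)
qed

lemma open_\<psi>\<kappa>_dist: "open {w. dist (\<psi> (\<kappa> k w)) a < e}"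
  by (intro open_Collect_less continuous_intros continuous_on_compose2[OF cont_\<psi> cont_\<kappa>']) auto

lemma fibre_coordinate:
  assumes "\<pi> a = \<pi> (\<psi> z)" obtains k where "a = \<psi> (\<kappa> k z)"
  using assms surj_\<psi>[of a] \<pi>\<psi>_eq_iff[of z] by metis

text \<open>
  Since the structure group commutes with the action, moving one point of a fibre to a nearby
  position can be done while moving finitely many other points of the fibre only slightly.
\<close>

lemma fibre_transport:
  assumes "finite A" "\<And>a. a \<in> A \<Longrightarrow> \<pi> a = \<pi> b" "e > 0"
  obtains d where "d > 0" "\<And>V. open V \<Longrightarrow> V \<noteq> {} \<Longrightarrow> V \<subseteq> ball b d \<Longrightarrow>
      \<exists>t. \<alpha> t b \<in> V \<and> (\<forall>a\<in>A. dist (\<alpha> t a) a < e)"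
proof -
  obtain z where z: "\<psi> z = b" using surj_\<psi> by blast
  have "\<forall>a\<in>A. \<exists>k. a = \<psi> (\<kappa> k z)" using assms(2) z fibre_coordinate by metis
  then obtain k where k: "\<And>a. a \<in> A \<Longrightarrow> a = \<psi> (\<kappa> (k a) z)" by metis
  define W where "W = (\<Inter>a\<in>A. {w. dist (\<psi> (\<kappa> (k a) w)) a < e})"
  have W: "open W" unfolding W_def by (intro open_INT assms(1) ballI open_\<psi>\<kappa>_dist)
  have "z \<in> W" using k assms(3) unfolding W_def by auto
  then have "b \<in> \<psi> ` W" using z by blast
  then obtain d where d: "d > 0" "ball b d \<subseteq> \<psi> ` W"
    using open_\<psi>[OF W] open_contains_ball by blast
  show thesis
  proof (rule that[OF d(1)])
    fix V assume V: "open V" "V \<noteq> {}" "V \<subseteq> ball b d"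
    have "open (\<psi> -` V \<inter> W)"
      using V(1) W cont_\<psi> by (auto intro!: continuous_open_vimage simp: continuous_on_eq_continuous_at)
    moreover have "\<psi> -` V \<inter> W \<noteq> {}" using V(2,3) d(2) by blast
    ultimately obtain t where t: "\<tau> t z \<in> \<psi> -` V \<inter> W" using act_cover_dense by blast
    have "\<alpha> t a = \<psi> (\<kappa> (k a) (\<tau> t z))" if "a \<in> A" for a
      by (subst k[OF that]) (simp add: \<kappa>_commute equivariant_\<psi>)
    then show "\<exists>t. \<alpha> t b \<in> V \<and> (\<forall>a\<in>A. dist (\<alpha> t a) a < e)"
      using t z by (intro exI[of _ t]) (auto simp: W_def simp flip: equivariant_\<psi>)
  qed
qed

text \<open>
  Commutativity of the acting group enters here: if \<open>V'\<close> and its translate by \<open>g\<close> both lie in a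
  translate of \<open>V\<close>, then whatever a group element does to \<open>V'\<close> it does to \<open>g V'\<close> up to \<open>g\<close>.
\<close>

lemma reach_insert:
  assumes A: "finite A" "\<And>a. a \<in> A \<Longrightarrow> \<pi> a = \<pi> b" "b \<in> A" "reach A" and bc: "RP b c"
  shows "reach (insert c A)"
  unfolding reach_def
proof (intro allI impI)
  fix V :: "'x set" and e :: real assume V: "open V" "V \<noteq> {}" "e > 0"
  then have e2: "e/2 > 0" by simp
  obtain d where d: "d > 0" "\<And>V. open V \<Longrightarrow> V \<noteq> {} \<Longrightarrow> V \<subseteq> ball b d \<Longrightarrow>
      \<exists>t. \<alpha> t b \<in> V \<and> (\<forall>a\<in>A. dist (\<alpha> t a) a < e/2)"
    using fibre_transport[OF A(1,2) e2] by metis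
  have dd: "min d (e/2) > 0" using d e2 by simp
  obtain g1 v1 v2 where v: "v1 \<in> V" "v2 \<in> V" "dist (\<alpha> g1 v1) b < min d (e/2)" "dist (\<alpha> g1 v2) c < min d (e/2)"
    using RPD[OF bc V(1,2) dd] by metis
  define V1 where "V1 = \<alpha> g1 ` V \<inter> ball b d"
  define V2 where "V2 = \<alpha> g1 ` V \<inter> ball c (e/2)"
  have V12: "open V1" "open V2" "\<alpha> g1 v1 \<in> V1" "\<alpha> g1 v2 \<in> V2"
    using v V(1) by (auto simp: V1_def V2_def dist_commute intro!: open_act_image)
  obtain t where t: "\<alpha> t b \<in> V1" "\<And>a. a \<in> A \<Longrightarrow> dist (\<alpha> t a) a < e/2"
  proof -
    have "V1 \<noteq> {}" "V1 \<subseteq> ball b d" using V12 by (auto simp: V1_def)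
    then show thesis using d(2)[OF V12(1)] that by blast
  qed
  obtain g where g: "\<alpha> g (\<alpha> t b) \<in> V2" using act_dense[OF V12(2)] V12(4) by blast
  \<comment> \<open>The point \<open>\<alpha> t b\<close> lies in this set, and both
    \<open>V'\<close> and its image under \<open>g\<close> lie in the translate of \<open>V\<close>
    by \<open>g1\<close>. Points for \<open>A\<close> will come from \<open>V'\<close> itself, the
    point for \<open>c\<close> from its image under \<open>g\<close>.\<close>
  define V' where "V' = V1 \<inter> \<alpha> g -` V2"
  have V': "open V'" "V' \<noteq> {}" using V12 g t by (auto simp: V'_def intro!: open_act_vimage)
  obtain r where r: "r > 0" "ball (\<alpha> g (\<alpha> t b)) r \<subseteq> V2" using V12(2) g open_contains_ball by blast
  obtain d1 where d1: "d1 > 0" "\<And>x y. dist x y < d1 \<Longrightarrow> dist (\<alpha> g x) (\<alpha> g y) < r"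
    using uniform_act[OF r(1)] by metis
  have m: "min d1 (e/2) > 0" using d1 e2 by simp
  \<comment> \<open>The target is \<open>A\<close> displaced by \<open>t\<close>: each of its points
    is within \<open>e/2\<close> of the original, while \<open>\<alpha> t b\<close> is now a point
    that \<open>g\<close> sends into \<open>V2\<close>, close to \<open>c\<close>.\<close>
  obtain g2 where g2: "\<And>a. a \<in> A \<Longrightarrow> \<exists>v\<in>V'. dist (\<alpha> g2 v) (\<alpha> t a) < min d1 (e/2)"
    using reachD[OF reach_act[OF A(4), of t] V' m] by (metis imageI)
  have "\<exists>v\<in>V. dist (\<alpha> (g2 + g1) v) a < e" if a: "a \<in> insert c A" for a
  proof (cases "a \<in> A")
    case True
    then obtain v' where v': "v' \<in> V'" "dist (\<alpha> g2 v') (\<alpha> t a) < e/2" using g2 by fastforce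
    then obtain v where "v \<in> V" "v' = \<alpha> g1 v" by (auto simp: V'_def V1_def)
    moreover have "dist (\<alpha> g2 v') a < e"
      using v'(2) t(2)[OF True] dist_triangle[of "\<alpha> g2 v'" a "\<alpha> t a"] by linarith
    ultimately show ?thesis by (auto simp: act(3))
  next
    case False
    then have [simp]: "a = c" using a by simp
    obtain v' where v': "v' \<in> V'" "dist (\<alpha> g2 v') (\<alpha> t b) < d1" using g2[OF A(3)] by auto
    then have "dist (\<alpha> g (\<alpha> g2 v')) (\<alpha> g (\<alpha> t b)) < r" using d1(2) by blast
    then have "\<alpha> g (\<alpha> g2 v') \<in> V2" using r(2) by (auto simp: dist_commute)
    then have "dist (\<alpha> g (\<alpha> g2 v')) c < e" using V(3) by (auto simp: V2_def dist_commute)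
    moreover obtain v where v: "v \<in> V" "\<alpha> g v' = \<alpha> g1 v" using v' by (auto simp: V'_def V2_def)
    moreover have "\<alpha> g (\<alpha> g2 v') = \<alpha> (g2 + g1) v"
    proof -
      have "\<alpha> g (\<alpha> g2 v') = \<alpha> g2 (\<alpha> g v')" by (simp add: add.commute flip: act(3))
      then show ?thesis by (simp add: v(2) act(3))
    qed
    ultimately show ?thesis by auto
  qed
  then show "\<exists>g. \<forall>a\<in>insert c A. \<exists>v\<in>V. dist (\<alpha> g v) a < e" by blast
qed

lemma reach_mono: "reach A \<Longrightarrow> B \<subseteq> A \<Longrightarrow> reach B"
  unfolding reach_def by (metis subsetD)

text \<open>An instance of \<open>reach_insert\<close> with the pair \<open>a\<close>,
  \<open>b\<close> as starting set. That pair must lie in one fibre, but \<open>c\<close> may be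
  anywhere; \<open>difference_limit\<close> relies on this freedom.\<close>

lemma RP_trans:
  assumes "RP a b" "RP b c" "\<pi> a = \<pi> b" shows "RP a c"
proof -
  have "reach (insert c {a, b})"
    by (rule reach_insert[of _ b]) (use assms in \<open>auto simp: RP_def\<close>)
  then show ?thesis unfolding RP_def by (rule reach_mono) auto
qed

text \<open>Points are added one at a time with \<open>x\<close> as the fixed base point, so
  proximality of each point to \<open>x\<close> yields a common group element for all.\<close>

lemma reach_finite_fibre:
  assumes "finite A" "\<And>a. a \<in> A \<Longrightarrow> \<pi> a = \<pi> x" "\<And>a. a \<in> A \<Longrightarrow> RP x a"
  shows "reach (insert x A)"
  using assms
proof (induction A)
  case empty
  then show ?case using RP_refl[of x] by (simp add: RP_def)
next
  case (insert a A)
  have "reach (insert a (insert x A))"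
    by (rule reach_insert[of _ x]) (use insert in auto)
  then show ?case by (simp add: insert_commute)
qed

text \<open>The pairs \<open>(\<psi> z, \<psi> (\<kappa> k z))\<close>, for fixed \<open>k\<close>, form a minimal set.\<close>

lemma RP_coordinate:
  assumes "RP (\<psi> z) (\<psi> (\<kappa> k z))" shows "RP (\<psi> z') (\<psi> (\<kappa> k z'))"
proof (rule RP_closed)
  fix e :: real assume e: "e > 0"
  define W where "W = {w. dist (\<psi> (\<kappa> 0 w)) (\<psi> z') < e} \<inter> {w. dist (\<psi> (\<kappa> k w)) (\<psi> (\<kappa> k z')) < e}"
  have "open W" unfolding W_def by (intro open_Int open_\<psi>\<kappa>_dist)
  moreover have "z' \<in> W" using e by (simp add: W_def \<kappa>_0)
  ultimately obtain g where "\<tau> g z \<in> W" using act_cover_dense[of W z] by blast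
  then have g: "dist (\<psi> (\<tau> g z)) (\<psi> z') < e" "dist (\<psi> (\<kappa> k (\<tau> g z))) (\<psi> (\<kappa> k z')) < e"
    by (simp_all add: W_def \<kappa>_0)
  have "RP (\<psi> (\<tau> g z)) (\<psi> (\<kappa> k (\<tau> g z)))"
    using RP_act[OF assms, of g] by (simp add: equivariant_\<psi> \<kappa>_commute)
  then show "\<exists>y y'. RP y y' \<and> dist y (\<psi> z') < e \<and> dist y' (\<psi> (\<kappa> k z')) < e" using g by blast
qed

lemma closed_RP: "closed {x'. RP x x'}"
proof -
  have "RP x x'" if cl: "x' \<in> closure {x'. RP x x'}" for x'
  proof (rule RP_closed)
    fix e :: real assume e: "e > 0"
    then obtain y where "RP x y" "dist y x' < e" using cl unfolding closure_approachable by blast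
    then show "\<exists>y y'. RP y y' \<and> dist y x < e \<and> dist y' x' < e" using e by (metis dist_self)
  qed
  then show ?thesis by (auto simp flip: closure_subset_eq)
qed

text \<open>By minimality a single open set \<open>W\<close> is carried into each \<open>V i\<close>
  by some \<open>h i\<close>. It is enough to spread \<open>W\<close> over a net of the fibre of
  \<open>x0\<close>: by commutativity the same \<open>g\<close> then spreads each \<open>V i\<close>
  over the fibre moved by \<open>h i\<close>.\<close>

lemma spread_over_fibres:
  assumes RP: "\<And>x. \<pi> x = \<pi> x0 \<Longrightarrow> RP x0 x" and I: "finite I"
    and V: "\<And>i. i \<in> I \<Longrightarrow> open (V i)" "\<And>i. i \<in> I \<Longrightarrow> V i \<noteq> {}" and e: "e > 0"
  obtains g y where "\<And>i x. i \<in> I \<Longrightarrow> \<pi> x = y i \<Longrightarrow> \<exists>v\<in>V i. dist (\<alpha> g v) x < e"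
proof -
  have "\<exists>W h. open W \<and> W \<noteq> {} \<and> (\<forall>i\<in>I. \<alpha> (h i) ` W \<subseteq> V i)"
    using I V
  proof (induction I)
    case empty
    show ?case by (intro exI[of _ UNIV]) auto
  next
    case (insert i I)
    then have "\<exists>W h. open W \<and> W \<noteq> {} \<and> (\<forall>j\<in>I. \<alpha> (h j) ` W \<subseteq> V j)" by simp
    then obtain W h where W: "open W" "W \<noteq> {}" "\<And>j. j \<in> I \<Longrightarrow> \<alpha> (h j) ` W \<subseteq> V j" by metis
    then obtain w where "w \<in> W" by blast
    obtain g where g: "\<alpha> g w \<in> V i" using act_dense[of "V i" w] insert.prems by auto
    have "open (W \<inter> \<alpha> g -` V i)" using W insert.prems by (auto intro!: open_act_vimage)
    moreover have "W \<inter> \<alpha> g -` V i \<noteq> {}" using g \<open>w \<in> W\<close> by auto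
    moreover have "\<forall>j\<in>insert i I. \<alpha> ((h(i := g)) j) ` (W \<inter> \<alpha> g -` V i) \<subseteq> V j"
      using W(3) insert.hyps(2) by fastforce
    ultimately show ?case by blast
  qed
  then obtain W h where W: "open W" "W \<noteq> {}" "\<And>i. i \<in> I \<Longrightarrow> \<alpha> (h i) ` W \<subseteq> V i" by blast
  have "\<exists>d>0. \<forall>x y. dist x y < d \<longrightarrow> dist (\<alpha> (h i) x) (\<alpha> (h i) y) < e" for i
    using uniform_act[OF e] by metis
  then obtain d where d: "\<And>i. d i > 0" "\<And>i x y. dist x y < d i \<Longrightarrow> dist (\<alpha> (h i) x) (\<alpha> (h i) y) < e"
    by metis
  define d' where "d' = Min (insert 1 (d ` I))"
  have d': "d' > 0" "\<And>i. i \<in> I \<Longrightarrow> d' \<le> d i" using I d by (auto simp: d'_def)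
  then have "d'/2 > 0" by simp
  then obtain D where D: "finite D" "D \<subseteq> {x. \<pi> x = \<pi> x0}" "\<And>x. x \<in> {x. \<pi> x = \<pi> x0} \<Longrightarrow> \<exists>y\<in>D. dist x y < d'/2"
    by (rule finite_net[where S="{x. \<pi> x = \<pi> x0}"]) blast
  have "reach (insert x0 D)" by (rule reach_finite_fibre) (use D RP in auto)
  then obtain g where g: "\<And>a. a \<in> insert x0 D \<Longrightarrow> \<exists>v\<in>W. dist (\<alpha> g v) a < d'/2"
    using reachD[OF _ W(1,2) \<open>d'/2 > 0\<close>] by metis
  show thesis
  proof (rule that[of "\<lambda>i. \<beta> (h i) (\<pi> x0)" g])
    fix i x assume i: "i \<in> I" and x: "\<pi> x = \<beta> (h i) (\<pi> x0)"
    have "\<pi> (\<alpha> (- h i) x) = \<pi> x0" by (simp add: equivariant_\<pi> x act_base)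
    then obtain y where y: "y \<in> D" "dist (\<alpha> (- h i) x) y < d'/2" using D(3) by blast
    then obtain w where w: "w \<in> W" "dist (\<alpha> g w) y < d'/2" using g by blast
    have "dist (\<alpha> g w) (\<alpha> (- h i) x) < d'" using y(2) w(2) dist_triangle_half_l by blast
    then have "dist (\<alpha> (h i) (\<alpha> g w)) (\<alpha> (h i) (\<alpha> (- h i) x)) < e" using d(2) d'(2)[OF i] by force
    moreover have "\<alpha> (h i) (\<alpha> g w) = \<alpha> g (\<alpha> (h i) w)" by (simp add: add.commute flip: act(3))
    ultimately have "dist (\<alpha> g (\<alpha> (h i) w)) x < e" by (simp add: act)
    then show "\<exists>v\<in>V i. dist (\<alpha> g v) x < e" using W(3)[OF i] w(1) by blast
  qed
qed

end

section \<open>Equicontinuity in metric terms\<close>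

lemma tendsto_dist_zero:
  assumes "x \<longlonglongrightarrow> l" "(\<lambda>n. dist (x n) (y n)) \<longlonglongrightarrow> 0"
  shows "y \<longlonglongrightarrow> (l :: 'a::metric_space)"
proof (rule metric_tendsto_imp_tendsto[of "\<lambda>n. dist (x n) l + dist (x n) (y n)" 0])
  show "(\<lambda>n. dist (x n) l + dist (x n) (y n)) \<longlonglongrightarrow> 0"
    using tendsto_add[OF tendsto_dist[OF assms(1) tendsto_const[of l]] assms(2)] by simp
  have "dist (y n) l \<le> dist (x n) l + dist (x n) (y n)" for n
    using dist_triangle[of "y n" l "x n"] by (simp add: dist_commute)
  then show "\<forall>\<^sub>F n in sequentially. dist (y n) l \<le> dist (dist (x n) l + dist (x n) (y n)) 0"
    by (simp add: dist_real_def)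
qed

lemma diagonal_nbhd_uniform:
  assumes "diagonal_nbhd (euclidean :: 'a::compact_metric_space topology) \<delta>"
  obtains d where "d > 0" "\<And>x y. dist x y < d \<Longrightarrow> (x, y) \<in> \<delta>"
proof -
  obtain U :: "('a \<times> 'a) set" where U: "open U" "Id \<subseteq> U" "U \<subseteq> \<delta>"
    using assms by (auto simp: diagonal_nbhd_def Id_on_def Id_def image_subset_iff)
  have "\<exists>e>0. \<forall>x y. dist x y < e \<longrightarrow> (x, y) \<in> U"
  proof (rule ccontr)
    assume "\<not> ?thesis"
    then have "\<exists>x y. dist x y < 1 / Suc n \<and> (x, y) \<notin> U" for n
      by (metis of_nat_0_less_iff zero_less_Suc zero_less_divide_1_iff)
    then obtain x y where xy: "\<And>n. dist (x n) (y n) < 1 / Suc n" "\<And>n. (x n, y n) \<notin> U" by metis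
    obtain r l where r: "strict_mono (r :: nat \<Rightarrow> nat)" "(\<lambda>n. x (r n)) \<longlonglongrightarrow> l"
      by (rule compact_space_subseq)
    have "(\<lambda>n. dist (x n) (y n)) \<longlonglongrightarrow> 0"
    proof (rule tendsto_sandwich[OF _ _ tendsto_const lim_inverse_n'[THEN LIMSEQ_Suc]])
      show "\<forall>\<^sub>F n in sequentially. dist (x n) (y n) \<le> 1 / real (Suc n)"
        by (intro always_eventually allI less_imp_le xy(1))
    qed simp
    then have "(\<lambda>n. dist (x (r n)) (y (r n))) \<longlonglongrightarrow> 0"
      using LIMSEQ_subseq_LIMSEQ[OF _ r(1)] by (auto simp: o_def)
    then have "(\<lambda>n. y (r n)) \<longlonglongrightarrow> l" by (rule tendsto_dist_zero[OF r(2)])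
    then have "(\<lambda>n. (x (r n), y (r n))) \<longlonglongrightarrow> (l, l)" using r(2) by (intro tendsto_Pair)
    moreover have "closed (- U)" "\<And>n. (x (r n), y (r n)) \<in> - U" using U(1) xy(2) by auto
    ultimately have "(l, l) \<in> - U" by (meson closed_sequentially)
    then show False using U(2) by auto
  qed
  then show thesis using that U(3) by blast
qed

lemma equicontinuous_system_uniform:
  fixes \<gamma> :: "'g \<Rightarrow> 'a::compact_metric_space \<Rightarrow> 'a"
  assumes "equicontinuous_system euclidean \<gamma>" "e > 0"
  obtains d where "d > 0" "\<And>g x y. dist x y < d \<Longrightarrow> dist (\<gamma> g x) (\<gamma> g y) < e"
proof -
  define \<epsilon> where "\<epsilon> = {p :: 'a \<times> 'a. dist (fst p) (snd p) < e}"
  have "open \<epsilon>" unfolding \<epsilon>_def by (intro open_Collect_less continuous_intros)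
  then have "diagonal_nbhd euclidean \<epsilon>"
    using assms(2) by (auto simp: diagonal_nbhd_def \<epsilon>_def)
  then obtain \<delta> where \<delta>: "diagonal_nbhd euclidean \<delta>" "\<And>g. map_prod (\<gamma> g) (\<gamma> g) ` \<delta> \<subseteq> \<epsilon>"
    using assms(1) unfolding equicontinuous_system_def by blast
  obtain d where d: "d > 0" "\<And>x y. dist x y < d \<Longrightarrow> (x, y) \<in> \<delta>"
    by (rule diagonal_nbhd_uniform[OF \<delta>(1)]) blast
  show thesis
  proof (rule that[OF d(1)])
    fix g and x y :: 'a assume "dist x y < d"
    then have "map_prod (\<gamma> g) (\<gamma> g) (x, y) \<in> \<epsilon>" using d(2) \<delta>(2) by blast
    then show "dist (\<gamma> g x) (\<gamma> g y) < e" by (simp add: \<epsilon>_def)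
  qed
qed

lemma not_tendsto_zero_subseq:
  fixes f :: "nat \<Rightarrow> real"
  assumes "\<not> f \<longlonglongrightarrow> 0" "\<And>n. f n \<ge> 0"
  obtains e r where "e > 0" "strict_mono (r :: nat \<Rightarrow> nat)" "\<And>n. f (r n) \<ge> e"
proof -
  obtain e where e: "e > 0" "\<And>N. \<exists>n\<ge>N. \<not> f n < e"
    using assms by (auto simp: LIMSEQ_iff)
  then have "infinite {n. f n \<ge> e}"
    by (metis (mono_tags, lifting) infinite_nat_iff_unbounded_le leI mem_Collect_eq)
  then have "strict_mono (enumerate {n. f n \<ge> e})" "\<And>n. f (enumerate {n. f n \<ge> e} n) \<ge> e"
    using enumerate_in_set strict_mono_enumerate by fast+
  then show thesis using that e(1) by blast
qed

section \<open>Regional proximality at a point over a singleton fibre, and null sequences in the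
  group\<close>

locale automorphic_point = homogeneous_extension \<alpha> \<beta> \<pi> \<tau> \<kappa> L \<psi>
  for \<alpha> :: "'g::ab_group_add \<Rightarrow> 'x::compact_metric_space \<Rightarrow> 'x"
    and \<beta> :: "'g \<Rightarrow> 's::compact_metric_space \<Rightarrow> 's"
    and \<pi> :: "'x \<Rightarrow> 's"
    and \<tau> :: "'g \<Rightarrow> 't::t2_space \<Rightarrow> 't"
    and \<kappa> :: "'k::{topological_group_add,t2_space} \<Rightarrow> 't \<Rightarrow> 't"
    and L :: "'k set" and \<psi> :: "'t \<Rightarrow> 'x" +
  fixes \<gamma> :: "'g \<Rightarrow> 'y::compact_metric_space \<Rightarrow> 'y" and \<phi> and x0
  assumes maximal: "maximal_equicontinuous_factor euclidean \<alpha> euclidean \<gamma> \<phi>"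
    and fibre_x0: "\<phi> x = \<phi> x0 \<longleftrightarrow> \<pi> x = \<pi> x0"
begin

lemma cont_\<phi>: "continuous_on UNIV \<phi>"
  and equivariant_\<phi>: "\<phi> (\<alpha> g x) = \<gamma> g (\<phi> x)"
  and equicontinuous_factor: "equicontinuous_system euclidean \<gamma>"
  using maximal by (auto simp: maximal_equicontinuous_factor_def extension_def)

text \<open>Two points of a small ball around \<open>x\<close> have close images in the
  equicontinuous factor, and these remain close under every group element.\<close>

lemma RP_imp_\<phi>_eq:
  assumes "RP x x'" shows "\<phi> x = \<phi> x'"
proof -
  have "dist (\<phi> x) (\<phi> x') \<le> 0"
  proof (rule field_le_epsilon)
    fix e :: real assume "e > 0"
    then have e: "e/3 > 0" by simp
    obtain d1 where d1: "d1 > 0" "\<And>g x y. dist x y < d1 \<Longrightarrow> dist (\<gamma> g x) (\<gamma> g y) < e/3"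
      by (rule equicontinuous_system_uniform[OF equicontinuous_factor e]) blast
    obtain d2 where d2: "d2 > 0" "\<And>x y. dist x y < d2 \<Longrightarrow> dist (\<phi> x) (\<phi> y) < d1"
      by (rule continuous_imp_uniformly_continuous_space[OF cont_\<phi> d1(1)]) blast
    obtain d3 where d3: "d3 > 0" "\<And>x y. dist x y < d3 \<Longrightarrow> dist (\<phi> x) (\<phi> y) < e/3"
      by (rule continuous_imp_uniformly_continuous_space[OF cont_\<phi> e]) blast
    have "ball x (d2/2) \<noteq> {}" using d2(1) by simp
    then obtain g v v' where v: "v \<in> ball x (d2/2)" "v' \<in> ball x (d2/2)"
      "dist (\<alpha> g v) x < d3" "dist (\<alpha> g v') x' < d3"
      using RPD[OF assms open_ball _ d3(1)] by metis
    have "dist v v' < d2" using v(1,2) by (auto intro: dist_triangle_half_r)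
    then have "dist (\<phi> (\<alpha> g v)) (\<phi> (\<alpha> g v')) < e/3"
      unfolding equivariant_\<phi> by (intro d1(2) d2(2))
    moreover have "dist (\<phi> (\<alpha> g v)) (\<phi> x) < e/3" "dist (\<phi> (\<alpha> g v')) (\<phi> x') < e/3"
      using v(3,4) d3(2) by blast+
    ultimately show "dist (\<phi> x) (\<phi> x') \<le> 0 + e"
      using dist_triangle[of "\<phi> x" "\<phi> x'" "\<phi> (\<alpha> g v)"] dist_triangle[of "\<phi> (\<alpha> g v)" "\<phi> x'" "\<phi> (\<alpha> g v')"]
      by (simp add: dist_commute)
  qed
  then show ?thesis by simp
qed

definition B where "B = {x. RP x0 x}"

text \<open>This is where the singleton \<open>\<theta>\<close>-fibre enters: by
  \<open>fibre_x0\<close> the \<open>\<phi>\<close>-fibre of \<open>x0\<close> is just its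
  \<open>\<pi>\<close>-fibre. All uses of \<open>RP_trans\<close> at \<open>x0\<close> depend on
  it.\<close>

lemma B_fibre: "x \<in> B \<Longrightarrow> \<pi> x = \<pi> x0"
  using RP_imp_\<phi>_eq[of x0 x] fibre_x0[of x] by (simp add: B_def)

lemma x0_B: "x0 \<in> B" by (simp add: B_def RP_refl)

lemma closed_B: "closed B" unfolding B_def by (rule closed_RP)

text \<open>
  Null sequences are those converging to \<open>0\<close> in the group topology for which the translates of
  \<open>x0\<close> near \<open>B\<close> are the neighbourhoods of \<open>0\<close>.
\<close>

definition null where
  "null g \<longleftrightarrow> (\<lambda>n. infdist (\<alpha> (g n) x0) B) \<longlonglongrightarrow> 0"

lemma null_limit:
  assumes "null g" "(\<lambda>n. \<alpha> (g n) x0) \<longlonglongrightarrow> w" shows "w \<in> B"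
proof -
  have "(\<lambda>n. infdist (\<alpha> (g n) x0) B) \<longlonglongrightarrow> infdist w B" by (intro tendsto_infdist assms)
  then have "infdist w B = 0" using assms(1) LIMSEQ_unique unfolding null_def by blast
  then show ?thesis using in_closed_iff_infdist_zero[OF closed_B] x0_B by blast
qed

text \<open>By compactness, a sequence of orbit points staying away from \<open>B\<close> would have
  a subsequential limit outside \<open>B\<close>.\<close>

lemma null_I:
  assumes "\<And>r w. strict_mono r \<Longrightarrow> (\<lambda>n. \<alpha> (g (r n)) x0) \<longlonglongrightarrow> w \<Longrightarrow> w \<in> B"
  shows "null g"
  unfolding null_def
proof (rule ccontr)
  assume "\<not> (\<lambda>n. infdist (\<alpha> (g n) x0) B) \<longlonglongrightarrow> 0"
  then obtain e r where e: "e > 0" and r: "strict_mono (r :: nat \<Rightarrow> nat)"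
    "\<And>n. infdist (\<alpha> (g (r n)) x0) B \<ge> e"
    by (rule not_tendsto_zero_subseq) (auto simp: infdist_nonneg)
  obtain s w where s: "strict_mono (s :: nat \<Rightarrow> nat)" "(\<lambda>n. \<alpha> (g (r (s n))) x0) \<longlonglongrightarrow> w"
    by (rule compact_space_subseq[of "\<lambda>n. \<alpha> (g (r n)) x0"])
  have "w \<in> B" using assms[OF strict_mono_o[OF r(1) s(1)]] s(2) by (simp add: o_def)
  moreover have "e \<le> infdist w B"
    by (rule LIMSEQ_le_const[OF tendsto_infdist[OF s(2)]]) (use r(2) in blast)
  ultimately show False using e by simp
qed

lemma null_subseq: "null g \<Longrightarrow> strict_mono r \<Longrightarrow> null (\<lambda>n. g (r n))"
  unfolding null_def using LIMSEQ_subseq_LIMSEQ by (fastforce simp: o_def)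

text \<open>The aim is a point \<open>l\<close> of the fibre of \<open>x0\<close> with
  \<open>x0\<close>, \<open>l\<close> and \<open>l\<close>, \<open>w\<close> regionally proximal;
  transitivity along that fibre then gives the claim. Write \<open>b\<close> and \<open>b'\<close>
  in coordinates as differing by \<open>k\<close> in the structure group. Displacing
  \<open>x0\<close> by the same \<open>k\<close> gives points \<open>f\<close> proximal to
  \<open>x0\<close> that \<open>h\<close> carries close to \<open>b\<close>, and \<open>l\<close> is
  a limit of these. Since \<open>h\<close> also carries \<open>\<alpha> (g n - h n) x0\<close> close
  to \<open>b\<close>, \<open>l\<close> and \<open>w\<close> are proximal.\<close>

lemma difference_limit:
  assumes g: "(\<lambda>n. \<alpha> (g n) x0) \<longlonglongrightarrow> b" and h: "(\<lambda>n. \<alpha> (h n) x0) \<longlonglongrightarrow> b'"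
    and w: "(\<lambda>n. \<alpha> (g n - h n) x0) \<longlonglongrightarrow> w" and b: "b \<in> B" "b' \<in> B"
  shows "w \<in> B"
proof -
  have RPb: "RP b' b"
    using RP_trans[of b' x0 b] b B_fibre[OF b(2)] RP_sym by (simp add: B_def)
  obtain z' where z': "\<psi> z' = b'" using surj_\<psi> by blast
  obtain k where k: "b = \<psi> (\<kappa> k z')"
    using fibre_coordinate[of b z'] z' B_fibre b by metis
  have "\<exists>n f. n \<ge> m \<and> RP x0 f \<and> \<pi> f = \<pi> x0 \<and> dist (\<alpha> (h n) f) b < 1 / real (Suc m)" for m
  proof -
    define W where "W = {w. dist (\<psi> (\<kappa> k w)) b < 1 / real (Suc m)}"
    have "open (\<psi> ` W)" unfolding W_def by (intro open_\<psi> open_\<psi>\<kappa>_dist)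
    moreover have "z' \<in> W" by (simp add: W_def k)
    ultimately have "\<forall>\<^sub>F n in sequentially. \<alpha> (h n) x0 \<in> \<psi> ` W"
      using h z' by (auto intro: topological_tendstoD)
    then obtain n where n: "n \<ge> m" "\<alpha> (h n) x0 \<in> \<psi> ` W"
      unfolding eventually_sequentially by (meson le_cases)
    then obtain z where z: "z \<in> W" "\<psi> z = \<alpha> (h n) x0" by auto
    \<comment> \<open>The displacement by \<open>k\<close> is done in the cover and pulled back by
      \<open>h n\<close>, which is possible because \<open>\<kappa>\<close> and
      \<open>\<tau>\<close> commute; \<open>\<tau> (- h n) z\<close> is a lift of
      \<open>x0\<close>.\<close>
    define f where "f = \<psi> (\<kappa> k (\<tau> (- h n) z))"
    have x0: "\<psi> (\<tau> (- h n) z) = x0" by (simp add: equivariant_\<psi> z act)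
    have "RP x0 f"
      using RP_coordinate[of z' k "\<tau> (- h n) z"] RPb z' k x0 by (simp add: f_def)
    moreover have "\<pi> f = \<pi> x0" using \<pi>\<psi>_eq_iff[of "\<tau> (- h n) z"] x0 unfolding f_def by metis
    moreover have "dist (\<alpha> (h n) f) b < 1 / real (Suc m)"
    proof -
      have "\<alpha> (h n) f = \<psi> (\<kappa> k z)"
        by (simp add: f_def act_cover flip: equivariant_\<psi> \<kappa>_commute)
      then show ?thesis using z(1) unfolding W_def by simp
    qed
    ultimately show ?thesis using n(1) by blast
  qed
  then obtain n f where n: "\<And>m. n m \<ge> m" and f: "\<And>m. RP x0 (f m)" "\<And>m. \<pi> (f m) = \<pi> x0"
    "\<And>m. dist (\<alpha> (h (n m)) (f m)) b < 1 / real (Suc m)" by metis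
  obtain r l where r: "strict_mono (r :: nat \<Rightarrow> nat)" "(\<lambda>m. f (r m)) \<longlonglongrightarrow> l"
    by (rule compact_space_subseq)
  \<comment> \<open>The indices \<open>n m\<close> need not increase, but \<open>n m \<ge> m\<close>
    makes them tend to infinity, which is enough to carry over the limits.\<close>
  have t: "filterlim (\<lambda>m. n (r m)) sequentially sequentially"
  proof (rule filterlim_at_top_mono[OF filterlim_ident])
    show "\<forall>\<^sub>F m in sequentially. m \<le> n (r m)"
      using n seq_suble[OF r(1)] order_trans by (intro always_eventually) blast
  qed
  have "RP x0 l"
    using closed_sequentially[OF closed_B _ r(2)] f(1) by (simp add: B_def)
  have "\<pi> x0 = \<pi> l"
  proof (rule LIMSEQ_unique)
    show "(\<lambda>m. \<pi> (f (r m))) \<longlonglongrightarrow> \<pi> l"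
      by (rule continuous_on_tendsto_compose[OF cont_\<pi> r(2)]) auto
  qed (simp add: f(2))
  have "RP l w"
  proof (rule RP_I)
    fix e :: real assume e: "e > 0"
    have "(\<lambda>m. dist (\<alpha> (h (n (r m))) (f (r m))) b) \<longlonglongrightarrow> 0"
    proof (rule tendsto_sandwich[OF _ _ tendsto_const LIMSEQ_subseq_LIMSEQ[OF lim_inverse_n'[THEN LIMSEQ_Suc] r(1), unfolded o_def]])
      show "\<forall>\<^sub>F m in sequentially. dist (\<alpha> (h (n (r m))) (f (r m))) b \<le> 1 / real (Suc (r m))"
        by (intro always_eventually allI less_imp_le f(3))
    qed simp
    then have "\<forall>\<^sub>F m in sequentially. dist (\<alpha> (h (n (r m))) (f (r m))) b < e/2"
      using e by (intro order_tendstoD) auto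
    moreover have "\<forall>\<^sub>F m in sequentially. dist (f (r m)) l < e" using r(2) e by (rule tendstoD)
    moreover have "\<forall>\<^sub>F m in sequentially. dist (\<alpha> (g (n (r m)) - h (n (r m))) x0) w < e"
      using filterlim_compose[OF w t] e by (rule tendstoD)
    moreover have "\<forall>\<^sub>F m in sequentially. dist (\<alpha> (g (n (r m))) x0) b < e/2"
      using filterlim_compose[OF g t] by (rule tendstoD) (use e in simp)
    ultimately have "\<forall>\<^sub>F m in sequentially. dist (\<alpha> (h (n (r m))) (f (r m))) b < e/2 \<and> dist (f (r m)) l < e \<and>
       dist (\<alpha> (g (n (r m)) - h (n (r m))) x0) w < e \<and> dist (\<alpha> (g (n (r m))) x0) b < e/2"
      by eventually_elim simp
    then obtain m where m: "dist (\<alpha> (h (n (r m))) (f (r m))) b < e/2" "dist (f (r m)) l < e"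
       "dist (\<alpha> (g (n (r m)) - h (n (r m))) x0) w < e" "dist (\<alpha> (g (n (r m))) x0) b < e/2"
      by (auto simp: eventually_sequentially)
    have "\<alpha> (h (n (r m))) (\<alpha> (g (n (r m)) - h (n (r m))) x0) = \<alpha> (g (n (r m))) x0"
      by (simp flip: act(3))
    then have "dist (\<alpha> (h (n (r m))) (f (r m))) (\<alpha> (h (n (r m))) (\<alpha> (g (n (r m)) - h (n (r m))) x0)) < e"
      using m(1,4) dist_triangle_half_l by simp
    then show "\<exists>u u' g. dist u l < e \<and> dist u' w < e \<and> dist (\<alpha> g u) (\<alpha> g u') < e" using m(2,3) by blast
  qed
  then show ?thesis using RP_trans[OF \<open>RP x0 l\<close>] \<open>\<pi> x0 = \<pi> l\<close> by (simp add: B_def)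
qed

text \<open>The group axiom for the topology at 0: every limit of differences reduces, along
  subsequences, to limits in \<open>B\<close> and hence to \<open>difference_limit\<close>.\<close>

lemma null_diff:
  assumes "null g" "null h" shows "null (\<lambda>n. g n - h n)"
proof (rule null_I)
  fix r w assume r: "strict_mono (r :: nat \<Rightarrow> nat)" "(\<lambda>n. \<alpha> (g (r n) - h (r n)) x0) \<longlonglongrightarrow> w"
  obtain s b where s: "strict_mono (s :: nat \<Rightarrow> nat)" "(\<lambda>n. \<alpha> (g (r (s n))) x0) \<longlonglongrightarrow> b"
    by (rule compact_space_subseq[of "\<lambda>n. \<alpha> (g (r n)) x0"])
  obtain t b' where t: "strict_mono (t :: nat \<Rightarrow> nat)" "(\<lambda>n. \<alpha> (h (r (s (t n)))) x0) \<longlonglongrightarrow> b'"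
    by (rule compact_space_subseq[of "\<lambda>n. \<alpha> (h (r (s n))) x0"])
  have mono: "strict_mono (\<lambda>n. r (s (t n)))" "strict_mono (\<lambda>n. s (t n))"
    using r(1) s(1) t(1) by (auto simp: strict_mono_def)
  have g: "(\<lambda>n. \<alpha> (g (r (s (t n)))) x0) \<longlonglongrightarrow> b"
    using LIMSEQ_subseq_LIMSEQ[OF s(2) t(1)] by (simp add: o_def)
  have w: "(\<lambda>n. \<alpha> (g (r (s (t n))) - h (r (s (t n)))) x0) \<longlonglongrightarrow> w"
    using LIMSEQ_subseq_LIMSEQ[OF r(2) mono(2)] by (simp add: o_def)
  show "w \<in> B"
    by (rule difference_limit[OF g t(2) w null_limit[OF null_subseq[OF assms(1) mono(1)] g]
          null_limit[OF null_subseq[OF assms(2) mono(1)] t(2)]])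
qed

lemma null_0: "null (\<lambda>n. 0)"
  by (simp add: null_def act x0_B)

lemma null_minus: "null g \<Longrightarrow> null (\<lambda>n. - g n)"
  using null_diff[OF null_0] by simp

lemma null_add: "null g \<Longrightarrow> null h \<Longrightarrow> null (\<lambda>n. g n + h n)"
  using null_diff[of g "\<lambda>n. - h n"] null_minus by simp

text \<open>The element \<open>h n\<close> brings \<open>x0\<close> and
  \<open>\<alpha> (g n - h n) x0\<close> together near \<open>x\<close>, so any limit of the latter
  points is regionally proximal to \<open>x0\<close>.\<close>

lemma null_diff_same_limit:
  assumes "(\<lambda>n. \<alpha> (g n) x0) \<longlonglongrightarrow> x" "(\<lambda>n. \<alpha> (h n) x0) \<longlonglongrightarrow> x"
  shows "null (\<lambda>n. g n - h n)"
proof (rule null_I)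
  fix r w assume r: "strict_mono (r :: nat \<Rightarrow> nat)" "(\<lambda>n. \<alpha> (g (r n) - h (r n)) x0) \<longlonglongrightarrow> w"
  have "RP x0 w"
  proof (rule RP_I)
    fix e :: real assume e: "e > 0"
    have "\<forall>\<^sub>F n in sequentially. dist (\<alpha> (g (r n)) x0) x < e/2"
      by (rule tendstoD[OF LIMSEQ_subseq_LIMSEQ[OF assms(1) r(1), unfolded o_def]]) (use e in simp)
    moreover have "\<forall>\<^sub>F n in sequentially. dist (\<alpha> (h (r n)) x0) x < e/2"
      by (rule tendstoD[OF LIMSEQ_subseq_LIMSEQ[OF assms(2) r(1), unfolded o_def]]) (use e in simp)
    moreover have "\<forall>\<^sub>F n in sequentially. dist (\<alpha> (g (r n) - h (r n)) x0) w < e"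
      using r(2) e by (rule tendstoD)
    ultimately have "\<forall>\<^sub>F n in sequentially. dist (\<alpha> (g (r n)) x0) x < e/2 \<and>
        dist (\<alpha> (h (r n)) x0) x < e/2 \<and> dist (\<alpha> (g (r n) - h (r n)) x0) w < e"
      by eventually_elim simp
    then obtain n where n: "dist (\<alpha> (g (r n)) x0) x < e/2" "dist (\<alpha> (h (r n)) x0) x < e/2"
        "dist (\<alpha> (g (r n) - h (r n)) x0) w < e" by (auto simp: eventually_sequentially)
    have "\<alpha> (h (r n)) (\<alpha> (g (r n) - h (r n)) x0) = \<alpha> (g (r n)) x0" by (simp flip: act(3))
    then have "dist (\<alpha> (h (r n)) x0) (\<alpha> (h (r n)) (\<alpha> (g (r n) - h (r n)) x0)) < e"
      using n(1,2) dist_triangle_half_l by simp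
    then show "\<exists>u u' g. dist u x0 < e \<and> dist u' w < e \<and> dist (\<alpha> g u) (\<alpha> g u') < e"
      using n(3) e by (metis dist_self)
  qed
  then show "w \<in> B" by (simp add: B_def)
qed

section \<open>The equivalence relation induced on X by null differences\<close>

lemma orbit_approximation:
  assumes "\<And>n. open (W n)" "\<And>n. x n \<in> W n"
  obtains g where "\<And>n. \<alpha> (g n) x0 \<in> W n" "(\<lambda>n. dist (x n) (\<alpha> (g n) x0)) \<longlonglongrightarrow> 0"
proof -
  have "\<exists>g. \<alpha> g x0 \<in> W n \<inter> ball (x n) (1 / real (Suc n))" for n
    by (rule act_dense) (use assms[of n] in \<open>auto intro!: exI[of _ "x n"]\<close>)
  then obtain g where g: "\<And>n. \<alpha> (g n) x0 \<in> W n" "\<And>n. dist (x n) (\<alpha> (g n) x0) < 1 / real (Suc n)"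
    by (metis IntD1 IntD2 mem_ball)
  have "(\<lambda>n. dist (x n) (\<alpha> (g n) x0)) \<longlonglongrightarrow> 0"
  proof (rule tendsto_sandwich[OF _ _ tendsto_const lim_inverse_n'[THEN LIMSEQ_Suc]])
    show "\<forall>\<^sub>F n in sequentially. dist (x n) (\<alpha> (g n) x0) \<le> 1 / real (Suc n)"
      by (intro always_eventually allI less_imp_le g(2))
  qed simp
  then show thesis using that g(1) by blast
qed

lemma orbit_approximation_point:
  obtains g where "(\<lambda>n. \<alpha> (g n) x0) \<longlonglongrightarrow> x"
  by (rule orbit_approximation[of "\<lambda>_. UNIV" "\<lambda>_. x"]) (auto dest: tendsto_dist_zero[OF tendsto_const])

text \<open>Two points are identified when they are approached along sequences of group elements
  equivalent in the sense of Cauchy completion. By \<open>E_null\<close> the choice of these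
  sequences is immaterial.\<close>

definition E where
  "E x x' \<longleftrightarrow> (\<exists>g h. (\<lambda>n. \<alpha> (g n) x0) \<longlonglongrightarrow> x \<and> (\<lambda>n. \<alpha> (h n) x0) \<longlonglongrightarrow> x' \<and> null (\<lambda>n. g n - h n))"

text \<open>Sequences approaching the same point differ by a null sequence, so
  \<open>g n - h n\<close> is a sum of three null differences.\<close>

lemma E_null:
  assumes "E x x'" "(\<lambda>n. \<alpha> (g n) x0) \<longlonglongrightarrow> x" "(\<lambda>n. \<alpha> (h n) x0) \<longlonglongrightarrow> x'"
  shows "null (\<lambda>n. g n - h n)"
proof -
  obtain g' h' where *: "(\<lambda>n. \<alpha> (g' n) x0) \<longlonglongrightarrow> x" "(\<lambda>n. \<alpha> (h' n) x0) \<longlonglongrightarrow> x'"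
    and n: "null (\<lambda>n. g' n - h' n)" using assms(1) unfolding E_def by blast
  have "null (\<lambda>n. (g n - g' n) + ((g' n - h' n) + (h' n - h n)))"
    by (intro null_add n null_diff_same_limit[OF assms(2) *(1)] null_diff_same_limit[OF *(2) assms(3)])
  then show ?thesis by simp
qed

lemma E_refl: "E x x"
proof -
  obtain g where "(\<lambda>n. \<alpha> (g n) x0) \<longlonglongrightarrow> x" by (rule orbit_approximation_point)
  then show ?thesis unfolding E_def using null_0 by (intro exI[of _ g]) simp
qed

lemma E_sym: "E x x' \<Longrightarrow> E x' x"
  unfolding E_def using null_minus by fastforce

lemma E_trans:
  assumes "E x x'" "E x' x''" shows "E x x''"
proof -
  obtain g h k where *: "(\<lambda>n. \<alpha> (g n) x0) \<longlonglongrightarrow> x" "(\<lambda>n. \<alpha> (h n) x0) \<longlonglongrightarrow> x'" "(\<lambda>n. \<alpha> (k n) x0) \<longlonglongrightarrow> x''"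
    by (metis orbit_approximation_point)
  have "null (\<lambda>n. (g n - h n) + (h n - k n))"
    by (intro null_add E_null[OF assms(1) *(1,2)] E_null[OF assms(2) *(2,3)])
  then show ?thesis using * unfolding E_def by auto
qed

lemma E_act: "E x x' \<Longrightarrow> E (\<alpha> k x) (\<alpha> k x')"
proof -
  assume "E x x'"
  then obtain g h where *: "(\<lambda>n. \<alpha> (g n) x0) \<longlonglongrightarrow> x" "(\<lambda>n. \<alpha> (h n) x0) \<longlonglongrightarrow> x'" "null (\<lambda>n. g n - h n)"
    unfolding E_def by blast
  have "(\<lambda>n. \<alpha> (k + f n) x0) \<longlonglongrightarrow> \<alpha> k y" if "(\<lambda>n. \<alpha> (f n) x0) \<longlonglongrightarrow> y" for f y
    unfolding act(3) by (rule continuous_on_tendsto_compose[OF act(1) that]) auto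
  then have "(\<lambda>n. \<alpha> (k + g n) x0) \<longlonglongrightarrow> \<alpha> k x" "(\<lambda>n. \<alpha> (k + h n) x0) \<longlonglongrightarrow> \<alpha> k x'" using * by blast+
  moreover have "null (\<lambda>n. (k + g n) - (k + h n))" using *(3) by simp
  ultimately show ?thesis
    unfolding E_def by (intro exI[of _ "\<lambda>n. k + g n"] exI[of _ "\<lambda>n. k + h n"] conjI)
qed

text \<open>The constant sequence 0 approaches \<open>x0\<close>, so any sequence approaching
  \<open>x\<close> is itself null.\<close>

lemma E_x0: "E x x0 \<Longrightarrow> x \<in> B"
proof -
  assume E: "E x x0"
  obtain g where g: "(\<lambda>n. \<alpha> (g n) x0) \<longlonglongrightarrow> x" by (rule orbit_approximation_point)
  have "null (\<lambda>n. g n - 0)" by (rule E_null[OF E g]) (simp add: act)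
  then show ?thesis using null_limit[OF _ g] by simp
qed

text \<open>A diagonal choice: being null is measured by the single number \<open>infdist\<close>,
  so at stage \<open>n\<close> one pair of group elements meets all three bounds
  \<open>1 / Suc n\<close>.\<close>

lemma E_limit:
  assumes "\<And>n. E (x n) (x' n)" "x \<longlonglongrightarrow> l" "x' \<longlonglongrightarrow> l'"
  shows "E l l'"
proof -
  have "\<exists>g h. dist (\<alpha> g x0) (x n) < 1 / real (Suc n) \<and> dist (\<alpha> h x0) (x' n) < 1 / real (Suc n) \<and>
      infdist (\<alpha> (g - h) x0) B < 1 / real (Suc n)" for n
  proof -
    obtain g h where "(\<lambda>n. \<alpha> (g n) x0) \<longlonglongrightarrow> x n" "(\<lambda>n. \<alpha> (h n) x0) \<longlonglongrightarrow> x' n" "null (\<lambda>n. g n - h n)"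
      using assms(1)[of n] unfolding E_def by blast
    then have "\<forall>\<^sub>F m in sequentially. dist (\<alpha> (g m) x0) (x n) < 1 / real (Suc n)"
      "\<forall>\<^sub>F m in sequentially. dist (\<alpha> (h m) x0) (x' n) < 1 / real (Suc n)"
      "\<forall>\<^sub>F m in sequentially. infdist (\<alpha> (g m - h m) x0) B < 1 / real (Suc n)"
      unfolding null_def by (auto intro: tendstoD order_tendstoD)
    then have "\<forall>\<^sub>F m in sequentially. dist (\<alpha> (g m) x0) (x n) < 1 / real (Suc n) \<and>
        dist (\<alpha> (h m) x0) (x' n) < 1 / real (Suc n) \<and> infdist (\<alpha> (g m - h m) x0) B < 1 / real (Suc n)"
      by eventually_elim simp
    then show ?thesis by (auto simp: eventually_sequentially)
  qed
  then obtain g h where g: "\<And>n. dist (\<alpha> (g n) x0) (x n) < 1 / real (Suc n)"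
    and h: "\<And>n. dist (\<alpha> (h n) x0) (x' n) < 1 / real (Suc n)"
    and gh: "\<And>n. infdist (\<alpha> (g n - h n) x0) B < 1 / real (Suc n)" by metis
  have lim: "f \<longlonglongrightarrow> (0::real)" if "\<And>n. f n < 1 / real (Suc n)" "\<And>n. f n \<ge> 0" for f
    by (rule tendsto_sandwich[OF _ _ tendsto_const lim_inverse_n'[THEN LIMSEQ_Suc]])
       (use that in \<open>auto intro!: always_eventually less_imp_le simp del: of_nat_Suc\<close>)
  have "(\<lambda>n. \<alpha> (g n) x0) \<longlonglongrightarrow> l"
    by (rule tendsto_dist_zero[OF assms(2)], rule lim) (use g in \<open>auto simp: dist_commute simp del: of_nat_Suc\<close>)
  moreover have "(\<lambda>n. \<alpha> (h n) x0) \<longlonglongrightarrow> l'"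
    by (rule tendsto_dist_zero[OF assms(3)], rule lim) (use h in \<open>auto simp: dist_commute simp del: of_nat_Suc\<close>)
  moreover have "null (\<lambda>n. g n - h n)"
    unfolding null_def by (rule lim) (use gh in \<open>auto simp: infdist_nonneg simp del: of_nat_Suc\<close>)
  ultimately show ?thesis unfolding E_def by blast
qed

text \<open>Equicontinuity of the action modulo \<open>E\<close>: differences of group elements are unaffected by translation.\<close>

lemma E_limit_act:
  assumes "y \<longlonglongrightarrow> l" "y' \<longlonglongrightarrow> l'" "(\<lambda>n. \<alpha> (g n) (y n)) \<longlonglongrightarrow> u" "(\<lambda>n. \<alpha> (g n) (y' n)) \<longlonglongrightarrow> u'"
    and E: "E l l'"
  shows "E u u'"
proof -
  have app: "\<exists>a. (\<lambda>n. \<alpha> (a n) x0) \<longlonglongrightarrow> l \<and> (\<lambda>n. \<alpha> (g n + a n) x0) \<longlonglongrightarrow> u"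
    if y: "y \<longlonglongrightarrow> l" "(\<lambda>n. \<alpha> (g n) (y n)) \<longlonglongrightarrow> u" for y l u
  proof -
    \<comment> \<open>Orbit points chosen in \<open>W n\<close> stay close to \<open>y n\<close>
      also after applying \<open>g n\<close>, which no modulus of continuity uniform in
      \<open>n\<close> would provide.\<close>
    define W where "W n = \<alpha> (g n) -` ball (\<alpha> (g n) (y n)) (1 / real (Suc n))" for n
    have W: "open (W n)" "y n \<in> W n" for n by (auto simp: W_def intro!: open_act_vimage)
    obtain a where a: "\<And>n. \<alpha> (a n) x0 \<in> W n" "(\<lambda>n. dist (y n) (\<alpha> (a n) x0)) \<longlonglongrightarrow> 0"
      by (rule orbit_approximation[of W y, OF W]) blast
    have "(\<lambda>n. dist (\<alpha> (g n) (y n)) (\<alpha> (g n + a n) x0)) \<longlonglongrightarrow> 0"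
    proof (rule tendsto_sandwich[OF _ _ tendsto_const lim_inverse_n'[THEN LIMSEQ_Suc]])
      have "dist (\<alpha> (g n) (y n)) (\<alpha> (g n + a n) x0) < 1 / real (Suc n)" for n
        using a(1)[of n] by (simp add: W_def act(3))
      then show "\<forall>\<^sub>F n in sequentially. dist (\<alpha> (g n) (y n)) (\<alpha> (g n + a n) x0) \<le> 1 / real (Suc n)"
        by (intro always_eventually allI less_imp_le)
    qed simp
    with tendsto_dist_zero[OF y(1) a(2)] show ?thesis
      by (intro exI[of _ a] conjI tendsto_dist_zero[OF y(2)])
  qed
  obtain a where a: "(\<lambda>n. \<alpha> (a n) x0) \<longlonglongrightarrow> l" "(\<lambda>n. \<alpha> (g n + a n) x0) \<longlonglongrightarrow> u"
    using app[OF assms(1,3)] by blast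
  obtain a' where a': "(\<lambda>n. \<alpha> (a' n) x0) \<longlonglongrightarrow> l'" "(\<lambda>n. \<alpha> (g n + a' n) x0) \<longlonglongrightarrow> u'"
    using app[OF assms(2,4)] by blast
  have "null (\<lambda>n. (g n + a n) - (g n + a' n))" using E_null[OF E a(1) a'(1)] by simp
  then show ?thesis using a(2) a'(2)
    unfolding E_def by (intro exI[of _ "\<lambda>n. g n + a n"] exI[of _ "\<lambda>n. g n + a' n"] conjI)
qed

end

subsection \<open>Quotients by closed invariant equivalence relations\<close>

text \<open>The quotient is realised on chosen representatives, so that it lives on a subset of
  \<open>'x\<close> as the definition of the maximal factor requires. The hypotheses
  \<open>lim\<close> and \<open>equi\<close> are closedness of the relation and equicontinuity
  modulo it, both in sequential form.\<close>

lemma equicontinuous_quotient: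
  fixes \<alpha> :: "'g::group_add \<Rightarrow> 'x::compact_metric_space \<Rightarrow> 'x"
  assumes dyn: "dynamical_system euclidean \<alpha>"
    and refl: "\<And>x. E x x" and sym: "\<And>x y. E x y \<Longrightarrow> E y x" and trans: "\<And>x y z. E x y \<Longrightarrow> E y z \<Longrightarrow> E x z"
    and inv: "\<And>g x y. E x y \<Longrightarrow> E (\<alpha> g x) (\<alpha> g y)"
    and lim: "\<And>x y k l. (\<And>n. E (x n) (y n)) \<Longrightarrow> x \<longlonglongrightarrow> k \<Longrightarrow> y \<longlonglongrightarrow> l \<Longrightarrow> E k l"
    and equi: "\<And>x y g k l u v. x \<longlonglongrightarrow> k \<Longrightarrow> y \<longlonglongrightarrow> l \<Longrightarrow> (\<lambda>n. \<alpha> (g n) (x n)) \<longlonglongrightarrow> u \<Longrightarrow>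
        (\<lambda>n. \<alpha> (g n) (y n)) \<longlonglongrightarrow> v \<Longrightarrow> E k l \<Longrightarrow> E u v"
  obtains Z :: "'x topology" and \<zeta> :: "'g \<Rightarrow> 'x \<Rightarrow> 'x" and q where "dynamical_system Z \<zeta>" "extension euclidean \<alpha> Z \<zeta> q"
    "equicontinuous_system Z \<zeta>" "\<And>x y. q x = q y \<longleftrightarrow> E x y"
proof -
  note act = dynamical_system_euclideanD[OF dyn]
  define q where "q x = (SOME y. E x y)" for x
  have Eq: "E x (q x)" for x unfolding q_def using refl by (rule someI)
  have q_eq: "q x = q y \<longleftrightarrow> E x y" for x y
  proof
    assume "q x = q y" then show "E x y" using Eq[of x] Eq[of y] sym trans by metis
  next
    assume "E x y"
    then have "E x = E y" using sym trans by blast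
    then show "q x = q y" by (simp add: q_def)
  qed
  define Z where "Z = topology (\<lambda>U. U \<subseteq> range q \<and> open (q -` U))"
  have "istopology (\<lambda>U. U \<subseteq> range q \<and> open (q -` U))"
    unfolding istopology_def by (auto simp: vimage_Union intro!: open_Int open_UN)
  then have openZ: "openin Z U \<longleftrightarrow> U \<subseteq> range q \<and> open (q -` U)" for U
    by (simp add: Z_def)
  have topZ: "topspace Z = range q"
  proof
    have "q -` range q = UNIV" by auto
    then have "openin Z (range q)" using openZ[of "range q"] by simp
    then show "range q \<subseteq> topspace Z" by (rule openin_subset)
    show "topspace Z \<subseteq> range q" using openZ[of "topspace Z"] by simp
  qed
  have cont_q: "continuous_map euclidean Z q"
    unfolding continuous_map_def topZ openZ by (auto simp: vimage_def)
  \<comment> \<open>By \<open>lim\<close> and compactness, saturations of closed sets are closed.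
    Normality then passes to the image, and with closed points this makes the quotient
    Hausdorff.\<close>
  have closed_q: "closed_map euclidean Z q"
    unfolding closed_map_def
  proof (intro allI impI)
    fix C :: "'x set" assume "closedin euclidean C"
    then have C: "closed C" by simp
    have "closed (q -` (q ` C))"
      unfolding closed_sequential_limits
    proof (intro allI impI, elim conjE)
      fix x l assume x: "\<forall>n. x n \<in> q -` (q ` C)" "x \<longlonglongrightarrow> l"
      then have "\<exists>c. c \<in> C \<and> E (x n) c" for n using q_eq by (metis imageE vimageD)
      then obtain c where c: "\<And>n. c n \<in> C" "\<And>n. E (x n) (c n)" by metis
      obtain r k where r: "strict_mono (r :: nat \<Rightarrow> nat)" "(\<lambda>n. c (r n)) \<longlonglongrightarrow> k"
        by (rule compact_space_subseq)
      have "E l k"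
        by (rule lim[of "\<lambda>n. x (r n)" "\<lambda>n. c (r n)"])
           (use c r LIMSEQ_subseq_LIMSEQ[OF x(2) r(1)] in \<open>auto simp: o_def\<close>)
      moreover have "k \<in> C" using closed_sequentially[OF C _ r(2)] c(1) by blast
      ultimately show "l \<in> q -` (q ` C)" using q_eq by blast
    qed
    moreover have "q -` (range q - q ` C) = - (q -` (q ` C))" by auto
    ultimately show "closedin Z (q ` C)" by (auto simp: closedin_def topZ openZ open_Compl)
  qed
  have surj_q: "q ` topspace euclidean = topspace Z" by (simp add: topZ)
  have quot: "quotient_map euclidean Z q"
    by (rule continuous_closed_imp_quotient_map[OF cont_q closed_q surj_q])
  have compX: "compact_space (euclidean :: 'x topology)"
    using compact_UNIV_metric by (simp add: compact_space_def)
  have compZ: "compact_space Z"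
    using image_compactin[OF _ cont_q, of UNIV] compX by (simp add: compact_space_def topZ)
  have "normal_space (euclidean :: 'x topology)"
    by (rule compact_Hausdorff_or_regular_imp_normal_space[OF compX]) simp
  then have "normal_space Z"
    by (rule normal_space_continuous_closed_map_image[OF _ cont_q closed_q surj_q])
  moreover have "t1_space Z"
    unfolding t1_space_closedin_singleton
  proof
    fix z assume "z \<in> topspace Z"
    then obtain x where "z = q x" by (auto simp: topZ)
    then show "closedin Z {z}" using closed_q unfolding closed_map_def
      by (metis closed_closedin closed_singleton image_empty image_insert)
  qed
  ultimately have hausZ: "Hausdorff_space Z" by (rule normal_t1_imp_Hausdorff_space)
  define \<zeta> where "\<zeta> g z = q (\<alpha> g z)" for g z
  have \<zeta>q: "\<zeta> g (q x) = q (\<alpha> g x)" for g x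
    unfolding \<zeta>_def q_eq by (rule inv, rule sym, rule Eq)
  have cont_\<zeta>: "continuous_map Z Z (\<zeta> g)" for g
  proof (rule continuous_compose_quotient_map[OF quot])
    have "continuous_map euclidean Z (q \<circ> \<alpha> g)"
      by (rule continuous_map_compose[OF _ cont_q]) (simp add: act)
    then show "continuous_map euclidean Z (\<zeta> g \<circ> q)" by (simp add: o_def \<zeta>q)
  qed
  have \<zeta>_0: "\<zeta> 0 z = z" if "z \<in> topspace Z" for z using that by (auto simp: topZ \<zeta>q act)
  have \<zeta>_add: "\<zeta> (g + h) z = \<zeta> g (\<zeta> h z)" if "z \<in> topspace Z" for g h z
    using that by (auto simp: topZ \<zeta>q act)
  have dynZ: "dynamical_system Z \<zeta>"
    unfolding dynamical_system_def
  proof (intro conjI allI ballI compZ hausZ \<zeta>_0 \<zeta>_add)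
    fix g
    have "homeomorphic_maps Z Z (\<zeta> g) (\<zeta> (- g))"
      unfolding homeomorphic_maps_def
      using \<zeta>_add[of _ "- g" g] \<zeta>_add[of _ g "- g"] \<zeta>_0 cont_\<zeta> by simp
    then show "homeomorphic_map Z Z (\<zeta> g)" using homeomorphic_map_maps by blast
  qed
  have extZ: "extension euclidean \<alpha> Z \<zeta> q"
    using cont_q by (simp add: extension_def topZ \<zeta>q)
  have cont_qq: "continuous_map euclidean (prod_topology Z Z) (map_prod q q)"
  proof -
    have "continuous_map (prod_topology euclidean euclidean) (prod_topology Z Z) (\<lambda>(x, y). (q x, q y))"
      using cont_q by (intro continuous_map_prod_top[THEN iffD2]) simp
    then show ?thesis by (simp add: map_prod_def)
  qed
  have "equicontinuous_system Z \<zeta>"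
    unfolding equicontinuous_system_def
  proof (intro allI impI)
    fix \<epsilon> assume "diagonal_nbhd Z \<epsilon>"
    then obtain W where W: "openin (prod_topology Z Z) W" "Id_on (topspace Z) \<subseteq> W" "W \<subseteq> \<epsilon>"
      unfolding diagonal_nbhd_def by blast
    define O' where "O' = map_prod q q -` W"
    have "open O'"
      using openin_continuous_map_preimage[OF cont_qq W(1)] by (simp add: O'_def vimage_def)
    have EO: "p \<in> O'" if "E (fst p) (snd p)" for p
    proof -
      have "q (fst p) = q (snd p)" using that q_eq by blast
      then have "map_prod q q p = (q (fst p), q (fst p))" by (cases p) simp
      then show ?thesis using W(2) by (auto simp: O'_def topZ Id_on_def)
    qed
    \<comment> \<open>The pairs that some group element moves out of \<open>O'\<close>. By
      \<open>equi\<close> their closure contains no equivalent pair, so the complement of its image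
      is an open neighbourhood of the diagonal of the quotient, valid for all
      \<open>g\<close>.\<close>
    define N where "N = {(x, y). \<exists>g. (\<alpha> g x, \<alpha> g y) \<notin> O'}"
    have NE: "\<not> E (fst p) (snd p)" if cl: "p \<in> closure N" for p
    proof
      assume E: "E (fst p) (snd p)"
      obtain s where s: "\<And>n. s n \<in> N" "s \<longlonglongrightarrow> p" using cl unfolding closure_sequential by blast
      have "\<exists>g. (\<alpha> g (fst (s n)), \<alpha> g (snd (s n))) \<notin> O'" for n
        using s(1)[of n] by (simp add: N_def case_prod_beta)
      then obtain g where g: "\<And>n. (\<alpha> (g n) (fst (s n)), \<alpha> (g n) (snd (s n))) \<notin> O'" by metis
      obtain r u where r: "strict_mono (r :: nat \<Rightarrow> nat)" "(\<lambda>n. \<alpha> (g (r n)) (fst (s (r n)))) \<longlonglongrightarrow> u"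
        by (rule compact_space_subseq[of "\<lambda>n. \<alpha> (g n) (fst (s n))"])
      obtain t v where t: "strict_mono (t :: nat \<Rightarrow> nat)" "(\<lambda>n. \<alpha> (g (r (t n))) (snd (s (r (t n))))) \<longlonglongrightarrow> v"
        by (rule compact_space_subseq[of "\<lambda>n. \<alpha> (g (r n)) (snd (s (r n)))"])
      have s': "(\<lambda>n. s (r (t n))) \<longlonglongrightarrow> p"
        using LIMSEQ_subseq_LIMSEQ[OF s(2) strict_mono_o[OF r(1) t(1)]] by (simp add: o_def)
      have u: "(\<lambda>n. \<alpha> (g (r (t n))) (fst (s (r (t n))))) \<longlonglongrightarrow> u"
        using LIMSEQ_subseq_LIMSEQ[OF r(2) t(1)] by (simp add: o_def)
      have "E u v" by (rule equi[OF tendsto_fst[OF s'] tendsto_snd[OF s'] u t(2) E])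
      moreover have "(u, v) \<in> - O'"
      proof (rule closed_sequentially)
        show "closed (- O')" using \<open>open O'\<close> by (rule closed_Compl)
        show "(\<lambda>n. (\<alpha> (g (r (t n))) (fst (s (r (t n)))), \<alpha> (g (r (t n))) (snd (s (r (t n)))))) \<longlonglongrightarrow> (u, v)"
          by (rule tendsto_Pair[OF u t(2)])
      qed (use g in auto)
      ultimately show False using EO[of "(u, v)"] by simp
    qed
    define \<delta> where "\<delta> = topspace (prod_topology Z Z) - map_prod q q ` closure N"
    have "compact (closure N)"
      using compact_Int_closed[OF compact_Times[OF compact_UNIV_metric compact_UNIV_metric], of "closure N"] by simp
    then have "compactin (prod_topology Z Z) (map_prod q q ` closure N)"
      by (intro image_compactin[OF _ cont_qq]) simp
    then have "closedin (prod_topology Z Z) (map_prod q q ` closure N)"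
      using compactin_imp_closedin hausZ by (metis Hausdorff_space_prod_topology)
    then have "openin (prod_topology Z Z) \<delta>" unfolding \<delta>_def by (rule openin_diff[OF openin_topspace])
    moreover have "Id_on (topspace Z) \<subseteq> \<delta>"
    proof
      fix p assume "p \<in> Id_on (topspace Z)"
      then obtain z where z: "p = (z, z)" "z \<in> topspace Z" by blast
      have "p \<notin> map_prod q q ` closure N"
      proof
        assume "p \<in> map_prod q q ` closure N"
        then obtain p' where "p' \<in> closure N" "q (fst p') = q (snd p')" using z(1) by auto
        then show False using NE q_eq by blast
      qed
      then show "p \<in> \<delta>" using z by (simp add: \<delta>_def)
    qed
    ultimately have "diagonal_nbhd Z \<delta>" by (auto simp: diagonal_nbhd_def \<delta>_def)
    moreover have "map_prod (\<zeta> g) (\<zeta> g) ` \<delta> \<subseteq> \<epsilon>" for g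
    proof
      fix p assume "p \<in> map_prod (\<zeta> g) (\<zeta> g) ` \<delta>"
      then obtain x y where xy: "p = (\<zeta> g (q x), \<zeta> g (q y))" "(q x, q y) \<in> \<delta>"
        by (auto simp: \<delta>_def topZ)
      then have "(x, y) \<notin> closure N" unfolding \<delta>_def by force
      then have "(x, y) \<notin> N" using closure_subset by blast
      then have "(\<alpha> g x, \<alpha> g y) \<in> O'" by (simp add: N_def)
      then show "p \<in> \<epsilon>" using W(3) by (auto simp: xy O'_def \<zeta>q)
    qed
    ultimately show "\<exists>\<delta>. diagonal_nbhd Z \<delta> \<and> (\<forall>g. map_prod (\<zeta> g) (\<zeta> g) ` \<delta> \<subseteq> \<epsilon>)" by blast
  qed
  then show thesis using that dynZ extZ q_eq by blast
qed

lemma (in automorphic_point) fibre_RP: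
  assumes "\<pi> x = \<pi> x0" shows "RP x0 x"
proof -
  obtain Z :: "'x topology" and \<zeta> :: "'g \<Rightarrow> 'x \<Rightarrow> 'x" and q
    where Z: "dynamical_system Z \<zeta>" "extension euclidean \<alpha> Z \<zeta> q" "equicontinuous_system Z \<zeta>"
      and q: "\<And>x y. q x = q y \<longleftrightarrow> E x y"
  proof (rule equicontinuous_quotient[of \<alpha> E])
    show "dynamical_system euclidean \<alpha>" by (rule minimal_system_euclideanD(1)[OF minimal])
    show "E x x" for x by (rule E_refl)
    show "E y x" if "E x y" for x y by (rule E_sym[OF that])
    show "E x z" if "E x y" "E y z" for x y z by (rule E_trans[OF that])
    show "E (\<alpha> g x) (\<alpha> g y)" if "E x y" for g x y by (rule E_act[OF that])
    show "E k l" if "\<And>n. E (x n) (y n)" "x \<longlonglongrightarrow> k" "y \<longlonglongrightarrow> l" for x y k l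
      by (rule E_limit[OF that])
    show "E u v" if "x \<longlonglongrightarrow> k" "y \<longlonglongrightarrow> l" "(\<lambda>n. \<alpha> (g n) (x n)) \<longlonglongrightarrow> u"
      "(\<lambda>n. \<alpha> (g n) (y n)) \<longlonglongrightarrow> v" "E k l" for x y g k l u v
      by (rule E_limit_act[OF that])
  qed (rule that)
  then obtain h where h: "\<And>x. q x = h (\<phi> x)"
    using maximal unfolding maximal_equicontinuous_factor_def by (metis UNIV_I topspace_euclidean)
  have "q x = q x0" using fibre_x0[of x] assms by (simp add: h)
  then show ?thesis using q E_x0 by (simp add: B_def)
qed

subsection \<open>Integration of the Haar section\<close>

text \<open>Measurability into \<open>count_space UNIV\<close> is the point: any function of the
  selected net point is then measurable, including arbitrary choices of points or of
  measures.\<close>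

lemma finite_selection:
  assumes "finite D"
  shows "\<exists>s :: 'a::metric_space \<Rightarrow> 'a. s \<in> measurable borel (count_space UNIV) \<and>
    (\<forall>x. (\<exists>p\<in>D. dist x p < r) \<longrightarrow> s x \<in> D \<and> dist x (s x) < r)"
  using assms
proof (induction D)
  case empty
  show ?case by (intro exI[of _ "\<lambda>_. undefined"]) simp
next
  case (insert p D)
  then obtain s :: "'a \<Rightarrow> 'a" where s [measurable]: "s \<in> measurable borel (count_space UNIV)"
    and sD: "\<And>x. \<exists>p\<in>D. dist x p < r \<Longrightarrow> s x \<in> D \<and> dist x (s x) < r" by metis
  define s' where "s' x = (if dist x p < r then p else s x)" for x
  have "s' \<in> measurable borel (count_space UNIV)"
    unfolding s'_def
  proof (rule measurable_If)
    have "open {x. dist x p < r}" by (intro open_Collect_less continuous_intros)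
    then show "{x \<in> space borel. dist x p < r} \<in> sets borel" by simp
  qed simp_all
  moreover have "\<forall>x. (\<exists>p'\<in>insert p D. dist x p' < r) \<longrightarrow> s' x \<in> insert p D \<and> dist x (s' x) < r"
    using sD by (auto simp: s'_def)
  ultimately show ?case by blast
qed

lemma integral_bind_prob:
  fixes f :: "'a::compact_metric_space \<Rightarrow> real" and \<nu> :: "'b::topological_space measure"
  assumes \<nu>: "\<nu> \<in> prob_measures" and K: "K \<in> borel \<rightarrow>\<^sub>M prob_algebra borel" and f: "continuous_on UNIV f"
  shows "(\<integral>x. f x \<partial>(\<nu> \<bind> K)) = (\<integral>y. (\<integral>x. f x \<partial>K y) \<partial>\<nu>)" "\<nu> \<bind> K \<in> prob_measures"
    "integrable \<nu> (\<lambda>y. \<integral>x. f x \<partial>K y)"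
proof -
  obtain B where B: "\<And>x. \<bar>f x\<bar> \<le> B" by (rule continuous_imp_bounded_real[OF f]) blast
  have fm [measurable]: "f \<in> borel_measurable borel" by (rule borel_measurable_continuous_onI[OF f])
  have K': "K \<in> \<nu> \<rightarrow>\<^sub>M subprob_algebra borel"
    by (intro measurable_prob_measures[OF \<nu>] measurable_prob_algebraD K)
  have Kp: "K y \<in> prob_measures" for y using measurable_space[OF K, of y] by (simp add: prob_measures_def)
  have "emeasure (K y) (space (K y)) = 1" for y
    using prob_space.emeasure_space_1[OF prob_measuresD(2)[OF Kp]] .
  then show "(\<integral>x. f x \<partial>(\<nu> \<bind> K)) = (\<integral>y. (\<integral>x. f x \<partial>K y) \<partial>\<nu>)"
    using B \<nu> by (intro integral_bind[OF fm _ K', of B 1])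
      (auto simp: prob_measures_iff prob_space_def)
  have "\<nu> \<in> space (prob_algebra borel)" using \<nu> by (simp add: prob_measures_def)
  from prob_space_bind'[OF this K] sets_bind'[OF this K]
  show "\<nu> \<bind> K \<in> prob_measures" by (simp add: prob_measures_iff)
  show "integrable \<nu> (\<lambda>y. \<integral>x. f x \<partial>K y)"
  proof (rule integrable_bounded_prob[OF \<nu>])
    show "(\<lambda>y. \<integral>x. f x \<partial>K y) \<in> borel_measurable borel"
      using measurable_prob_algebraD[OF K] by measurable
    show "\<bar>\<integral>x. f x \<partial>K y\<bar> \<le> B" for y
      using integral_diff_le_prob[OF Kp[of y] integrable_continuous_prob[OF Kp f], of "\<lambda>_. 0" B] B by simp
  qed
qed

lemma finite_uniform_modulus:
  fixes F :: "('a::compact_metric_space \<Rightarrow> real) set"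
  assumes "finite F" "\<And>f. f \<in> F \<Longrightarrow> continuous_on UNIV f" "e > 0"
  obtains d where "d > 0" "\<And>f x y. f \<in> F \<Longrightarrow> dist x y < d \<Longrightarrow> \<bar>f x - f y\<bar> < e"
proof -
  have "\<forall>f\<in>F. \<exists>d>0. \<forall>x y. dist x y < d \<longrightarrow> \<bar>f x - f y\<bar> < e"
    using continuous_imp_uniformly_continuous_space[OF assms(2) assms(3)] unfolding dist_real_def by metis
  then obtain d where d: "\<And>f. f \<in> F \<Longrightarrow> d f > 0"
    "\<And>f x y. f \<in> F \<Longrightarrow> dist x y < d f \<Longrightarrow> \<bar>f x - f y\<bar> < e" by metis
  show thesis
    by (rule that[of "Min (insert 1 (d ` F))"]) (use assms(1) d in auto)
qed

context Haar_extension
begin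

text \<open>Open sets generate the Borel sets and are stable under intersection, and the mass of an
  open set is a pointwise limit of integrals that depend continuously on \<open>y\<close>.\<close>

lemma measurable_hm: "hm \<in> borel \<rightarrow>\<^sub>M prob_algebra borel"
proof (rule measurable_prob_algebra_generated)
  show "sets (borel :: 'x measure) = sigma_sets UNIV (Collect open)" by (simp add: borel_def)
  show "Int_stable (Collect (open :: 'x set \<Rightarrow> bool))" by (auto simp: Int_stable_def)
  show "prob_space (hm y)" "sets (hm y) = sets borel" for y using hm_prob[of y] by (auto simp: prob_measures_iff)
  fix U :: "'x set" assume "U \<in> Collect open"
  then have U: "open U" by simp
  have fin: "emeasure (hm y) U = ennreal (measure (hm y) U)" for y
    using hm_prob[of y] by (intro finite_measure.emeasure_eq_measure)
      (auto simp: prob_measures_iff prob_space_def)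
  have "(\<lambda>y. measure (hm y) U) \<in> borel_measurable borel"
  proof (cases "U = UNIV")
    case True
    have "measure (hm y) U = 1" for y
      using prob_space.prob_space[OF prob_measuresD(2)[OF hm_prob[of y]]] prob_measuresD(3)[OF hm_prob[of y]] True by simp
    then show ?thesis by simp
  next
    case False
    show ?thesis
    proof (rule borel_measurable_LIMSEQ_real)
      show "(\<lambda>n. \<integral>x. min 1 (real n * infdist x (- U)) \<partial>hm y) \<longlonglongrightarrow> measure (hm y) U" for y
        using prob_measures_open_integral_limit[OF U hm_prob[of y]] False by simp
      show "(\<lambda>y. \<integral>x. min 1 (real n * infdist x (- U)) \<partial>hm y) \<in> borel_measurable borel" for n
        by (intro borel_measurable_continuous_onI continuous_hm continuous_intros)
    qed
  qed
  then show "(\<lambda>y. emeasure (hm y) U) \<in> borel_measurable borel" unfolding fin by simp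
qed simp

definition fibre_mean :: "('x \<Rightarrow> real) \<Rightarrow> 'x \<Rightarrow> real" where
  "fibre_mean f x = (\<integral>x'. f x' \<partial>hm (\<pi> x))"

lemma cont_fibre_mean: "continuous_on UNIV f \<Longrightarrow> continuous_on UNIV (fibre_mean f)"
  unfolding fibre_mean_def by (rule continuous_on_compose2[OF continuous_hm cont_\<pi>]) auto

lemma integral_fibre_deviation:
  assumes f: "continuous_on UNIV f"
  shows "(\<integral>x. f x - fibre_mean f x \<partial>hm y) = 0"
proof -
  interpret prob_space "hm y" using prob_measuresD(2)[OF hm_prob] .
  have "(\<integral>x. fibre_mean f x \<partial>hm y) = (\<integral>x. (\<integral>x'. f x' \<partial>hm y) \<partial>hm y)"
    by (intro integral_cong_AE measurable_prob_measures[OF hm_prob]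
          borel_measurable_continuous_onI[OF cont_fibre_mean[OF f]])
       (use hm_fibre[of y] in \<open>auto simp: fibre_mean_def\<close>)
  then show ?thesis
    using integrable_continuous_prob[OF hm_prob f] integrable_continuous_prob[OF hm_prob cont_fibre_mean[OF f]]
    by (simp add: prob_space)
qed

text \<open>If all deviations from the fibre means integrate to 0, then \<open>\<mu>\<close> and the
  Haar integral of its own image under \<open>\<pi>\<close> agree on the determining family, hence
  coincide.\<close>

lemma integrate_section_eq:
  assumes det: "\<And>\<mu> \<nu>. \<mu> \<in> prob_measures \<Longrightarrow> \<nu> \<in> prob_measures \<Longrightarrow>
       \<forall>j. (\<integral>x. f j x \<partial>\<mu>) = (\<integral>x. f j x \<partial>\<nu>) \<Longrightarrow> \<mu> = \<nu>"
    and f: "\<And>j :: nat. continuous_on UNIV (f j)"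
  shows "integrate_section hm ` prob_measures =
     {\<mu> \<in> prob_measures. \<forall>j. (\<integral>x. f j x - fibre_mean (f j) x \<partial>\<mu>) = 0}"
proof (intro equalityI subsetI)
  fix \<mu> assume "\<mu> \<in> integrate_section hm ` prob_measures"
  then obtain \<nu> where \<nu>: "\<nu> \<in> prob_measures" "\<mu> = \<nu> \<bind> hm" by (auto simp: integrate_section_def)
  have "(\<integral>x. f j x - fibre_mean (f j) x \<partial>\<mu>) = 0" for j
    unfolding \<nu>(2)
    by (subst integral_bind_prob(1)[OF \<nu>(1) measurable_hm])
       (auto intro!: continuous_intros f cont_fibre_mean simp: integral_fibre_deviation[OF f])
  then show "\<mu> \<in> {\<mu> \<in> prob_measures. \<forall>j. (\<integral>x. f j x - fibre_mean (f j) x \<partial>\<mu>) = 0}"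
    using integral_bind_prob(2)[OF \<nu>(1) measurable_hm f] \<nu>(2) by blast
next
  fix \<mu> assume "\<mu> \<in> {\<mu> \<in> prob_measures. \<forall>j. (\<integral>x. f j x - fibre_mean (f j) x \<partial>\<mu>) = 0}"
  then have \<mu>: "\<mu> \<in> prob_measures" and z: "\<And>j. (\<integral>x. f j x - fibre_mean (f j) x \<partial>\<mu>) = 0" by auto
  have \<nu>: "distr \<mu> borel \<pi> \<in> prob_measures" by (rule distr_prob_measures[OF \<mu> measurable_\<pi>])
  have "\<mu> = distr \<mu> borel \<pi> \<bind> hm"
  proof (rule det[OF \<mu> integral_bind_prob(2)[OF \<nu> measurable_hm f]], rule allI)
    fix j
    have "(\<integral>x. f j x \<partial>(distr \<mu> borel \<pi> \<bind> hm)) = (\<integral>y. (\<integral>x. f j x \<partial>hm y) \<partial>distr \<mu> borel \<pi>)"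
      by (rule integral_bind_prob(1)[OF \<nu> measurable_hm f])
    also have "\<dots> = (\<integral>x. fibre_mean (f j) x \<partial>\<mu>)"
      unfolding fibre_mean_def
      by (rule integral_distr_prob[OF \<mu> measurable_\<pi> borel_measurable_continuous_onI[OF continuous_hm[OF f]]])
    also have "\<dots> = (\<integral>x. f j x \<partial>\<mu>)"
      using z[of j] integrable_continuous_prob[OF \<mu> f] integrable_continuous_prob[OF \<mu> cont_fibre_mean[OF f]]
      by simp
    finally show "(\<integral>x. f j x \<partial>\<mu>) = (\<integral>x. f j x \<partial>(distr \<mu> borel \<pi> \<bind> hm))" by simp
  qed
  then show "\<mu> \<in> integrate_section hm ` prob_measures"
    using \<nu> by (auto simp: integrate_section_def)
qed

text \<open>The Haar measure of the fibre is pushed into \<open>V\<close> by a finite-valued Borel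
  map \<open>\<sigma>\<close>, chosen so that following it by \<open>\<alpha> g\<close> moves each
  fibre point by less than \<open>d\<close>. Functions that integrate to 0 over the fibre then have
  small integrals after translation.\<close>

lemma push_close_to_Haar:
  assumes dense: "\<And>x. \<pi> x = y \<Longrightarrow> \<exists>v\<in>V. dist (\<alpha> g v) x < d/2"
    and h: "\<And>h. h \<in> H \<Longrightarrow> continuous_on UNIV h" "\<And>h x y. h \<in> H \<Longrightarrow> dist x y < d \<Longrightarrow> \<bar>h x - h y\<bar> \<le> e"
      "\<And>h. h \<in> H \<Longrightarrow> (\<integral>x. h x \<partial>hm y) = 0"
    and d: "d > 0"
  obtains \<rho> where "\<rho> \<in> prob_measures" "AE x in \<rho>. x \<in> V"
    "\<And>h. h \<in> H \<Longrightarrow> \<bar>\<integral>x. h (\<alpha> g x) \<partial>\<rho>\<bar> \<le> (e::real)"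
proof -
  have "d/2 > 0" using d by simp
  then obtain D where D: "finite D" "D \<subseteq> {x. \<pi> x = y}" "\<And>x. x \<in> {x. \<pi> x = y} \<Longrightarrow> \<exists>p\<in>D. dist x p < d/2"
    by (rule finite_net[where S="{x. \<pi> x = y}"]) blast
  obtain s :: "'x \<Rightarrow> 'x" where s: "s \<in> measurable borel (count_space UNIV)"
    "\<And>x. \<exists>p\<in>D. dist x p < d/2 \<Longrightarrow> s x \<in> D \<and> dist x (s x) < d/2"
    using finite_selection[OF D(1), of "d/2"] by metis
  have "\<forall>p\<in>D. \<exists>v\<in>V. dist (\<alpha> g v) p < d/2" using dense D(2) by blast
  then obtain v where v: "\<And>p. p \<in> D \<Longrightarrow> v p \<in> V" "\<And>p. p \<in> D \<Longrightarrow> dist (\<alpha> g (v p)) p < d/2" by metis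
  define \<sigma> where "\<sigma> x = v (s x)" for x
  have \<sigma>: "\<sigma> \<in> borel_measurable borel"
    unfolding \<sigma>_def by (rule measurable_compose[OF s(1)]) simp
  have \<sigma>V: "\<sigma> x \<in> V" "dist (\<alpha> g (\<sigma> x)) x < d" if "\<pi> x = y" for x
  proof -
    have sx: "s x \<in> D" "dist x (s x) < d/2" using s(2)[of x] D(3)[of x] that by auto
    then show "\<sigma> x \<in> V" by (simp add: \<sigma>_def v)
    show "dist (\<alpha> g (\<sigma> x)) x < d"
      unfolding \<sigma>_def using v(2)[OF sx(1)] sx(2) by (rule dist_triangle_half_l)
  qed
  define \<rho> where "\<rho> = distr (hm y) borel \<sigma>"
  show thesis
  proof (rule that)
    show \<rho>: "\<rho> \<in> prob_measures" unfolding \<rho>_def by (rule distr_prob_measures[OF hm_prob \<sigma>])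
    \<comment> \<open>\<open>V\<close> is an arbitrary set here; the statement about almost all
      points is transferred through a finite, hence Borel, subset of it.\<close>
    have fin: "finite (v ` D)" using D(1) by simp
    have "AE x in hm y. \<sigma> x \<in> v ` D \<inter> V"
      using hm_fibre[of y]
    proof eventually_elim
      case (elim x)
      then have "s x \<in> D" using s(2)[of x] D(3)[of x] by auto
      then show ?case using \<sigma>V(1)[OF elim] by (simp add: \<sigma>_def)
    qed
    moreover have "v ` D \<inter> V \<in> sets borel"
      using fin by (intro borel_closed finite_imp_closed) auto
    then have "{x \<in> space borel. x \<in> v ` D \<inter> V} \<in> sets borel" by (simp del: Int_iff)
    ultimately have "AE x in \<rho>. x \<in> v ` D \<inter> V"
      unfolding \<rho>_def by (subst AE_distr_iff[OF measurable_prob_measures[OF hm_prob \<sigma>]])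
    then show "AE x in \<rho>. x \<in> V" by eventually_elim simp
    fix h assume hH: "h \<in> H"
    have cont: "continuous_on UNIV (\<lambda>x. h (\<alpha> g x))"
      by (rule continuous_on_compose2[OF h(1)[OF hH] act(1)]) simp
    have meas: "(\<lambda>x. h (\<alpha> g x)) \<in> borel_measurable borel" by (rule borel_measurable_continuous_onI[OF cont])
    have "(\<integral>x. h (\<alpha> g x) \<partial>\<rho>) = (\<integral>x. h (\<alpha> g (\<sigma> x)) \<partial>hm y)"
      unfolding \<rho>_def by (rule integral_distr_prob[OF hm_prob \<sigma> meas])
    moreover have "\<bar>(\<integral>x. h (\<alpha> g (\<sigma> x)) \<partial>hm y) - (\<integral>x. h x \<partial>hm y)\<bar> \<le> e"
    proof (rule integral_diff_le_prob[OF hm_prob _ integrable_continuous_prob[OF hm_prob h(1)[OF hH]]])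
      obtain B where "\<And>x. \<bar>h x\<bar> \<le> B" by (rule continuous_imp_bounded_real[OF h(1)[OF hH]]) blast
      then show "integrable (hm y) (\<lambda>x. h (\<alpha> g (\<sigma> x)))"
        by (intro integrable_bounded_prob[OF hm_prob measurable_compose[OF \<sigma> meas]])
      show "AE x in hm y. \<bar>h (\<alpha> g (\<sigma> x)) - h x\<bar> \<le> e"
        using hm_fibre[of y] by eventually_elim (intro h(2)[OF hH] \<sigma>V)
    qed
    ultimately show "\<bar>\<integral>x. h (\<alpha> g x) \<partial>\<rho>\<bar> \<le> e" using h(3)[OF hH] by simp
  qed
qed

text \<open>The mass at \<open>x\<close> is replaced by a measure on the ball around the selected
  net point \<open>i x\<close>. It moves by less than \<open>d1\<close>, which preserves the
  integrals over \<open>F\<close>; every replacement measure is nearly null for \<open>H\<close>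
  after translation by the common \<open>g\<close>, and mixing preserves this bound.\<close>

lemma approximation_step:
  assumes RP: "\<And>x. \<pi> x = \<pi> x0 \<Longrightarrow> RP x0 x" and \<mu>: "\<mu> \<in> prob_measures"
    and F: "finite F" "\<And>f :: 'x \<Rightarrow> real. f \<in> F \<Longrightarrow> continuous_on UNIV f"
    and H: "finite H" "\<And>h :: 'x \<Rightarrow> real. h \<in> H \<Longrightarrow> continuous_on UNIV h" "\<And>h y. h \<in> H \<Longrightarrow> (\<integral>x. h x \<partial>hm y) = 0"
    and e: "e > 0"
  obtains \<mu>' g where "\<mu>' \<in> prob_measures" "\<And>f. f \<in> F \<Longrightarrow> \<bar>(\<integral>x. f x \<partial>\<mu>') - (\<integral>x. f x \<partial>\<mu>)\<bar> < e"
    "\<And>h. h \<in> H \<Longrightarrow> \<bar>\<integral>x. h (\<alpha> g x) \<partial>\<mu>'\<bar> < e"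
proof -
  have e2: "e/2 > 0" using e by simp
  obtain d1 where d1: "d1 > 0" "\<And>f x y. f \<in> F \<Longrightarrow> dist x y < d1 \<Longrightarrow> \<bar>f x - f y\<bar> < e/2"
    by (rule finite_uniform_modulus[OF F e2]) (assumption, rule that)
  obtain d2 where d2: "d2 > 0" "\<And>h x y. h \<in> H \<Longrightarrow> dist x y < d2 \<Longrightarrow> \<bar>h x - h y\<bar> < e/2"
    by (rule finite_uniform_modulus[OF H(1,2) e2]) (assumption, rule that)
  have d12: "d1/2 > 0" "d2/2 > 0" using d1 d2 by auto
  obtain D :: "'x set" where D: "finite D" "\<And>x. \<exists>p\<in>D. dist x p < d1/2"
    using finite_net[OF d12(1), of UNIV] by auto
  obtain i :: "'x \<Rightarrow> 'x" where i: "i \<in> measurable borel (count_space UNIV)"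
    "\<And>x. i x \<in> D \<and> dist x (i x) < d1/2"
    using finite_selection[OF D(1), of "d1/2"] D(2) by metis
  obtain g y where gy: "\<And>c x. c \<in> D \<Longrightarrow> \<pi> x = y c \<Longrightarrow> \<exists>v\<in>ball c (d1/2). dist (\<alpha> g v) x < d2/2"
  proof (rule spread_over_fibres[of x0 D "\<lambda>c. ball c (d1/2)" "d2/2"])
    show "RP x0 x" if "\<pi> x = \<pi> x0" for x by (rule RP[OF that])
  qed (use D(1) d12 that in auto)
  \<comment> \<open>Outside the net any probability measure will do, and \<open>\<mu>\<close> is at
    hand; this makes the choice of \<open>\<rho>\<close> total, so that \<open>K\<close> is a
    kernel.\<close>
  have "\<exists>\<rho>. \<rho> \<in> prob_measures \<and> (c \<in> D \<longrightarrow> (AE x in \<rho>. x \<in> ball c (d1/2)) \<and>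
      (\<forall>h\<in>H. \<bar>\<integral>x. h (\<alpha> g x) \<partial>\<rho>\<bar> \<le> e/2))" for c
  proof (cases "c \<in> D")
    case True
    obtain \<rho> where "\<rho> \<in> prob_measures" "AE x in \<rho>. x \<in> ball c (d1/2)"
      "\<And>h. h \<in> H \<Longrightarrow> \<bar>\<integral>x. h (\<alpha> g x) \<partial>\<rho>\<bar> \<le> e/2"
    proof (rule push_close_to_Haar[of "y c" "ball c (d1/2)" g d2 H "e/2"])
      show "\<exists>v\<in>ball c (d1/2). dist (\<alpha> g v) x < d2/2" if "\<pi> x = y c" for x by (rule gy[OF True that])
      show "\<bar>h x - h y\<bar> \<le> e/2" if "h \<in> H" "dist x y < d2" for h x y using d2(2)[OF that] by simp
    qed (use H d2 in auto)
    then show ?thesis by blast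
  next
    case False
    then show ?thesis using \<mu> by blast
  qed
  then obtain \<rho> where \<rho>: "\<And>c. \<rho> c \<in> prob_measures" "\<And>c. c \<in> D \<Longrightarrow> AE x in \<rho> c. x \<in> ball c (d1/2)"
      "\<And>c h. c \<in> D \<Longrightarrow> h \<in> H \<Longrightarrow> \<bar>\<integral>x. h (\<alpha> g x) \<partial>\<rho> c\<bar> \<le> e/2" by metis
  define K where "K x = \<rho> (i x)" for x
  have K: "K \<in> borel \<rightarrow>\<^sub>M prob_algebra borel"
    unfolding K_def by (rule measurable_compose[OF i(1)]) (use \<rho>(1) in \<open>simp add: prob_measures_def\<close>)
  have e2lt: "e/2 < e" using e by simp
  show thesis
  proof (rule that)
    show "\<mu> \<bind> K \<in> prob_measures" by (rule integral_bind_prob(2)[OF \<mu> K continuous_on_const[of _ 0]])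
  next
    fix f assume f: "f \<in> F"
    have "\<bar>(\<integral>x. f x \<partial>(\<mu> \<bind> K)) - (\<integral>x. f x \<partial>\<mu>)\<bar> \<le> e/2"
      unfolding integral_bind_prob(1)[OF \<mu> K F(2)[OF f]]
    proof (rule integral_diff_le_prob[OF \<mu> integral_bind_prob(3)[OF \<mu> K F(2)[OF f]] integrable_continuous_prob[OF \<mu> F(2)[OF f]]], rule AE_I2)
      fix x
      interpret prob_space "\<rho> (i x)" using prob_measuresD(2)[OF \<rho>(1)] .
      have "\<bar>(\<integral>x'. f x' \<partial>\<rho> (i x)) - (\<integral>x'. f x \<partial>\<rho> (i x))\<bar> \<le> e/2"
      proof (rule integral_diff_le_prob[OF \<rho>(1) integrable_continuous_prob[OF \<rho>(1) F(2)[OF f]]])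
        show "AE x' in \<rho> (i x). \<bar>f x' - f x\<bar> \<le> e/2"
          using \<rho>(2)[OF i(2)[THEN conjunct1]]
        proof eventually_elim
          case (elim x')
          then have "dist x' x < d1"
            using i(2)[of x] dist_triangle_half_r[of "i x" x' d1 x] by (simp add: dist_commute)
          then show ?case using d1(2)[OF f] by (simp add: less_imp_le)
        qed
      qed simp
      then show "\<bar>(\<integral>x. f x \<partial>K x) - f x\<bar> \<le> e/2" by (simp add: K_def prob_space)
    qed
    then show "\<bar>(\<integral>x. f x \<partial>(\<mu> \<bind> K)) - (\<integral>x. f x \<partial>\<mu>)\<bar> < e" using e2lt by linarith
  next
    fix h assume h: "h \<in> H"
    have cont: "continuous_on UNIV (\<lambda>x. h (\<alpha> g x))"
      by (rule continuous_on_compose2[OF H(2)[OF h] act(1)]) simp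
    have "\<bar>(\<integral>x. (\<integral>x'. h (\<alpha> g x') \<partial>K x) \<partial>\<mu>) - (\<integral>x. 0 \<partial>\<mu>)\<bar> \<le> e/2"
      by (rule integral_diff_le_prob[OF \<mu> integral_bind_prob(3)[OF \<mu> K cont]])
         (use \<rho>(3)[OF i(2)[THEN conjunct1] h] in \<open>auto simp: K_def\<close>)
    then show "\<bar>\<integral>x. h (\<alpha> g x) \<partial>(\<mu> \<bind> K)\<bar> < e"
      using integral_bind_prob(1)[OF \<mu> K cont] e2lt by simp
  qed
qed

end

section \<open>Residuality: reduction to the deviations from fibre means\<close>

theorem proposition3p3:
  fixes \<alpha> :: "'g::ab_group_add \<Rightarrow> 'x::compact_metric_space \<Rightarrow> 'x"
    and \<beta> :: "'g \<Rightarrow> 's::compact_metric_space \<Rightarrow> 's"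
    and \<gamma> :: "'g \<Rightarrow> 'y::compact_metric_space \<Rightarrow> 'y"
    and \<phi> :: "'x \<Rightarrow> 'y" and \<pi> :: "'x \<Rightarrow> 's" and \<theta> :: "'s \<Rightarrow> 'y"
    and \<tau> :: "'g \<Rightarrow> 't::t2_space \<Rightarrow> 't"
    and \<kappa> :: "'k::{topological_group_add,t2_space} \<Rightarrow> 't \<Rightarrow> 't"
    and L :: "'k set" and \<psi> :: "'t \<Rightarrow> 'x"
    and hm :: "'s \<Rightarrow> 'x measure"
  assumes "minimal_system euclidean \<alpha>"
    and "maximal_equicontinuous_factor euclidean \<alpha> euclidean \<gamma> \<phi>"
    and "infinite (UNIV :: 'y set)"
    and "dynamical_system euclidean \<beta>"
    and "equicontinuous_extension euclidean \<alpha> euclidean \<beta> \<pi>"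
    and "almost_one_to_one_extension euclidean \<beta> euclidean \<gamma> \<theta>"
    and "\<phi> = \<theta> \<circ> \<pi>"
    and "homogeneous_presentation \<alpha> \<beta> \<pi> \<tau> \<kappa> L \<psi>"
    and "fibre_Haar_measures \<pi> \<kappa> \<psi> hm"
  shows "let MM = integrate_section hm ` prob_measures;
             R = {\<nu> \<in> prob_measures.
                    weak_star_topology closure_of measure_orbit \<alpha> \<nu> \<inter> MM \<noteq> {}}
         in gdelta_in weak_star_topology R \<and>
            weak_star_topology closure_of R = topspace weak_star_topology"
proof -
  interpret Haar_extension \<alpha> \<beta> \<pi> \<tau> \<kappa> L \<psi> hm
    using assms by unfold_locales (auto simp: equicontinuous_extension_def)
  \<comment> \<open>A dense subset of a nonempty space is nonempty; one such point is all that is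
    used of the almost 1-1 property.\<close>
  obtain y0 where y0: "is_singleton {s. \<theta> s = y0}"
  proof -
    have "closure {y. is_singleton {s. \<theta> s = y}} = UNIV"
      using assms(6) unfolding almost_one_to_one_extension_def Let_def by simp
    then show thesis using that by (metis (no_types, lifting) Collect_empty_eq UNIV_not_empty closure_empty)
  qed
  have "extension euclidean \<alpha> euclidean \<gamma> \<phi>"
    using assms(2) by (simp add: maximal_equicontinuous_factor_def)
  then obtain x0 where x0: "\<phi> x0 = y0" unfolding extension_def by simp (metis surjD)
  interpret automorphic_point \<alpha> \<beta> \<pi> \<tau> \<kappa> L \<psi> \<gamma> \<phi> x0
  proof unfold_locales
    show "maximal_equicontinuous_factor euclidean \<alpha> euclidean \<gamma> \<phi>" by fact
    obtain s where s: "{s. \<theta> s = y0} = {s}" using y0 by (rule is_singletonE)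
    show "\<phi> x = \<phi> x0 \<longleftrightarrow> \<pi> x = \<pi> x0" for x
    proof
      assume "\<phi> x = \<phi> x0"
      then have "\<pi> x \<in> {s. \<theta> s = y0}" "\<pi> x0 \<in> {s. \<theta> s = y0}" using x0 assms(7) by auto
      then show "\<pi> x = \<pi> x0" using s by auto
    qed (simp add: assms(7))
  qed
  obtain f :: "nat \<Rightarrow> 'x \<Rightarrow> real" where f: "\<And>j. continuous_on UNIV (f j)"
    and det: "\<And>\<mu> \<nu>. \<mu> \<in> prob_measures \<Longrightarrow> \<nu> \<in> prob_measures \<Longrightarrow>
       \<forall>j. (\<integral>x. f j x \<partial>\<mu>) = (\<integral>x. f j x \<partial>\<nu>) \<Longrightarrow> \<mu> = \<nu>"
    by (rule countable_determining_family) (rule that)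
  define h where "h j x = f j x - fibre_mean (f j) x" for j x
  have cont_h: "continuous_on UNIV (h j)" for j
    unfolding h_def by (intro continuous_intros f cont_fibre_mean)
  interpret measure_action \<alpha> h
    by unfold_locales (use act cont_h in auto)
  have MM: "integrate_section hm ` prob_measures = null_measures"
    unfolding null_measures_def h_def by (rule integrate_section_eq[OF _ f]) (rule det)
  have "weak_star_topology closure_of approaching = topspace weak_star_topology"
  proof (rule approaching_dense)
    fix \<mu> :: "'x measure" and F :: "('x \<Rightarrow> real) set" and n and e :: real
    assume *: "\<mu> \<in> prob_measures" "finite F" "\<And>f. f \<in> F \<Longrightarrow> continuous_on UNIV f" "e > 0"
    obtain \<mu>' g where "\<mu>' \<in> prob_measures" "\<And>f. f \<in> F \<Longrightarrow> \<bar>(\<integral>x. f x \<partial>\<mu>') - (\<integral>x. f x \<partial>\<mu>)\<bar> < e"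
      "\<And>k. k \<in> h ` {..n} \<Longrightarrow> \<bar>\<integral>x. k (\<alpha> g x) \<partial>\<mu>'\<bar> < e"
    proof (rule approximation_step[OF fibre_RP *(1,2,3), of "h ` {..n}" e])
      show "(\<integral>x. k x \<partial>hm y) = 0" if "k \<in> h ` {..n}" for k y
        using that integral_fibre_deviation[OF f] by (auto simp: h_def)
    qed (use cont_h *(4) in auto)
    then show "\<exists>\<mu>'\<in>prob_measures. (\<forall>f\<in>F. \<bar>(\<integral>x. f x \<partial>\<mu>') - (\<integral>x. f x \<partial>\<mu>)\<bar> < e) \<and>
         (\<exists>g. \<forall>j\<le>n. \<bar>\<integral>x. h j (\<alpha> g x) \<partial>\<mu>'\<bar> < e)" by (metis atMost_iff imageI)
  qed
  then show ?thesis
    using gdelta_in_approaching unfolding Let_def MM approaching_def by blast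
qed

end
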